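(* Let $1<p<\infty$ and let $Z$ be a real Banach space that uniformly contains the spaces $\ell_p^n$, $n\in\mathbb{N}$. Then, for each $n\in\mathbb{N}$, the set of $n$-point subsets of $\ell_p$ that do not embed isometrically into $Z$ (that is, the set of $n$-tuples $(x_1,\dots,x_n)$ of pairwise distinct points of $\ell_p$ such that $\{x_1,\dots,x_n\}$, with the metric inherited from $\ell_p$, does not embed isometrically into $Z$) is a nowhere dense and Haar null subset of $\underbrace{\ell_p\times\dots\times\ell_p}_{n\text{ times}}$.
   Context: All Banach spaces are real. $\ell_p$ is the space of real $p$-summable sequences with its usual norm, and $\ell_p^n$ is $\mathbb{R}^n$ with the $p$-norm. A Banach space $X$ is $C$-isomorphic to a Banach space $Y$ if there is a linear isomorphism $T:X\to Y$ with $\|T\|\,\|T^{-1}\|\le C$. A Banach space $Z$ uniformly contains the spaces $\ell_p^n$, $n\in\mathbb{N}$, if there are a constant $C$ and subspaces $Y_n$ of $Z$ such that $Y_n$ is $C$-isomorphic to $\ell_p^n$ for all $n\in\mathbb{N}$. An isometric embedding of a metric space into a Banach space is a (not necessarily linear) distance-preserving map. The $n$-point subsets of $\ell_p$ are regarded as $n$-tuples of points, i.e. as elements of the Banach space $\ell_p\times\dots\times\ell_p$ ($n$ factors, with any of the usual equivalent product norms). A Borel subset $A$ of a separable Banach space $X$ is Haar null if there is a Borel probability measure $\mu$ on $X$ such that $\mu(x+A)=0$ for every $x\in X$. An arbitrary subset of $X$ is called Haar null if it is contained in a Borel Haar null set. *)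

theory Defs
  imports "HOL-Probability.Probability" "HOL-Library.Function_Algebras"
begin

text \<open>
  The exponent \<open>p\<close> and the length of tuples are term-level parameters, so the spaces involved are
  not types. A normed space is given by a linear subspace \<open>V\<close> of a type of class
  \<^class>\<open>real_vector\<close> and a function \<open>N\<close> that is a norm on \<open>V\<close>. Sequences and tuples of sequences are
  functions, for which the pointwise vector space structure is needed.
\<close>

instantiation "fun" :: (type, real_vector) real_vector
begin

definition "c *\<^sub>R f = (\<lambda>x. c *\<^sub>R f x)" for f :: "'a \<Rightarrow> 'b"

instance
  by standard (auto simp: scaleR_fun_def fun_eq_iff scaleR_add_right scaleR_add_left)

end


section \<open>Normed spaces on subspaces\<close>

definition norm_topology :: "'a::real_vector set \<Rightarrow> ('a \<Rightarrow> real) \<Rightarrow> 'a topology"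
  where "norm_topology V N = Metric_space.mtopology V (\<lambda>x y. N (x - y))"

definition norm_borel :: "'a::real_vector set \<Rightarrow> ('a \<Rightarrow> real) \<Rightarrow> 'a measure"
  where "norm_borel V N = sigma V {U. openin (norm_topology V N) U}"

definition nowhere_dense_in :: "'a topology \<Rightarrow> 'a set \<Rightarrow> bool"
  where "nowhere_dense_in X A \<longleftrightarrow> A \<subseteq> topspace X \<and> X interior_of (X closure_of A) = {}"

text \<open>Membership in \<^const>\<open>null_sets\<close> says that the translate is measurable and has measure zero.\<close>

definition borel_haar_null :: "'a::real_vector set \<Rightarrow> ('a \<Rightarrow> real) \<Rightarrow> 'a set \<Rightarrow> bool"
  where "borel_haar_null V N B \<longleftrightarrow>
    B \<in> sets (norm_borel V N) \<and>
    (\<exists>\<mu>. prob_space \<mu> \<and> sets \<mu> = sets (norm_borel V N) \<and>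
         (\<forall>x\<in>V. (+) x ` B \<in> null_sets \<mu>))"

definition haar_null :: "'a::real_vector set \<Rightarrow> ('a \<Rightarrow> real) \<Rightarrow> 'a set \<Rightarrow> bool"
  where "haar_null V N A \<longleftrightarrow> (\<exists>B. A \<subseteq> B \<and> borel_haar_null V N B)"

definition bounded_linear_between ::
    "'a::real_vector set \<Rightarrow> ('a \<Rightarrow> real) \<Rightarrow> 'b::real_vector set \<Rightarrow> ('b \<Rightarrow> real) \<Rightarrow> ('a \<Rightarrow> 'b) \<Rightarrow> bool"
  where "bounded_linear_between V N W M T \<longleftrightarrow>
    T \<in> V \<rightarrow> W \<and>
    (\<forall>x\<in>V. \<forall>y\<in>V. T (x + y) = T x + T y) \<and>
    (\<forall>c. \<forall>x\<in>V. T (c *\<^sub>R x) = c *\<^sub>R T x) \<and>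
    (\<exists>K. \<forall>x\<in>V. M (T x) \<le> K * N x)"

text \<open>As in \<^const>\<open>onorm\<close>, the quotient is \<open>0\<close> for \<open>x = 0\<close>.\<close>

definition op_norm :: "'a set \<Rightarrow> ('a \<Rightarrow> real) \<Rightarrow> ('b \<Rightarrow> real) \<Rightarrow> ('a \<Rightarrow> 'b) \<Rightarrow> real"
  where "op_norm V N M T = (SUP x\<in>V. M (T x) / N x)"

definition C_isomorphic ::
    "real \<Rightarrow> 'a::real_vector set \<Rightarrow> ('a \<Rightarrow> real) \<Rightarrow> 'b::real_vector set \<Rightarrow> ('b \<Rightarrow> real) \<Rightarrow> bool"
  where "C_isomorphic C V N W M \<longleftrightarrow>
    (\<exists>T S. bounded_linear_between V N W M T \<and> bounded_linear_between W M V N S \<and>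
       (\<forall>x\<in>V. S (T x) = x) \<and> (\<forall>y\<in>W. T (S y) = y) \<and>
       op_norm V N M T * op_norm W M N S \<le> C)"


section \<open>Sequence spaces and tuples\<close>

definition lp_space :: "real \<Rightarrow> (nat \<Rightarrow> real) set"
  where "lp_space p = {x. summable (\<lambda>i. \<bar>x i\<bar> powr p)}"

definition lp_norm :: "real \<Rightarrow> (nat \<Rightarrow> real) \<Rightarrow> real"
  where "lp_norm p x = (\<Sum>i. \<bar>x i\<bar> powr p) powr (1 / p)"

text \<open>\<open>\<real>\<^sup>n\<close> is represented by the sequences vanishing from index \<open>n\<close> on; likewise for \<open>n\<close>-tuples.\<close>

definition lp_fin_space :: "nat \<Rightarrow> (nat \<Rightarrow> real) set"
  where "lp_fin_space n = {x. \<forall>i\<ge>n. x i = 0}"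

definition lp_fin_norm :: "real \<Rightarrow> nat \<Rightarrow> (nat \<Rightarrow> real) \<Rightarrow> real"
  where "lp_fin_norm p n x = (\<Sum>i<n. \<bar>x i\<bar> powr p) powr (1 / p)"

definition tuples :: "nat \<Rightarrow> 'a::real_vector set \<Rightarrow> (nat \<Rightarrow> 'a) set"
  where "tuples n V = {x. (\<forall>i<n. x i \<in> V) \<and> (\<forall>i\<ge>n. x i = 0)}"

definition tuple_norm :: "nat \<Rightarrow> ('a \<Rightarrow> real) \<Rightarrow> (nat \<Rightarrow> 'a) \<Rightarrow> real"
  where "tuple_norm n N x = (\<Sum>i<n. N (x i))"

definition uniformly_contains_lp :: "real \<Rightarrow> 'z::real_normed_vector set \<Rightarrow> bool"
  where "uniformly_contains_lp p Z \<longleftrightarrow>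
    (\<exists>C. \<forall>n. \<exists>Y. subspace Y \<and> Y \<subseteq> Z \<and>
       C_isomorphic C Y norm (lp_fin_space n) (lp_fin_norm p n))"

definition embeds_isometrically ::
    "'a set \<Rightarrow> ('a \<Rightarrow> 'a \<Rightarrow> real) \<Rightarrow> 'z::metric_space set \<Rightarrow> bool"
  where "embeds_isometrically S d Z \<longleftrightarrow>
    (\<exists>f \<in> S \<rightarrow> Z. \<forall>u\<in>S. \<forall>v\<in>S. dist (f u) (f v) = d u v)"

definition nonembeddable_tuples :: "real \<Rightarrow> nat \<Rightarrow> 'z::real_normed_vector set \<Rightarrow> (nat \<Rightarrow> nat \<Rightarrow> real) set"
  where "nonembeddable_tuples p n Z = {x \<in> tuples n (lp_space p). inj_on x {..<n} \<and>
    \<not> embeds_isometrically (x ` {..<n}) (\<lambda>u v. lp_norm p (u - v)) Z}"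


section \<open>The norms induce metrics\<close>

text \<open>
  \<^const>\<open>Metric_space.mtopology\<close> is meaningful only for a metric, so this is checked here for the
  finite powers of \<open>\<ell>\<^sub>p\<close>.
\<close>

lemma lp_space_iff: "x \<in> lp_space p \<longleftrightarrow> summable (\<lambda>i. \<bar>x i\<bar> powr p)"
  by (simp add: lp_space_def)

lemma lp_norm_nonneg: "0 \<le> lp_norm p x"
  by (simp add: lp_norm_def)

lemma lp_norm_minus_commute: "lp_norm p (x - y) = lp_norm p (y - x)"
  by (simp add: lp_norm_def abs_minus_commute)

lemma lp_norm_eq_0_iff:
  assumes "1 < p" "x \<in> lp_space p"
  shows "lp_norm p x = 0 \<longleftrightarrow> x = 0"
proof -
  have "lp_norm p x = 0 \<longleftrightarrow> (\<Sum>i. \<bar>x i\<bar> powr p) = 0"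
    by (simp add: lp_norm_def)
  also have "\<dots> \<longleftrightarrow> (\<forall>i. \<bar>x i\<bar> powr p = 0)"
    using assms(2) by (intro suminf_eq_zero_iff) (auto simp: lp_space_iff)
  also have "\<dots> \<longleftrightarrow> x = 0"
    by (auto simp: fun_eq_iff)
  finally show ?thesis .
qed

lemma lp_norm_powr:
  assumes "1 < p" "x \<in> lp_space p"
  shows "lp_norm p x powr p = (\<Sum>i. \<bar>x i\<bar> powr p)"
  using assms by (simp add: lp_norm_def powr_powr suminf_nonneg lp_space_iff)

lemma convex_on_powr_nonneg:
  assumes "1 < p"
  shows "convex_on {0..} (\<lambda>t::real. t powr p)"
proof (rule convex_onI)
  fix t x y :: real
  assume t: "0 < t" "t < 1" and xy: "x \<in> {0..}" "y \<in> {0..}"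
  have le: "c powr p \<le> c" if "0 < c" "c < 1" for c :: real
    using powr_mono'[of 1 p c] that assms by simp
  consider "x = 0" | "y = 0" | "0 < x" "0 < y"
    using xy by force
  then show "((1 - t) *\<^sub>R x + t *\<^sub>R y) powr p \<le> (1 - t) * x powr p + t * y powr p"
  proof cases
    case 1
    then show ?thesis
      using le[of t] t xy by (simp add: powr_mult mult_right_mono)
  next
    case 2
    then show ?thesis
      using le[of "1 - t"] t xy by (simp add: powr_mult mult_right_mono)
  next
    case 3
    then show ?thesis
      using convex_onD[OF powr_convex, of p t x y] t assms by simp
  qed
qed simp

lemma abs_add_powr_le:
  fixes a b :: real
  assumes "1 < p" "0 < A" "0 < B"
  shows "\<bar>a + b\<bar> powr p \<le>
    (A + B) powr p * (A / (A + B) * (\<bar>a\<bar> powr p / A powr p) + B / (A + B) * (\<bar>b\<bar> powr p / B powr p))"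
proof -
  have conv: "convex_on {0..} (\<lambda>t::real. t powr p)"
    using assms(1) by (rule convex_on_powr_nonneg)
  have AB: "1 - B / (A + B) = A / (A + B)"
    using assms by (simp add: field_simps)
  have "((1 - B / (A + B)) *\<^sub>R (\<bar>a\<bar> / A) + (B / (A + B)) *\<^sub>R (\<bar>b\<bar> / B)) powr p
      \<le> (1 - B / (A + B)) * (\<bar>a\<bar> / A) powr p + (B / (A + B)) * (\<bar>b\<bar> / B) powr p"
    using assms by (intro convex_onD[OF conv]) auto
  then have le: "(A / (A + B) * (\<bar>a\<bar> / A) + B / (A + B) * (\<bar>b\<bar> / B)) powr p
      \<le> A / (A + B) * (\<bar>a\<bar> powr p / A powr p) + B / (A + B) * (\<bar>b\<bar> powr p / B powr p)"
    using assms unfolding AB by (simp add: powr_divide)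
  have eq: "A / (A + B) * (\<bar>a\<bar> / A) + B / (A + B) * (\<bar>b\<bar> / B) = (\<bar>a\<bar> + \<bar>b\<bar>) / (A + B)"
    using assms by (simp add: add_divide_distrib)
  have "\<bar>a + b\<bar> powr p \<le> (\<bar>a\<bar> + \<bar>b\<bar>) powr p"
    using assms by (intro powr_mono2) auto
  also have "\<dots> = (A + B) powr p * ((\<bar>a\<bar> + \<bar>b\<bar>) / (A + B)) powr p"
    using assms by (simp add: powr_divide)
  also have "\<dots> \<le> (A + B) powr p *
      (A / (A + B) * (\<bar>a\<bar> powr p / A powr p) + B / (A + B) * (\<bar>b\<bar> powr p / B powr p))"
    using le unfolding eq by (intro mult_left_mono) auto
  finally show ?thesis .
qed

lemma
  assumes p: "1 < p" and x: "x \<in> lp_space p" and y: "y \<in> lp_space p"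
  shows lp_space_add: "x + y \<in> lp_space p"
    and lp_norm_triangle: "lp_norm p (x + y) \<le> lp_norm p x + lp_norm p y"
proof -
  define rhs where "rhs A B = (\<lambda>i. (A + B) powr p *
    (A / (A + B) * (\<bar>x i\<bar> powr p / A powr p) + B / (A + B) * (\<bar>y i\<bar> powr p / B powr p)))" for A B :: real
  have rhs_summable: "summable (rhs A B)" for A B
    unfolding rhs_def using x y
    by (intro summable_mult summable_add summable_divide) (auto simp: lp_space_iff)
  have le: "\<bar>(x + y) i\<bar> powr p \<le> rhs A B i" if "0 < A" "0 < B" for A B i
    unfolding rhs_def plus_fun_def using abs_add_powr_le[OF p that] .
  show mem: "x + y \<in> lp_space p"
    unfolding lp_space_iff
    by (rule summable_comparison_test'[OF rhs_summable[of 1 1], of 0]) (use le[of 1 1] in auto)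
  show "lp_norm p (x + y) \<le> lp_norm p x + lp_norm p y"
  proof (cases "x = 0 \<or> y = 0")
    case True
    then show ?thesis by (auto simp: lp_norm_nonneg)
  next
    case False
    define A B where "A = lp_norm p x" and "B = lp_norm p y"
    have A: "0 < A" and B: "0 < B"
      using False lp_norm_eq_0_iff[OF p x] lp_norm_eq_0_iff[OF p y]
        lp_norm_nonneg[of p x] lp_norm_nonneg[of p y]
      unfolding A_def B_def by linarith+
    have sums: "(\<lambda>i. \<bar>x i\<bar> powr p) sums (A powr p)" "(\<lambda>i. \<bar>y i\<bar> powr p) sums (B powr p)"
      using x y p unfolding A_def B_def by (auto simp: lp_norm_powr lp_space_iff summable_sums)
    have "rhs A B sums ((A + B) powr p *
        (A / (A + B) * (A powr p / A powr p) + B / (A + B) * (B powr p / B powr p)))"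
      unfolding rhs_def by (intro sums_mult sums_add sums_divide sums)
    also have "(A + B) powr p *
        (A / (A + B) * (A powr p / A powr p) + B / (A + B) * (B powr p / B powr p)) = (A + B) powr p"
      using A B by (simp flip: add_divide_distrib)
    finally have rhs: "rhs A B sums ((A + B) powr p)" .
    have "(\<Sum>i. \<bar>(x + y) i\<bar> powr p) \<le> (\<Sum>i. rhs A B i)"
      using le[OF A B] mem rhs_summable by (intro suminf_le) (auto simp: lp_space_iff)
    then have "(\<Sum>i. \<bar>(x + y) i\<bar> powr p) \<le> (A + B) powr p"
      using sums_unique[OF rhs] by simp
    moreover have "0 \<le> (\<Sum>i. \<bar>(x + y) i\<bar> powr p)"
      using mem by (intro suminf_nonneg) (auto simp: lp_space_iff)
    ultimately have "lp_norm p (x + y) \<le> ((A + B) powr p) powr (1 / p)"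
      unfolding lp_norm_def using p by (intro powr_mono2) auto
    also have "\<dots> = A + B"
      using A B p by (simp add: powr_powr)
    finally show ?thesis by (simp add: A_def B_def)
  qed
qed

lemma subspace_lp_space: "1 < p \<Longrightarrow> subspace (lp_space p)"
  by (auto simp: subspace_def lp_space_add) 
     (auto simp: lp_space_iff scaleR_fun_def abs_mult powr_mult)

lemma subspace_tuples: "subspace V \<Longrightarrow> subspace (tuples n V)"
  by (auto simp: subspace_def tuples_def scaleR_fun_def)

lemma Metric_space_lp_tuples:
  assumes p: "1 < p"
  shows "Metric_space (tuples n (lp_space p)) (\<lambda>x y. tuple_norm n (lp_norm p) (x - y))"
proof
  note V = subspace_lp_space[OF p]
  show "0 \<le> tuple_norm n (lp_norm p) (x - y)" for x y
    by (simp add: tuple_norm_def sum_nonneg lp_norm_nonneg)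
  show "tuple_norm n (lp_norm p) (x - y) = tuple_norm n (lp_norm p) (y - x)" for x y
    by (simp add: tuple_norm_def lp_norm_minus_commute)
  fix x y z
  assume x: "x \<in> tuples n (lp_space p)" and y: "y \<in> tuples n (lp_space p)"
  have "tuple_norm n (lp_norm p) (x - y) = 0 \<longleftrightarrow> (\<forall>i<n. lp_norm p (x i - y i) = 0)"
    by (auto simp: tuple_norm_def sum_nonneg_eq_0_iff lp_norm_nonneg)
  also have "\<dots> \<longleftrightarrow> (\<forall>i<n. x i = y i)"
    using x y by (simp add: lp_norm_eq_0_iff[OF p] subspace_diff[OF V] tuples_def)
  also have "\<dots> \<longleftrightarrow> x = y"
    using x y by (auto simp: fun_eq_iff[of x y] tuples_def) (metis not_le)
  finally show "tuple_norm n (lp_norm p) (x - y) = 0 \<longleftrightarrow> x = y" .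
  assume z: "z \<in> tuples n (lp_space p)"
  have "lp_norm p (x i - z i) \<le> lp_norm p (x i - y i) + lp_norm p (y i - z i)" if "i < n" for i
    using lp_norm_triangle[OF p, of "x i - y i" "y i - z i"] x y z that
    by (simp add: subspace_diff[OF V] tuples_def)
  then show "tuple_norm n (lp_norm p) (x - z)
      \<le> tuple_norm n (lp_norm p) (x - y) + tuple_norm n (lp_norm p) (y - z)"
    unfolding tuple_norm_def sum.distrib[symmetric] by (intro sum_mono) auto
qed

end

theory Submission
  imports Defs "HOL-Homology.Brouwer_Degree" "Jordan_Normal_Form.Determinant"
begin

text \<open>
  The space \<open>Z\<close> contains almost isometric copies of every \<open>\<ell>\<^sub>p\<^sup>k\<close> (Krivine's theorem in the case of
  uniformly isomorphic copies). Along the given isomorphic copies, iterated ultrafilter limits give a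
  norm on finite sequences that is insensitive to inserting zeros. Passing to blocks
  \<open>(1, -1, 1, -1, \<dots>)\<close> makes it invariant under signs in the limit. Passing to blocks that are almost
  eigenvectors of the operators ``repeat every block \<open>q\<close> times'', for all primes \<open>q\<close> at once, makes
  \<open>q\<close> equal consecutive entries \<open>t\<close> replaceable by the single entry \<open>q\<^sup>1\<^sup>/\<^sup>p t\<close>, and the only norm with
  this property is a multiple of the \<open>\<ell>\<^sub>p\<close> norm. All these operations preserve finite
  representability in \<open>Z\<close>.

  If the map from tuples to distances has a surjective derivative at \<open>x\<close>, then a topological
  covering argument corrects the small errors made by an almost isometric copy, so that the points
  of \<open>x\<close> embed isometrically. Surjectivity holds as soon as certain determinants in the first \<open>n\<close>
  coordinates do not vanish. This is an open condition, and it holds almost surely after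
  translating by a random tuple with independent uniform coordinates.
\<close>

section \<open>Almost isometric copies of finite-dimensional \<open>\<ell>\<^sub>p\<close> spaces\<close>

text \<open>Krivine's theorem for a general space has to find its eigenvectors by a spectral
  argument. Here the upper \<open>l_p\<close> estimate makes every \<open>N\<close> in play
  1-Lipschitz for the \<open>l_p\<close> norm (\<open>lp_like_Lipschitz\<close>). So it suffices to
  write down almost eigenvectors of the repetition operators in \<open>l_p\<close> itself, where the
  eigenvalue \<open>q powr (1 / p)\<close> is known. They come from arithmetic weights
  \<open>v\<close> with \<open>v (q * j)\<close> close to \<open>q * v j\<close> in mean, for all
  primes up to a bound at once. The lower estimate keeps the limits away from 0. An almost isometric
  copy controls the norm of \<open>'z\<close> only uniformly, and this norm need not be
  differentiable. The map from corrections to distances is close to the identity merely as a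
  continuous map; non-contractibility of spheres therefore takes the place of an inverse function
  theorem. The determinants are arranged so that each has an entry that can be varied alone. This
  gives generic non-vanishing although the derivative of the \<open>p\<close>-th power of the
  modulus need not be analytic at 0.\<close>

lemma powr_add_le_add_powr:
  fixes x y p :: real
  assumes "1 \<le> p" "0 \<le> x" "0 \<le> y"
  shows "x powr p + y powr p \<le> (x + y) powr p"
proof -
  have split: "t powr p = t * t powr (p - 1)" if "0 \<le> t" for t :: real
    using that powr_add[of t 1 "p - 1"] by (cases "t = 0") auto
  have "x * x powr (p - 1) + y * y powr (p - 1) \<le> x * (x + y) powr (p - 1) + y * (x + y) powr (p - 1)"
    using assms by (intro add_mono mult_left_mono powr_mono2) auto
  then show ?thesis
    using assms by (simp add: split distrib_right)
qed

text \<open>Superadditivity of \<open>t powr p\<close>, applied to the \<open>p\<close>-th roots. It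
  turns an \<open>l_1\<close> estimate for weights into an \<open>l_p\<close> estimate for their
  roots, as needed for the dilation weights and for the rounding of \<open>p\<close>-th
  powers.\<close>

lemma abs_diff_powr_inverse_le:
  fixes a b p :: real
  assumes "1 \<le> p" "0 \<le> a" "0 \<le> b"
  shows "\<bar>a powr (1 / p) - b powr (1 / p)\<bar> powr p \<le> \<bar>a - b\<bar>"
proof -
  have *: "\<bar>a powr (1 / p) - b powr (1 / p)\<bar> powr p \<le> \<bar>a - b\<bar>" if "0 \<le> b" "b \<le> a" for a b :: real
  proof -
    have le: "b powr (1 / p) \<le> a powr (1 / p)"
      using that assms(1) by (intro powr_mono2) auto
    have "(a powr (1 / p) - b powr (1 / p)) powr p + (b powr (1 / p)) powr p \<le> (a powr (1 / p)) powr p"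
      using powr_add_le_add_powr[OF assms(1), of "a powr (1 / p) - b powr (1 / p)" "b powr (1 / p)"] le
      by simp
    then show ?thesis
      using le that assms(1) by (simp add: powr_powr)
  qed
  show ?thesis
    using *[of a b] *[of b a] assms by (cases "b \<le> a") (auto simp: abs_minus_commute)
qed

subsection \<open>A free ultrafilter\<close>

text \<open>Zorn's lemma for the proper filters finer than \<open>sequentially\<close>. Smaller
  filters are finer, so an ultrafilter is a minimal element. A nonempty chain is a base of its
  infimum, which is therefore proper and bounds the chain.\<close>

lemma free_ultrafilter_exists:
  "\<exists>F. F \<le> sequentially \<and> F \<noteq> bot \<and> (\<forall>P. eventually P F \<or> eventually (\<lambda>n. \<not> P n) F)"
proof -
  define A where "A = {F. F \<le> sequentially \<and> F \<noteq> bot}"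
  let ?r = "relation_of (\<lambda>F G. G \<le> F) A"
  have "partial_order_on A ?r"
    by (rule partial_order_on_relation_ofI) auto
  moreover have "\<exists>G\<in>A. \<forall>F\<in>C. G \<le> F" if C: "C \<in> Chains ?r" for C
  proof (cases "C = {}")
    case True
    have "sequentially \<in> A" by (simp add: A_def)
    with True show ?thesis by auto
  next
    case False
    have CA: "C \<subseteq> A" using C by (rule Chains_relation_of)
    have chain: "F \<le> G \<or> G \<le> F" if "F \<in> C" "G \<in> C" for F G
      using C that unfolding Chains_def relation_of_def by auto
    have base: "\<exists>H\<in>C. H \<le> inf F G" if "F \<in> C" "G \<in> C" for F G
      using chain[OF that] that by (metis inf.absorb1 inf.absorb2 order_refl)
    have "Inf C \<noteq> bot"
      using CA eventually_Inf_base[OF False base, of "\<lambda>_. False"]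
      by (auto simp: A_def trivial_limit_def)
    moreover have "Inf C \<le> sequentially"
      using False CA by (auto simp: A_def intro: Inf_lower2)
    ultimately show ?thesis
      by (auto simp: A_def intro!: bexI[of _ "Inf C"] Inf_lower)
  qed
  ultimately have "\<exists>F\<in>A. \<forall>G\<in>A. G \<le> F \<longrightarrow> G = F"
    by (rule predicate_Zorn)
  then obtain F where F: "F \<in> A" and min: "\<And>G. G \<in> A \<Longrightarrow> G \<le> F \<Longrightarrow> G = F"
    by blast
  \<comment> \<open>If the negation of \<open>P\<close> does not hold eventually, \<open>F\<close>
    can be refined by \<open>P\<close>; by minimality the refinement is \<open>F\<close>
    itself.\<close>
  have "eventually P F" if "\<not> eventually (\<lambda>n. \<not> P n) F" for P
  proof -
    have "inf F (principal {n. P n}) \<noteq> bot"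
      using that by (simp add: trivial_limit_def eventually_inf_principal)
    then have "inf F (principal {n. P n}) \<in> A"
      using F by (auto simp: A_def intro: le_infI1)
    then have "inf F (principal {n. P n}) = F"
      using min by simp
    moreover have "eventually P (inf F (principal {n. P n}))"
      by (simp add: eventually_inf_principal)
    ultimately show ?thesis by simp
  qed
  then show ?thesis
    using F by (auto simp: A_def)
qed

definition free_ultra :: "nat filter"
  where "free_ultra = (SOME F. F \<le> sequentially \<and> F \<noteq> bot \<and>
    (\<forall>P. eventually P F \<or> eventually (\<lambda>n. \<not> P n) F))"

lemma
  shows free_ultra_le: "free_ultra \<le> sequentially"
    and free_ultra_neq_bot: "free_ultra \<noteq> bot"
    and eventually_free_ultra_cases: "eventually P free_ultra \<or> eventually (\<lambda>n. \<not> P n) free_ultra"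
  unfolding free_ultra_def using someI_ex[OF free_ultrafilter_exists] by blast+

lemma free_ultra_eventually: "eventually P sequentially \<Longrightarrow> eventually P free_ultra"
  using free_ultra_le by (rule filter_leD)

text \<open>Compactness of the interval gives a cluster point, and along an ultrafilter a cluster
  point is a limit. Stating this for \<open>Lim\<close> allows limits to be used in definitions and
  their bounds to be read off afterwards.\<close>

lemma free_ultra_converges:
  fixes f :: "nat \<Rightarrow> real"
  assumes "eventually (\<lambda>n. a \<le> f n \<and> f n \<le> b) free_ultra"
  shows "(f \<longlongrightarrow> Lim free_ultra f) free_ultra \<and> a \<le> Lim free_ultra f \<and> Lim free_ultra f \<le> b"
proof -
  have "filtermap f free_ultra \<noteq> bot"
    by (simp add: filtermap_bot_iff free_ultra_neq_bot)
  moreover have "eventually (\<lambda>x. x \<in> {a..b}) (filtermap f free_ultra)"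
    using assms by (simp add: eventually_filtermap)
  ultimately obtain l where l: "inf (nhds l) (filtermap f free_ultra) \<noteq> bot"
    using compact_Icc[of a b] unfolding compact_filter by blast
  have "(f \<longlongrightarrow> l) free_ultra"
  proof (rule topological_tendstoI)
    fix S assume S: "open S" "l \<in> S"
    show "eventually (\<lambda>n. f n \<in> S) free_ultra"
    proof (rule ccontr)
      assume "\<not> ?thesis"
      then have "eventually (\<lambda>n. f n \<notin> S) free_ultra"
        using eventually_free_ultra_cases[of "\<lambda>n. f n \<in> S"] by blast
      then have "eventually (\<lambda>x. x \<notin> S) (filtermap f free_ultra)"
        by (simp add: eventually_filtermap)
      moreover have "eventually (\<lambda>x. x \<in> S) (nhds l)"
        using S by (simp add: eventually_nhds_in_open)
      ultimately have "eventually (\<lambda>x. False) (inf (nhds l) (filtermap f free_ultra))"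
        unfolding eventually_inf by (intro exI[of _ "\<lambda>x. x \<in> S"] exI[of _ "\<lambda>x. x \<notin> S"]) auto
      with l show False by (simp add: eventually_False)
    qed
  qed
  then have lim: "(f \<longlongrightarrow> Lim free_ultra f) free_ultra"
    using tendsto_Lim[OF free_ultra_neq_bot] by blast
  moreover have "a \<le> Lim free_ultra f"
    using assms by (intro tendsto_lowerbound[OF lim _ free_ultra_neq_bot]) (auto elim: eventually_mono)
  moreover have "Lim free_ultra f \<le> b"
    using assms by (intro tendsto_upperbound[OF lim _ free_ultra_neq_bot]) (auto elim: eventually_mono)
  ultimately show ?thesis by blast
qed

subsection \<open>Functions on finite sequences\<close>

definition lp_sum :: "real \<Rightarrow> real list \<Rightarrow> real"
  where "lp_sum p xs = (\<Sum>x\<leftarrow>xs. \<bar>x\<bar> powr p)"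

definition lp_list :: "real \<Rightarrow> real list \<Rightarrow> real"
  where "lp_list p xs = lp_sum p xs powr (1 / p)"

primrec lin_comb :: "(nat \<Rightarrow> 'z::real_vector) \<Rightarrow> real list \<Rightarrow> 'z" where
  "lin_comb z [] = 0"
| "lin_comb z (x # xs) = x *\<^sub>R z 0 + lin_comb (\<lambda>i. z (Suc i)) xs"

text \<open>The coefficients of a vector given along the consecutive blocks of pattern
  \<open>w\<close>; see \<open>lin_comb_block_subst\<close>.\<close>

definition block_subst :: "real list \<Rightarrow> real list \<Rightarrow> real list"
  where "block_subst w xs = concat (map (\<lambda>x. map ((*) x) w) xs)"

abbreviation nonzeros :: "real list \<Rightarrow> real list"
  where "nonzeros \<equiv> filter (\<lambda>x. x \<noteq> 0)"

text \<open>Additive errors on finitely many lists survive pointwise limits. Homogeneity and the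
  triangle inequality of \<open>N\<close> are inherited from the norm of \<open>'z\<close> by
  letting the error tend to 0, so they are derived rather than assumed.\<close>

definition finitely_represented :: "'z::real_normed_vector itself \<Rightarrow> (real list \<Rightarrow> real) \<Rightarrow> bool"
  where "finitely_represented _ N \<longleftrightarrow>
    (\<forall>A \<epsilon>. finite A \<longrightarrow> 0 < \<epsilon> \<longrightarrow> (\<exists>z::nat \<Rightarrow> 'z. \<forall>xs\<in>A. \<bar>norm (lin_comb z xs) - N xs\<bar> < \<epsilon>))"

text \<open>Invariance under \<^const>\<open>filter\<close> says that \<open>N\<close> is the norm of a spreading sequence.\<close>

definition lp_like :: "'z::real_normed_vector itself \<Rightarrow> real \<Rightarrow> real \<Rightarrow> (real list \<Rightarrow> real) \<Rightarrow> bool"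
  where "lp_like Z p C N \<longleftrightarrow> finitely_represented Z N \<and>
    (\<forall>xs. lp_list p xs / C \<le> N xs \<and> N xs \<le> lp_list p xs) \<and> (\<forall>xs. N (nonzeros xs) = N xs)"

lemma lp_sum_simps [simp]:
  "lp_sum p [] = 0" "lp_sum p (x # xs) = \<bar>x\<bar> powr p + lp_sum p xs"
  "lp_sum p (xs @ ys) = lp_sum p xs + lp_sum p ys"
  by (simp_all add: lp_sum_def)

lemma lp_sum_nonneg [simp]: "0 \<le> lp_sum p xs"
  by (induction xs) auto

lemma lp_sum_scale: "lp_sum p (map ((*) c) xs) = \<bar>c\<bar> powr p * lp_sum p xs"
  by (induction xs) (auto simp: abs_mult powr_mult distrib_left)

lemma lp_sum_map_upt: "lp_sum p (map f [0..<m]) = (\<Sum>i<m. \<bar>f i\<bar> powr p)"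
  by (induction m) auto

lemma lp_list_nonneg [simp]: "0 \<le> lp_list p xs"
  by (simp add: lp_list_def)

lemma block_subst_simps [simp]:
  "block_subst w [] = []" "block_subst w (x # xs) = map ((*) x) w @ block_subst w xs"
  "block_subst w (xs @ ys) = block_subst w xs @ block_subst w ys"
  by (simp_all add: block_subst_def)

lemma lp_list_block_subst: "lp_list p (block_subst w xs) = lp_list p w * lp_list p xs"
proof -
  have "lp_sum p (block_subst w xs) = lp_sum p w * lp_sum p xs"
    by (induction xs) (auto simp: lp_sum_scale distrib_left)
  then show ?thesis by (simp add: lp_list_def powr_mult)
qed

lemma nonzeros_block_subst: "nonzeros (block_subst w (nonzeros xs)) = nonzeros (block_subst w xs)"
  by (induction xs) auto

lemma lin_comb_append:
  "lin_comb z (xs @ ys) = lin_comb z xs + lin_comb (\<lambda>i. z (length xs + i)) ys"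
  by (induction xs arbitrary: z) (auto simp: algebra_simps)

lemma lin_comb_scale: "lin_comb z (map ((*) c) xs) = c *\<^sub>R lin_comb z xs"
  by (induction xs arbitrary: z) (auto simp: algebra_simps)

lemma lin_comb_scale_vectors: "lin_comb (\<lambda>i. c *\<^sub>R z i) xs = c *\<^sub>R lin_comb z xs"
  by (induction xs arbitrary: z) (auto simp: algebra_simps)

lemma lin_comb_diff:
  "length xs = length ys \<Longrightarrow> lin_comb z (map2 (-) xs ys) = lin_comb z xs - lin_comb z ys"
  by (induction xs ys arbitrary: z rule: list_induct2) (auto simp: algebra_simps)

lemma lin_comb_map_upt: "lin_comb z (map f [0..<m]) = (\<Sum>i<m. f i *\<^sub>R z i)"
  by (induction m) (auto simp: lin_comb_append)

lemma lin_comb_block_subst: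
  "lin_comb z (block_subst w xs) = lin_comb (\<lambda>i. lin_comb (\<lambda>j. z (i * length w + j)) w) xs"
  by (induction xs arbitrary: z) (auto simp: lin_comb_append lin_comb_scale algebra_simps)

lemma finitely_representedD:
  assumes "finitely_represented TYPE('z::real_normed_vector) N" "finite A" "0 < \<epsilon>"
  obtains z :: "nat \<Rightarrow> 'z::real_normed_vector" where "\<And>xs. xs \<in> A \<Longrightarrow> \<bar>norm (lin_comb z xs) - N xs\<bar> < \<epsilon>"
  using assms unfolding finitely_represented_def by meson

lemma finitely_represented_block_subst:
  fixes N :: "real list \<Rightarrow> real"
  assumes N: "finitely_represented TYPE('z::real_normed_vector) N" and c: "0 < c"
  shows "finitely_represented TYPE('z) (\<lambda>xs. N (block_subst w xs) / c)"
  unfolding finitely_represented_def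
proof (intro allI impI)
  fix A :: "real list set" and \<epsilon> :: real assume A: "finite A" "0 < \<epsilon>"
  obtain z :: "nat \<Rightarrow> 'z" where z: "\<And>xs. xs \<in> block_subst w ` A \<Longrightarrow> \<bar>norm (lin_comb z xs) - N xs\<bar> < c * \<epsilon>"
    using finitely_representedD[OF N, of "block_subst w ` A" "c * \<epsilon>"] A c by auto
  show "\<exists>z::nat \<Rightarrow> 'z. \<forall>xs\<in>A. \<bar>norm (lin_comb z xs) - N (block_subst w xs) / c\<bar> < \<epsilon>"
  proof (intro exI ballI)
    fix xs assume "xs \<in> A"
    let ?z = "\<lambda>i. (1 / c) *\<^sub>R lin_comb (\<lambda>j. z (i * length w + j)) w"
    have "norm (lin_comb ?z xs) = norm (lin_comb z (block_subst w xs)) / c"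
      using c by (simp only: lin_comb_scale_vectors lin_comb_block_subst norm_scaleR) simp
    then have "\<bar>norm (lin_comb ?z xs) - N (block_subst w xs) / c\<bar>
        = \<bar>norm (lin_comb z (block_subst w xs)) - N (block_subst w xs)\<bar> / c"
      using c by (simp flip: diff_divide_distrib)
    also have "\<dots> < \<epsilon>"
      using z[of "block_subst w xs"] \<open>xs \<in> A\<close> c by (simp add: divide_less_eq mult.commute)
    finally show "\<bar>norm (lin_comb ?z xs) - N (block_subst w xs) / c\<bar> < \<epsilon>" .
  qed
qed

lemma finitely_represented_limit:
  assumes N: "\<And>m. finitely_represented TYPE('z::real_normed_vector) (N m)"
    and lim: "\<And>xs. ((\<lambda>m. N m xs) \<longlongrightarrow> M xs) F" and F: "F \<noteq> bot"
  shows "finitely_represented TYPE('z) M"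
  unfolding finitely_represented_def
proof (intro allI impI)
  fix A :: "real list set" and \<epsilon> :: real assume A: "finite A" "0 < \<epsilon>"
  have "eventually (\<lambda>m. dist (N m xs) (M xs) < \<epsilon> / 2) F" for xs
    using A by (intro tendstoD[OF lim]) auto
  then have "eventually (\<lambda>m. \<forall>xs\<in>A. dist (N m xs) (M xs) < \<epsilon> / 2) F"
    using A by (simp add: eventually_ball_finite)
  then obtain m where m: "\<And>xs. xs \<in> A \<Longrightarrow> \<bar>N m xs - M xs\<bar> < \<epsilon> / 2"
    using F eventually_happens by (fastforce simp: dist_real_def)
  obtain z :: "nat \<Rightarrow> 'z" where z: "\<And>xs. xs \<in> A \<Longrightarrow> \<bar>norm (lin_comb z xs) - N m xs\<bar> < \<epsilon> / 2"
    using finitely_representedD[OF N A(1), of "\<epsilon> / 2"] A by auto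
  have "\<bar>norm (lin_comb z xs) - M xs\<bar> < \<epsilon>" if "xs \<in> A" for xs
    using z[OF that] m[OF that] by linarith
  then show "\<exists>z::nat \<Rightarrow> 'z. \<forall>xs\<in>A. \<bar>norm (lin_comb z xs) - M xs\<bar> < \<epsilon>" by blast
qed

lemma finitely_represented_scale:
  assumes N: "finitely_represented TYPE('z::real_normed_vector) N"
  shows "N (map ((*) c) xs) = \<bar>c\<bar> * N xs"
proof -
  have "\<bar>N (map ((*) c) xs) - \<bar>c\<bar> * N xs\<bar> \<le> 0"
  proof (rule field_le_epsilon)
    fix e :: real assume e: "0 < e"
    \<comment> \<open>The error \<open>d\<close> enters once as it is and once multiplied by the
      modulus of \<open>c\<close>.\<close>
    define d where "d = e / (1 + \<bar>c\<bar>)"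
    have pos: "0 < 1 + \<bar>c\<bar>" by (simp add: add_pos_nonneg)
    have "(1 + \<bar>c\<bar>) * d = e" using pos by (simp add: d_def)
    then have d: "0 < d" "d + \<bar>c\<bar> * d = e"
      using e pos unfolding distrib_right by (simp_all add: d_def)
    obtain z :: "nat \<Rightarrow> 'z"
      where z: "\<And>ys. ys \<in> {xs, map ((*) c) xs} \<Longrightarrow> \<bar>norm (lin_comb z ys) - N ys\<bar> < d"
      using finitely_representedD[OF N, of "{xs, map ((*) c) xs}" d] d by auto
    have "\<bar>\<bar>c\<bar> * norm (lin_comb z xs) - N (map ((*) c) xs)\<bar> < d"
      using z[of "map ((*) c) xs"] by (simp add: lin_comb_scale)
    moreover have "\<bar>\<bar>c\<bar> * norm (lin_comb z xs) - \<bar>c\<bar> * N xs\<bar> \<le> \<bar>c\<bar> * d"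
      using z[of xs] by (simp add: abs_mult mult_left_mono flip: right_diff_distrib)
    ultimately show "\<bar>N (map ((*) c) xs) - \<bar>c\<bar> * N xs\<bar> \<le> 0 + e"
      using d by linarith
  qed
  then show ?thesis by simp
qed

lemma finitely_represented_triangle:
  assumes N: "finitely_represented TYPE('z::real_normed_vector) N" and len: "length xs = length ys"
  shows "\<bar>N xs - N ys\<bar> \<le> N (map2 (-) xs ys)"
proof (rule field_le_epsilon)
  fix e :: real assume e: "0 < e"
  let ?A = "{xs, ys, map2 (-) xs ys}"
  obtain z :: "nat \<Rightarrow> 'z" where z: "\<And>ys. ys \<in> ?A \<Longrightarrow> \<bar>norm (lin_comb z ys) - N ys\<bar> < e / 3"
    using finitely_representedD[OF N, of ?A "e / 3"] e by auto
  have "\<bar>norm (lin_comb z xs) - norm (lin_comb z ys)\<bar> \<le> norm (lin_comb z (map2 (-) xs ys))"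
    unfolding lin_comb_diff[OF len] by (rule norm_triangle_ineq3)
  then show "\<bar>N xs - N ys\<bar> \<le> N (map2 (-) xs ys) + e"
    using z[of xs, OF insertI1] z[of ys, OF insertI2, OF insertI1] z[of "map2 (-) xs ys", OF insertI2, OF insertI2, OF insertI1]
    by linarith
qed

lemma lp_like_Lipschitz:
  assumes "lp_like TYPE('z::real_normed_vector) p C N" "length xs = length ys"
  shows "\<bar>N xs - N ys\<bar> \<le> lp_list p (map2 (-) xs ys)"
  using finitely_represented_triangle[of N xs ys] assms unfolding lp_like_def by (meson order_trans)

lemma lp_like_nonzeros_cong:
  assumes "lp_like TYPE('z::real_normed_vector) p C N" "nonzeros xs = nonzeros ys"
  shows "N xs = N ys"
  using assms unfolding lp_like_def by metis

text \<open>\<open>lp_list\<close> is multiplicative under \<open>block_subst\<close>, so the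
  normalised functions satisfy both bounds with the same \<open>C\<close>, and these bounds make the
  limits exist. Each later improvement of \<open>N\<close> is a choice of the blocks
  \<open>w m\<close>.\<close>

lemma lp_like_block_limit:
  fixes w :: "nat \<Rightarrow> real list"
  assumes N: "lp_like TYPE('z::real_normed_vector) p C N" and w: "\<And>m. 0 < lp_sum p (w m)"
  shows "\<exists>M. lp_like TYPE('z) p C M \<and>
    (\<forall>xs. ((\<lambda>m. N (block_subst (w m) xs) / lp_list p (w m)) \<longlongrightarrow> M xs) free_ultra)"
proof -
  define M where "M xs = Lim free_ultra (\<lambda>m. N (block_subst (w m) xs) / lp_list p (w m))" for xs
  have w': "0 < lp_list p (w m)" for m
    using w[of m] by (simp add: lp_list_def)
  have bounds: "lp_list p xs / C \<le> N (block_subst (w m) xs) / lp_list p (w m) \<and>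
      N (block_subst (w m) xs) / lp_list p (w m) \<le> lp_list p xs" for m xs
  proof -
    have "lp_list p (w m) * lp_list p xs / C \<le> N (block_subst (w m) xs)"
      "N (block_subst (w m) xs) \<le> lp_list p (w m) * lp_list p xs"
      using N unfolding lp_like_def by (auto simp flip: lp_list_block_subst)
    with w'[of m] show ?thesis
      by (simp add: pos_le_divide_eq pos_divide_le_eq mult.commute)
  qed
  have lim: "((\<lambda>m. N (block_subst (w m) xs) / lp_list p (w m)) \<longlongrightarrow> M xs) free_ultra \<and>
      lp_list p xs / C \<le> M xs \<and> M xs \<le> lp_list p xs" for xs
    unfolding M_def using bounds by (intro free_ultra_converges always_eventually allI)
  moreover have "finitely_represented TYPE('z) M"
  proof (rule finitely_represented_limit[where N = "\<lambda>m xs. N (block_subst (w m) xs) / lp_list p (w m)", OF _ _ free_ultra_neq_bot])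
    show "finitely_represented TYPE('z) (\<lambda>xs. N (block_subst (w m) xs) / lp_list p (w m))" for m
      using N w'[of m] unfolding lp_like_def by (intro finitely_represented_block_subst) auto
  qed (use lim in blast)
  moreover have "M (nonzeros xs) = M xs" for xs
    unfolding M_def using lp_like_nonzeros_cong[OF N nonzeros_block_subst] by simp
  ultimately show ?thesis
    unfolding lp_like_def by blast
qed

subsection \<open>Spreading limits of almost isometric copies\<close>

lemma op_norm_bound:
  assumes T: "bounded_linear_between V N W M T" and x: "x \<in> V" and N: "\<And>x. x \<in> V \<Longrightarrow> 0 \<le> N x"
  shows "M (T x) \<le> op_norm V N M T * N x"
proof -
  obtain K where K: "\<And>x. x \<in> V \<Longrightarrow> M (T x) \<le> K * N x"
    using T unfolding bounded_linear_between_def by blast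
  \<comment> \<open>\<open>K\<close> may be negative, and the quotient is 0 where \<open>N\<close>
    vanishes; \<open>max K 0\<close> bounds both cases.\<close>
  have "M (T y) / N y \<le> max K 0" if "y \<in> V" for y
  proof (cases "N y = 0")
    case False
    have "M (T y) \<le> max K 0 * N y"
      using K[OF that] mult_right_mono[OF max.cobounded1 N[OF that], of K 0] by linarith
    then show ?thesis using N[OF that] False by (simp add: pos_divide_le_eq)
  qed simp
  then have bdd: "bdd_above ((\<lambda>x. M (T x) / N x) ` V)"
    by (auto intro!: bdd_aboveI)
  show ?thesis
  proof (cases "N x = 0")
    case True
    then show ?thesis using K[OF x] by simp
  next
    case False
    then have "0 < N x" using N[OF x] by simp
    moreover have "M (T x) / N x \<le> op_norm V N M T"
      unfolding op_norm_def using bdd x by (rule cSUP_upper2) simp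
    ultimately show ?thesis by (simp add: pos_divide_le_eq)
  qed
qed

lemma lp_fin_norm_nonneg: "0 \<le> lp_fin_norm p n x"
  by (simp add: lp_fin_norm_def)

lemma linear_between_lp_fin_space:
  fixes S :: "(nat \<Rightarrow> real) \<Rightarrow> 'z::real_normed_vector"
  assumes S: "bounded_linear_between (lp_fin_space n) M Y N S" and k: "k \<le> n"
  shows "S (\<lambda>i. if i < k then a i else 0) = (\<Sum>i<k. a i *\<^sub>R S (\<lambda>j. if j = i then 1 else 0))"
  using k
proof (induction k)
  case 0
  have "0 \<in> lp_fin_space n" by (simp add: lp_fin_space_def)
  then have "S (0 *\<^sub>R 0) = 0 *\<^sub>R S 0"
    using S unfolding bounded_linear_between_def by blast
  then have "S (\<lambda>i. 0) = 0"
    by (simp add: zero_fun_def scaleR_fun_def)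
  then show ?case by simp
next
  case (Suc k)
  let ?u = "\<lambda>i. if i < k then a i else 0" and ?e = "\<lambda>j. if j = k then 1 else 0 :: real"
  have mem: "?u \<in> lp_fin_space n" "?e \<in> lp_fin_space n" "a k *\<^sub>R ?e \<in> lp_fin_space n"
    using Suc.prems by (auto simp: lp_fin_space_def scaleR_fun_def)
  have "(\<lambda>i. if i < Suc k then a i else 0) = ?u + a k *\<^sub>R ?e"
    by (auto simp: fun_eq_iff scaleR_fun_def less_Suc_eq)
  then have "S (\<lambda>i. if i < Suc k then a i else 0) = S ?u + a k *\<^sub>R S ?e"
    using S mem unfolding bounded_linear_between_def by simp
  then show ?case using Suc by simp
qed

text \<open>The images of the unit vectors under the inverse isomorphism \<open>S\<close> are
  divided by its norm \<open>s\<close>. The upper constant becomes 1, and the lower one is the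
  inverse of the product of the two operator norms.\<close>

lemma C_isomorphic_lp_fin_basis:
  fixes Y :: "'z::real_normed_vector set"
  assumes "C_isomorphic C Y norm (lp_fin_space n) (lp_fin_norm p n)" and n: "0 < n"
  shows "1 \<le> C \<and> (\<exists>z::nat \<Rightarrow> 'z. \<forall>a. lp_fin_norm p n a / C \<le> norm (\<Sum>i<n. a i *\<^sub>R z i) \<and>
    norm (\<Sum>i<n. a i *\<^sub>R z i) \<le> lp_fin_norm p n a)"
proof -
  let ?V = "lp_fin_space n" and ?N = "lp_fin_norm p n"
  obtain T S where T: "bounded_linear_between Y norm ?V ?N T"
    and S: "bounded_linear_between ?V ?N Y norm S"
    and TS: "\<And>y. y \<in> ?V \<Longrightarrow> T (S y) = y" and C: "op_norm Y norm ?N T * op_norm ?V ?N norm S \<le> C"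
    using assms unfolding C_isomorphic_def by blast
  define s t where "s = op_norm ?V ?N norm S" and "t = op_norm Y norm ?N T"
  have S_le: "norm (S a) \<le> s * ?N a" if "a \<in> ?V" for a
    unfolding s_def by (rule op_norm_bound[OF S that]) (simp add: lp_fin_norm_nonneg)
  have T_le: "?N a \<le> t * norm (S a)" if a: "a \<in> ?V" for a
  proof -
    have "S a \<in> Y" using S a unfolding bounded_linear_between_def by blast
    from op_norm_bound[OF T this] show ?thesis by (simp add: TS[OF a] t_def)
  qed
  \<comment> \<open>The unit vector \<open>e\<close>, available since \<open>0 < n\<close>, shows
    that both operator norms are positive and that their product is at least 1.\<close>
  define e :: "nat \<Rightarrow> real" where "e = (\<lambda>i. if i = 0 then 1 else 0)"
  have "(\<Sum>i<n. \<bar>e i\<bar> powr p) = (\<Sum>i<n. if i = 0 then 1 else 0)"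
    by (intro sum.cong) (auto simp: e_def)
  then have e: "e \<in> ?V" "?N e = 1"
    using n by (auto simp: e_def lp_fin_space_def lp_fin_norm_def)
  have s: "0 < s" and t: "0 < t"
  proof -
    have "1 \<le> t * norm (S e)" "norm (S e) \<le> s"
      using S_le[OF e(1)] T_le[OF e(1)] by (auto simp: e)
    then show t: "0 < t"
      by (smt (verit) norm_ge_zero mult_nonpos_nonneg)
    have "0 < norm (S e)"
      using \<open>1 \<le> t * norm (S e)\<close> t by (smt (verit) norm_ge_zero mult_eq_0_iff)
    with \<open>norm (S e) \<le> s\<close> show "0 < s" by linarith
  qed
  have "1 \<le> t * norm (S e)" "t * norm (S e) \<le> t * s"
    using S_le[OF e(1)] T_le[OF e(1)] t by (auto simp: e)
  then have C1: "1 \<le> C" using C by (simp add: s_def t_def)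
  define z where "z i = (1 / s) *\<^sub>R S (\<lambda>j. if j = i then 1 else 0)" for i
  have "?N a / C \<le> norm (\<Sum>i<n. a i *\<^sub>R z i) \<and> norm (\<Sum>i<n. a i *\<^sub>R z i) \<le> ?N a" for a
  proof -
    let ?a = "\<lambda>i. if i < n then a i else 0"
    have a: "?a \<in> ?V" "?N ?a = ?N a" by (auto simp: lp_fin_space_def lp_fin_norm_def)
    have "(\<Sum>i<n. a i *\<^sub>R z i) = (1 / s) *\<^sub>R S ?a"
      unfolding linear_between_lp_fin_space[OF S order_refl] by (simp add: z_def scaleR_sum_right mult.commute)
    then have eq: "norm (\<Sum>i<n. a i *\<^sub>R z i) = norm (S ?a) / s"
      using s by simp
    have "norm (S ?a) / s \<le> ?N a"
      using S_le[OF a(1)] s by (simp add: a pos_divide_le_eq mult.commute)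
    moreover have "?N a / C \<le> norm (S ?a) / s"
    proof -
      have "?N a \<le> t * norm (S ?a)" using T_le[OF a(1)] by (simp add: a)
      also have "\<dots> = (t * s) * (norm (S ?a) / s)" using s by simp
      also have "\<dots> \<le> C * (norm (S ?a) / s)"
        using C s by (intro mult_right_mono) (auto simp: s_def t_def)
      finally show ?thesis using C1 by (simp add: pos_divide_le_eq mult.commute)
    qed
    ultimately show ?thesis unfolding eq by blast
  qed
  with C1 show ?thesis by blast
qed

section \<open>Iterated ultrafilter limits over finitely supported vectors\<close>

definition fin_supp :: "(nat \<Rightarrow> real) \<Rightarrow> bool"
  where "fin_supp a \<longleftrightarrow> finite {i. a i \<noteq> 0}"

definition supp_sum :: "real \<Rightarrow> (nat \<Rightarrow> real) \<Rightarrow> real"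
  where "supp_sum p a = (\<Sum>i | a i \<noteq> 0. \<bar>a i\<bar> powr p)"

definition supp_comb :: "(nat \<Rightarrow> 'z::real_vector) \<Rightarrow> (nat \<Rightarrow> real) \<Rightarrow> 'z"
  where "supp_comb z a = (\<Sum>i | a i \<noteq> 0. a i *\<^sub>R z i)"

text \<open>The spreading model construction of Brunel and Sucheston: each entry is placed at a
  position that goes to infinity, the limit for the first entry being the outermost. For finitely
  supported \<open>a\<close> the update eventually hits a position where \<open>a\<close> is 0, so
  it amounts to adding a multiple of a unit vector.\<close>

primrec iter_lim :: "((nat \<Rightarrow> real) \<Rightarrow> real) \<Rightarrow> (nat \<Rightarrow> real) \<Rightarrow> real list \<Rightarrow> real" where
  "iter_lim Q a [] = Q a"
| "iter_lim Q a (x # xs) = Lim free_ultra (\<lambda>n. iter_lim Q (a(n := x)) xs)"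

lemma fin_supp_upd: "fin_supp a \<Longrightarrow> fin_supp (a(n := x))"
  unfolding fin_supp_def by (rule finite_subset[of _ "insert n {i. a i \<noteq> 0}"]) auto

lemma eventually_fin_supp: "fin_supp a \<Longrightarrow> eventually (\<lambda>n. a n = 0) free_ultra"
  by (rule free_ultra_eventually) (simp add: eventually_cofinite fin_supp_def flip: cofinite_eq_sequentially)

lemma sum_supp_upd:
  fixes f :: "nat \<Rightarrow> real \<Rightarrow> 'b::ab_group_add"
  assumes "fin_supp a" "a n = 0" "f n 0 = 0"
  shows "(\<Sum>i | (a(n := x)) i \<noteq> 0. f i ((a(n := x)) i)) = (\<Sum>i | a i \<noteq> 0. f i (a i)) + f n x"
proof (cases "x = 0")
  case True
  then have "a(n := x) = a" using assms by (auto simp: fun_eq_iff)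
  then show ?thesis using True assms by simp
next
  case False
  then have "{i. (a(n := x)) i \<noteq> 0} = insert n {i. a i \<noteq> 0}" by auto
  moreover have "(\<Sum>i | a i \<noteq> 0. f i ((a(n := x)) i)) = (\<Sum>i | a i \<noteq> 0. f i (a i))"
    using assms by (intro sum.cong) auto
  ultimately show ?thesis using assms by (simp add: add.commute fin_supp_def)
qed

lemma supp_sum_upd: "fin_supp a \<Longrightarrow> a n = 0 \<Longrightarrow> supp_sum p (a(n := x)) = supp_sum p a + \<bar>x\<bar> powr p"
  unfolding supp_sum_def by (rule sum_supp_upd) auto

lemma supp_comb_upd: "fin_supp a \<Longrightarrow> a n = 0 \<Longrightarrow> supp_comb z (a(n := x)) = supp_comb z a + x *\<^sub>R z n"
  unfolding supp_comb_def by (rule sum_supp_upd[where f = "\<lambda>i t. t *\<^sub>R z i"]) auto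

text \<open>A new entry eventually lands off the support of \<open>a\<close>, where it just adds its
  \<open>p\<close>-th power; bounds that hold eventually pass to the limit.\<close>

lemma iter_lim_bounds:
  assumes Q: "\<And>a. fin_supp a \<Longrightarrow> supp_sum p a powr (1 / p) / C \<le> Q a \<and> Q a \<le> supp_sum p a powr (1 / p)"
    and a: "fin_supp a"
  shows "(supp_sum p a + lp_sum p xs) powr (1 / p) / C \<le> iter_lim Q a xs \<and>
    iter_lim Q a xs \<le> (supp_sum p a + lp_sum p xs) powr (1 / p)"
  using a
proof (induction xs arbitrary: a)
  case Nil
  then show ?case using Q by simp
next
  case (Cons x xs)
  have "(supp_sum p a + lp_sum p (x # xs)) powr (1 / p) / C \<le> iter_lim Q (a(n := x)) xs \<and>
      iter_lim Q (a(n := x)) xs \<le> (supp_sum p a + lp_sum p (x # xs)) powr (1 / p)" if "a n = 0" for n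
  proof -
    have "fin_supp (a(n := x))" by (rule fin_supp_upd[OF Cons.prems])
    from Cons.IH[OF this] show ?thesis
      using supp_sum_upd[OF Cons.prems that, of p x] by (simp add: add.assoc del: fun_upd_apply)
  qed
  then have "eventually (\<lambda>n. (supp_sum p a + lp_sum p (x # xs)) powr (1 / p) / C \<le> iter_lim Q (a(n := x)) xs \<and>
      iter_lim Q (a(n := x)) xs \<le> (supp_sum p a + lp_sum p (x # xs)) powr (1 / p)) free_ultra"
    using eventually_fin_supp[OF Cons.prems] by (auto elim: eventually_mono)
  from free_ultra_converges[OF this] show ?case by simp
qed

lemma iter_lim_tendsto:
  assumes Q: "\<And>a. fin_supp a \<Longrightarrow> supp_sum p a powr (1 / p) / C \<le> Q a \<and> Q a \<le> supp_sum p a powr (1 / p)"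
    and a: "fin_supp a"
  shows "((\<lambda>n. iter_lim Q (a(n := x)) xs) \<longlongrightarrow> iter_lim Q a (x # xs)) free_ultra"
proof -
  let ?s = "supp_sum p a + (\<bar>x\<bar> powr p + lp_sum p xs)"
  have "?s powr (1 / p) / C \<le> iter_lim Q (a(n := x)) xs \<and>
      iter_lim Q (a(n := x)) xs \<le> ?s powr (1 / p)" if "a n = 0" for n
    using iter_lim_bounds[OF Q fin_supp_upd[OF a], of n x xs] supp_sum_upd[OF a that, of p x]
    by (simp add: add.assoc)
  then have "eventually (\<lambda>n. ?s powr (1 / p) / C \<le> iter_lim Q (a(n := x)) xs \<and>
      iter_lim Q (a(n := x)) xs \<le> ?s powr (1 / p)) free_ultra"
    using eventually_fin_supp[OF a] by (auto elim: eventually_mono)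
  from free_ultra_converges[OF this] show ?thesis by simp
qed

text \<open>Placing a zero off the support changes nothing, so the limit belonging to a zero entry
  is that of an eventually constant sequence.\<close>

lemma iter_lim_nonzeros: "fin_supp a \<Longrightarrow> iter_lim Q a (nonzeros xs) = iter_lim Q a xs"
proof (induction xs arbitrary: a)
  case (Cons x xs)
  show ?case
  proof (cases "x = 0")
    case True
    have "eventually (\<lambda>n. iter_lim Q a xs = iter_lim Q (a(n := 0)) xs) free_ultra"
      using eventually_fin_supp[OF Cons.prems] by eventually_elim (metis fun_upd_triv)
    then have "((\<lambda>n. iter_lim Q (a(n := 0)) xs) \<longlongrightarrow> iter_lim Q a xs) free_ultra"
      by (rule Lim_transform_eventually[OF tendsto_const])
    then have "Lim free_ultra (\<lambda>n. iter_lim Q (a(n := 0)) xs) = iter_lim Q a xs"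
      by (rule tendsto_Lim[OF free_ultra_neq_bot])
    then show ?thesis
      using Cons True by simp
  next
    case False
    have "iter_lim Q (a(n := x)) (nonzeros xs) = iter_lim Q (a(n := x)) xs" for n
      by (rule Cons.IH) (rule fin_supp_upd[OF Cons.prems])
    then show ?thesis using False by (simp del: fun_upd_apply)
  qed
qed simp

text \<open>The induction runs over finite sets of pairs, since one copy \<open>m\<close> and one
  choice of positions must serve all of them. Positions are fixed from the outermost limit inwards;
  \<open>m\<close> comes last because the limit giving \<open>Q\<close> is the innermost.\<close>

lemma iter_lim_represented:
  fixes z :: "nat \<Rightarrow> nat \<Rightarrow> 'z::real_normed_vector"
  assumes Q: "\<And>a. fin_supp a \<Longrightarrow> supp_sum p a powr (1 / p) / C \<le> Q a \<and> Q a \<le> supp_sum p a powr (1 / p)"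
    and lim: "\<And>a. fin_supp a \<Longrightarrow> ((\<lambda>m. norm (supp_comb (z m) a)) \<longlongrightarrow> Q a) free_ultra"
    and F: "finite F" "\<And>a xs. (a, xs) \<in> F \<Longrightarrow> fin_supp a \<and> length xs \<le> k" and \<epsilon>: "0 < \<epsilon>"
  shows "\<exists>m h. \<forall>(a, xs) \<in> F. \<bar>norm (supp_comb (z m) a + lin_comb (\<lambda>i. z m (h i)) xs) - iter_lim Q a xs\<bar> < \<epsilon>"
  using F \<epsilon>
proof (induction k arbitrary: F \<epsilon>)
  case 0
  have "eventually (\<lambda>m. \<forall>t\<in>F. dist (norm (supp_comb (z m) (fst t))) (Q (fst t)) < \<epsilon>) free_ultra"
    using 0 by (intro eventually_ball_finite ballI tendstoD[OF lim]) force+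
  then obtain m where m: "\<forall>t\<in>F. dist (norm (supp_comb (z m) (fst t))) (Q (fst t)) < \<epsilon>"
    using eventually_happens'[OF free_ultra_neq_bot] by blast
  have "\<bar>norm (supp_comb (z m) a + lin_comb (\<lambda>i. z m i) xs) - iter_lim Q a xs\<bar> < \<epsilon>"
    if "(a, xs) \<in> F" for a xs
    using 0(2)[OF that] bspec[OF m that] by (simp add: dist_real_def)
  then show ?case by (intro exI[of _ m] exI[of _ "\<lambda>i. i"]) blast
next
  case (Suc k)
  \<comment> \<open>A single position \<open>n\<close> has to lie off all supports and to realise
    all outermost limits up to half of the error; the other half is left to the induction
    hypothesis.\<close>
  have "eventually (\<lambda>n. \<forall>(a, xs) \<in> F. a n = 0 \<and>
      (xs \<noteq> [] \<longrightarrow> dist (iter_lim Q (a(n := hd xs)) (tl xs)) (iter_lim Q a xs) < \<epsilon> / 2)) free_ultra"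
    (is "eventually ?P _")
  proof (rule eventually_ball_finite[OF Suc.prems(1)], clarify)
    fix a xs assume "(a, xs) \<in> F"
    then have a: "fin_supp a" using Suc.prems by blast
    show "eventually (\<lambda>n. a n = 0 \<and>
        (xs \<noteq> [] \<longrightarrow> dist (iter_lim Q (a(n := hd xs)) (tl xs)) (iter_lim Q a xs) < \<epsilon> / 2)) free_ultra"
    proof (cases xs)
      case Nil
      then show ?thesis using eventually_fin_supp[OF a] by simp
    next
      case (Cons x ys)
      have "eventually (\<lambda>n. dist (iter_lim Q (a(n := x)) ys) (iter_lim Q a (x # ys)) < \<epsilon> / 2) free_ultra"
        using Suc.prems by (intro tendstoD[OF iter_lim_tendsto[OF Q a]]) auto
      then show ?thesis using eventually_fin_supp[OF a] Cons by (simp add: eventually_conj)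
    qed
  qed
  then obtain n where n: "?P n"
    using eventually_happens'[OF free_ultra_neq_bot] by blast
  define step where "step = (\<lambda>(a :: nat \<Rightarrow> real, xs :: real list). if xs = [] then (a, []) else (a(n := hd xs), tl xs))"
  have fin: "finite (step ` F)" using Suc.prems by simp
  have len: "fin_supp a \<and> length xs \<le> k" if "(a, xs) \<in> step ` F" for a xs
    using that Suc.prems(2) by (fastforce simp: step_def split: if_splits intro: fin_supp_upd)
  have "0 < \<epsilon> / 2" using Suc.prems by simp
  from Suc.IH[OF fin len this] obtain m h where
    mh: "\<forall>(a, xs) \<in> step ` F. \<bar>norm (supp_comb (z m) a + lin_comb (\<lambda>i. z m (h i)) xs) - iter_lim Q a xs\<bar> < \<epsilon> / 2"
    by blast
  show ?case
  proof (intro exI ballI, clarify)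
    fix a xs assume ax: "(a, xs) \<in> F"
    then have a: "fin_supp a" using Suc.prems by blast
    have mh': "case step (a, xs) of (b, ys) \<Rightarrow>
        \<bar>norm (supp_comb (z m) b + lin_comb (\<lambda>i. z m (h i)) ys) - iter_lim Q b ys\<bar> < \<epsilon> / 2"
      by (rule bspec[OF mh imageI[OF ax]])
    show "\<bar>norm (supp_comb (z m) a + lin_comb (\<lambda>i. z m (case_nat n h i)) xs) - iter_lim Q a xs\<bar> < \<epsilon>"
    proof (cases xs)
      case Nil
      then show ?thesis using mh' Suc.prems by (simp add: step_def)
    next
      case (Cons x ys)
      have "a n = 0" and d: "dist (iter_lim Q (a(n := x)) ys) (iter_lim Q a xs) < \<epsilon> / 2"
        using n ax Cons by auto
      then have "supp_comb (z m) (a(n := x)) = supp_comb (z m) a + x *\<^sub>R z m n"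
        using supp_comb_upd[OF a] by blast
      then have "\<bar>norm (supp_comb (z m) a + lin_comb (\<lambda>i. z m (case_nat n h i)) xs) - iter_lim Q (a(n := x)) ys\<bar> < \<epsilon> / 2"
        using mh' Cons by (simp add: step_def add.assoc del: iter_lim.simps)
      then show ?thesis
        using d unfolding dist_real_def by linarith
    qed
  qed
qed

text \<open>\<open>Q\<close> is the limit of the norms in the given copies of growing dimension: the
  \<open>m\<close>-th copy contains the whole support of \<open>a\<close> once \<open>m\<close> is
  large. Starting \<open>iter_lim\<close> at the zero vector keeps the constants of
  \<open>Q\<close>.\<close>

proposition uniformly_contains_lp_imp_lp_like:
  assumes p: "1 < p" and Z: "uniformly_contains_lp p (UNIV :: 'z::real_normed_vector set)"
  obtains C N where "1 \<le> C" "lp_like TYPE('z) p C N"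
proof -
  obtain C where C: "\<And>n. \<exists>Y::'z set. C_isomorphic C Y norm (lp_fin_space n) (lp_fin_norm p n)"
    using Z unfolding uniformly_contains_lp_def by blast
  have C1: "1 \<le> C"
    using C_isomorphic_lp_fin_basis[of C _ 1 p] C[of 1] by auto
  have "\<exists>z::nat \<Rightarrow> 'z. \<forall>a. lp_fin_norm p n a / C \<le> norm (\<Sum>i<n. a i *\<^sub>R z i) \<and>
    norm (\<Sum>i<n. a i *\<^sub>R z i) \<le> lp_fin_norm p n a" for n
    using C_isomorphic_lp_fin_basis[of C _ n p] C[of n] by (cases "n = 0") (auto simp: lp_fin_norm_def)
  then obtain z :: "nat \<Rightarrow> nat \<Rightarrow> 'z" where z: "\<And>n a. lp_fin_norm p n a / C \<le> norm (\<Sum>i<n. a i *\<^sub>R z n i) \<and>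
    norm (\<Sum>i<n. a i *\<^sub>R z n i) \<le> lp_fin_norm p n a"
    by metis
  define Q where "Q a = Lim free_ultra (\<lambda>m. norm (supp_comb (z m) a))" for a
  have Q: "((\<lambda>m. norm (supp_comb (z m) a)) \<longlongrightarrow> Q a) free_ultra \<and>
      supp_sum p a powr (1 / p) / C \<le> Q a \<and> Q a \<le> supp_sum p a powr (1 / p)" if a: "fin_supp a" for a
    unfolding Q_def
  proof (rule free_ultra_converges[OF free_ultra_eventually])
    obtain m0 where m0: "\<And>i. a i \<noteq> 0 \<Longrightarrow> i < m0"
      using a unfolding fin_supp_def finite_nat_set_iff_bounded by auto
    have "supp_sum p a powr (1 / p) / C \<le> norm (supp_comb (z m) a) \<and>
      norm (supp_comb (z m) a) \<le> supp_sum p a powr (1 / p)" if "m0 \<le> m" for m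
    proof -
      have "supp_comb (z m) a = (\<Sum>i<m. a i *\<^sub>R z m i)" "supp_sum p a = (\<Sum>i<m. \<bar>a i\<bar> powr p)"
        unfolding supp_comb_def supp_sum_def
        using m0 that by (auto intro!: sum.mono_neutral_left intro: less_le_trans)
      then show ?thesis using z[of m a] by (simp add: lp_fin_norm_def)
    qed
    then show "eventually (\<lambda>m. supp_sum p a powr (1 / p) / C \<le> norm (supp_comb (z m) a) \<and>
      norm (supp_comb (z m) a) \<le> supp_sum p a powr (1 / p)) sequentially"
      unfolding eventually_sequentially by blast
  qed
  let ?N = "iter_lim Q (\<lambda>_. 0)"
  have "finitely_represented TYPE('z) ?N"
    unfolding finitely_represented_def
  proof (intro allI impI)
    fix A :: "real list set" and \<epsilon> :: real assume A: "finite A" "0 < \<epsilon>"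
    define F where "F = (\<lambda>xs. (\<lambda>_::nat. 0::real, xs)) ` A"
    define k where "k = Max (length ` A)"
    have F: "finite F" "\<And>a xs. (a, xs) \<in> F \<Longrightarrow> fin_supp a \<and> length xs \<le> k"
      using A by (auto simp: F_def k_def fin_supp_def)
    have "\<exists>m h. \<forall>(a, xs) \<in> F. \<bar>norm (supp_comb (z m) a + lin_comb (\<lambda>i. z m (h i)) xs) - iter_lim Q a xs\<bar> < \<epsilon>"
      using Q F A(2) by (intro iter_lim_represented[of p C Q z F k]) blast+
    then show "\<exists>z::nat \<Rightarrow> 'z. \<forall>xs\<in>A. \<bar>norm (lin_comb z xs) - ?N xs\<bar> < \<epsilon>"
      by (auto simp: F_def supp_comb_def)
  qed
  moreover have "lp_list p xs / C \<le> ?N xs \<and> ?N xs \<le> lp_list p xs" for xs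
    using iter_lim_bounds[of p C Q "\<lambda>_. 0" xs] Q by (simp add: lp_list_def supp_sum_def fin_supp_def)
  moreover have "?N (nonzeros xs) = ?N xs" for xs
    by (rule iter_lim_nonzeros) (simp add: fin_supp_def)
  ultimately have "lp_like TYPE('z) p C ?N"
    unfolding lp_like_def by blast
  with C1 that show ?thesis by blast
qed

subsection \<open>Sign invariance\<close>

lemma lp_sum_zero_diff [simp]: "lp_sum p (map2 (-) xs xs) = 0"
  by (induction xs) auto

lemma map2_diff_scale:
  fixes x :: real
  shows "map2 (-) (map ((*) x) us) (map ((*) x) vs) = map ((*) x) (map2 (-) us vs)"
  by (induction us vs rule: list_induct2') (auto simp: right_diff_distrib)

text \<open>The common context cancels in the difference. The two inner words must have equal
  length, which the applications arrange by inserting or deleting zeros.\<close>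

lemma lp_like_context:
  assumes N: "lp_like TYPE('z::real_normed_vector) p C N" and len: "length u = length v"
  shows "\<bar>N (L @ u @ R) - N (L @ v @ R)\<bar> \<le> lp_list p (map2 (-) u v)"
  using lp_like_Lipschitz[OF N, of "L @ u @ R" "L @ v @ R"] len by (simp add: lp_list_def)

text \<open>An error whose \<open>p\<close>-th power is of smaller order than the mass
  \<open>lp_sum p (w m)\<close> of the block disappears after normalisation. This is the common
  criterion for sign and dilation invariance.\<close>

lemma lp_like_limit_eq:
  assumes p: "0 < p" and w: "\<And>m. 0 < lp_sum p (w m)"
    and lim: "\<And>xs. ((\<lambda>m. N (block_subst (w m) xs) / lp_list p (w m)) \<longlongrightarrow> M xs) free_ultra"
    and le: "eventually (\<lambda>m. \<bar>N (block_subst (w m) xs) - N (block_subst (w m) ys)\<bar>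
      \<le> (c m * lp_sum p (w m)) powr (1 / p)) sequentially"
    and c: "c \<longlonglongrightarrow> 0" "\<And>m. 0 \<le> c m"
  shows "M xs = M ys"
proof -
  let ?d = "\<lambda>m. N (block_subst (w m) xs) / lp_list p (w m) - N (block_subst (w m) ys) / lp_list p (w m)"
  have "norm (?d m) \<le> c m powr (1 / p)"
    if "\<bar>N (block_subst (w m) xs) - N (block_subst (w m) ys)\<bar> \<le> (c m * lp_sum p (w m)) powr (1 / p)" for m
  proof -
    have pos: "0 < lp_list p (w m)" using w[of m] by (simp add: lp_list_def)
    have "norm (?d m) = \<bar>N (block_subst (w m) xs) - N (block_subst (w m) ys)\<bar> / lp_list p (w m)"
      using pos by (simp flip: diff_divide_distrib)
    also have "\<dots> \<le> (c m * lp_sum p (w m)) powr (1 / p) / lp_list p (w m)"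
      using that pos by (intro divide_right_mono) auto
    also have "\<dots> = c m powr (1 / p)"
      using pos c(2)[of m] by (simp add: lp_list_def powr_mult)
    finally show ?thesis .
  qed
  then have "eventually (\<lambda>m. norm (?d m) \<le> c m powr (1 / p)) sequentially"
    using le by (auto elim: eventually_mono)
  moreover have "(\<lambda>m. c m powr (1 / p)) \<longlonglongrightarrow> 0"
    using p c by (intro tendsto_zero_powrI[OF c(1) tendsto_const]) auto
  ultimately have "?d \<longlonglongrightarrow> 0"
    by (rule Lim_null_comparison)
  then have "(?d \<longlongrightarrow> 0) free_ultra"
    by (rule tendsto_mono[OF free_ultra_le])
  moreover have "(?d \<longlongrightarrow> M xs - M ys) free_ultra"
    by (intro tendsto_diff lim)
  ultimately show ?thesis
    using tendsto_unique[OF free_ultra_neq_bot] by fastforce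
qed

definition alternating :: "nat \<Rightarrow> real list"
  where "alternating m = concat (replicate m [1, -1])"

lemma alternating_simps [simp]:
  "alternating 0 = []" "alternating (Suc m) = 1 # -1 # alternating m"
  by (simp_all add: alternating_def)

lemma lp_sum_alternating: "lp_sum p (alternating m) = 2 * real m"
  by (induction m) auto

text \<open>All inner entries cancel and only the two ends remain. The first entry \<open>c\<close>
  is left free because the induction peels off two entries and continues with \<open>c = 1\<close>;
  the application has \<open>c = 0\<close>.\<close>

lemma lp_sum_alternating_shift:
  "lp_sum p (map2 (-) (alternating m @ [0]) (c # map ((*) (-1)) (alternating m)))
    = (if m = 0 then \<bar>c\<bar> powr p else \<bar>1 - c\<bar> powr p + 1)"
  by (induction m arbitrary: c) auto

text \<open>
  The negative of an alternating block is, up to its two end points, the same block shifted by one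
  position, and shifts do not change the value of \<open>N\<close>.
\<close>

lemma nonzeros_block_subst_pad:
  "nonzeros (block_subst w (L @ x # R)) = nonzeros (block_subst w L @ map ((*) x) (w @ [0]) @ block_subst w R)"
  "nonzeros (block_subst w (L @ - x # R)) =
    nonzeros (block_subst w L @ map ((*) x) (0 # map ((*) (-1)) w) @ block_subst w R)"
proof -
  have "(*) (- x) = (\<lambda>y. - (x * y))" by auto
  then show "nonzeros (block_subst w (L @ - x # R)) =
    nonzeros (block_subst w L @ map ((*) x) (0 # map ((*) (-1)) w) @ block_subst w R)"
    by (simp add: o_def)
qed simp

lemma lp_like_sign_invariant:
  assumes p: "1 < p" and N: "lp_like TYPE('z::real_normed_vector) p C N"
  obtains M where "lp_like TYPE('z) p C M" "\<And>xs. M (map abs xs) = M xs"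
proof -
  let ?w = "\<lambda>m. alternating (Suc m)"
  have w: "0 < lp_sum p (?w m)" for m
    unfolding lp_sum_alternating by simp
  obtain M where M: "lp_like TYPE('z) p C M"
    and lim: "\<And>xs. ((\<lambda>m. N (block_subst (?w m) xs) / lp_list p (?w m)) \<longlongrightarrow> M xs) free_ultra"
    using lp_like_block_limit[where w = ?w, OF N w] by blast
  \<comment> \<open>The two ends contribute 2 against the mass \<open>2 * Suc m\<close> of the
    block; this ratio is the factor \<open>inverse (real (Suc m))\<close>.\<close>
  have swap: "M (L @ x # R) = M (L @ - x # R)" for L R x
  proof (rule lp_like_limit_eq[where N = N and w = ?w and M = M, OF _ w lim, where c = "\<lambda>m. \<bar>x\<bar> powr p * inverse (real (Suc m))"])
    show "eventually (\<lambda>m. \<bar>N (block_subst (?w m) (L @ x # R)) - N (block_subst (?w m) (L @ - x # R))\<bar>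
        \<le> (\<bar>x\<bar> powr p * inverse (real (Suc m)) * lp_sum p (?w m)) powr (1 / p)) sequentially"
    proof (intro always_eventually allI)
      fix m
      let ?L = "block_subst (?w m) L" and ?R = "block_subst (?w m) R"
      let ?u = "?w m @ [0]" and ?v = "0 # map ((*) (-1)) (?w m)"
      have "N (block_subst (?w m) (L @ x # R)) = N (?L @ map ((*) x) ?u @ ?R)"
        by (rule lp_like_nonzeros_cong[OF N nonzeros_block_subst_pad(1)])
      moreover have "N (block_subst (?w m) (L @ - x # R)) = N (?L @ map ((*) x) ?v @ ?R)"
        by (rule lp_like_nonzeros_cong[OF N nonzeros_block_subst_pad(2)])
      ultimately have "\<bar>N (block_subst (?w m) (L @ x # R)) - N (block_subst (?w m) (L @ - x # R))\<bar>
          \<le> lp_list p (map2 (-) (map ((*) x) ?u) (map ((*) x) ?v))"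
        using lp_like_context[OF N, of "map ((*) x) ?u" "map ((*) x) ?v"]
        by (simp only: length_map length_append list.size)
      also have "\<dots> = (\<bar>x\<bar> powr p * lp_sum p (map2 (-) ?u ?v)) powr (1 / p)"
        unfolding map2_diff_scale lp_list_def lp_sum_scale ..
      also have "\<bar>x\<bar> powr p * lp_sum p (map2 (-) ?u ?v) = \<bar>x\<bar> powr p * inverse (real (Suc m)) * lp_sum p (?w m)"
        unfolding lp_sum_alternating_shift lp_sum_alternating by (simp add: field_simps)
      finally show "\<bar>N (block_subst (?w m) (L @ x # R)) - N (block_subst (?w m) (L @ - x # R))\<bar>
        \<le> (\<bar>x\<bar> powr p * inverse (real (Suc m)) * lp_sum p (?w m)) powr (1 / p)" .
    qed
    show "(\<lambda>m. \<bar>x\<bar> powr p * inverse (real (Suc m))) \<longlonglongrightarrow> 0"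
      using tendsto_mult_right_zero[OF LIMSEQ_inverse_real_of_nat] by simp
  qed (use p in auto)
  have "M (L @ map abs xs) = M (L @ xs)" for L xs
  proof (induction xs arbitrary: L)
    case (Cons x xs)
    have "M (L @ \<bar>x\<bar> # xs) = M (L @ x # xs)"
      using swap[of L x xs] by (auto simp: abs_if)
    then show ?case using Cons[of "L @ [\<bar>x\<bar>]"] by simp
  qed simp
  from M this[of "[]"] that show ?thesis by simp
qed

subsection \<open>Dilation invariance\<close>

text \<open>The mean over a period divisible by \<open>q ^ a\<close> is 1. Replacing
  \<open>j\<close> by \<open>q * j\<close> lowers a positive exponent by one and produces a factor
  \<open>q\<close>.\<close>

definition dil_term :: "nat \<Rightarrow> nat \<Rightarrow> nat \<Rightarrow> real"
  where "dil_term q a j = (if q ^ a dvd j then real q ^ a else 0)"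

text \<open>Multiplying the argument by a prime of \<open>P\<close> affects only the factor of that
  prime, so one weight serves all primes of \<open>P\<close>. Since the exponents start at 1, the
  weight for finite \<open>P\<close> vanishes at the non-multiples of each prime in
  \<open>P\<close>; these zeros can later be deleted.\<close>

definition dil_weight :: "nat \<Rightarrow> nat set \<Rightarrow> nat \<Rightarrow> real"
  where "dil_weight n P j = (\<Prod>q\<in>P. \<Sum>a<n. dil_term q (Suc a) j)"

lemma dil_term_nonneg: "0 \<le> dil_term q a j"
  by (simp add: dil_term_def)

lemma dil_weight_nonneg: "0 \<le> dil_weight n P j"
  unfolding dil_weight_def by (intro prod_nonneg sum_nonneg ballI dil_term_nonneg)

lemma dil_term_periodic: "q ^ a dvd M \<Longrightarrow> dil_term q a (j + M) = dil_term q a j"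
  by (simp add: dil_term_def dvd_add_left_iff)

lemma dil_term_mult: "0 < q \<Longrightarrow> dil_term q (Suc a) (q * j) = real q * dil_term q a j"
  by (simp add: dil_term_def)

lemma dil_term_coprime: "coprime r q \<Longrightarrow> dil_term r a (q * j) = dil_term r a j"
  by (simp add: dil_term_def coprime_dvd_mult_right_iff)

lemma dil_term_eq_0: "\<not> q dvd j \<Longrightarrow> dil_term q (Suc a) j = 0"
  by (auto simp: dil_term_def dest: dvd_mult_left)

lemma sum_periodic:
  fixes f :: "nat \<Rightarrow> real"
  assumes "\<And>i. f (i + M) = f i"
  shows "(\<Sum>i<q * M. f i) = real q * (\<Sum>i<M. f i)"
proof (induction q)
  case (Suc q)
  have shift: "f (i + k * M) = f i" for i k
  proof (induction k)
    case (Suc k)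
    then show ?case using assms[of "i + k * M"] by (simp add: algebra_simps)
  qed simp
  have "(\<Sum>i<Suc q * M. f i) = (\<Sum>i<q * M. f i) + (\<Sum>i=q * M..<q * M + M. f i)"
    by (simp add: sum.atLeastLessThan_concat atLeast0LessThan[symmetric] add.commute)
  also have "(\<Sum>i=q * M..<q * M + M. f i) = (\<Sum>i<M. f i)"
    using sum.shift_bounds_nat_ivl[of f 0 "q * M" M] by (simp add: shift add.commute atLeast0LessThan)
  finally show ?case using Suc by (simp add: distrib_right)
qed simp

lemma sum_multiples:
  fixes f :: "nat \<Rightarrow> real"
  assumes q: "0 < q" and f: "\<And>i. \<not> q dvd i \<Longrightarrow> f i = 0"
  shows "(\<Sum>i<q * M. f i) = (\<Sum>j<M. f (q * j))"
proof -
  have "(\<Sum>j<M. f (q * j)) = (\<Sum>i\<in>(*) q ` {..<M}. f i)"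
    using q by (subst sum.reindex) (auto simp: inj_on_def)
  also have "\<dots> = (\<Sum>i<q * M. f i)"
  proof (intro sum.mono_neutral_left ballI)
    fix i assume i: "i \<in> {..<q * M} - (*) q ` {..<M}"
    have "\<not> q dvd i"
      using i q by (auto simp: dvd_def)
    then show "f i = 0" by (rule f)
  qed (use q in auto)
  finally show ?thesis ..
qed

text \<open>
  Writing \<open>e\<^sub>a\<close> for \<^term>\<open>dil_term q a\<close> and \<open>B\<close> for the product over the other primes, the mean of
  \<open>e\<^sub>a B\<close> over a period does not depend on \<open>a\<close>, whereas \<open>j \<mapsto> q j\<close> shifts \<open>a\<close>: all of the defect
  comes from the two end terms of the telescoping sum.
\<close>

lemma dil_weight_almost_invariant:
  assumes P: "finite P" "\<And>r. r \<in> P \<Longrightarrow> prime r" "q \<in> P"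
    and M: "\<And>r. r \<in> P \<Longrightarrow> r ^ n dvd M" and n: "0 < n"
  shows "(\<Sum>j<M. \<bar>dil_weight n P (q * j) - real q * dil_weight n P j\<bar>)
    \<le> 2 * real q / real n * (\<Sum>j<M. dil_weight n P j)"
proof -
  define B where "B = dil_weight n (P - {q})"
  define W where "W a = (\<Sum>j<M. dil_term q a j * B j)" for a
  have q: "0 < q" using P prime_gt_0_nat by blast
  have dvdM: "r ^ a dvd M" if "r \<in> P" "a \<le> n" for r a
    using M[OF that(1)] le_imp_power_dvd[OF that(2)] dvd_trans by blast
  have B_nonneg: "0 \<le> B j" for j
    unfolding B_def by (rule dil_weight_nonneg)
  have B_period: "B (j + M) = B j" for j
    unfolding B_def dil_weight_def using dvdM
    by (intro prod.cong sum.cong dil_term_periodic) (auto simp del: power_Suc)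
  have B_mult: "B (q * j) = B j" for j
    unfolding B_def dil_weight_def using P
    by (intro prod.cong sum.cong dil_term_coprime primes_coprime) auto
  have split: "dil_weight n P j = (\<Sum>a<n. dil_term q (Suc a) j) * B j" for j
    unfolding B_def dil_weight_def using P by (simp add: prod.remove)
  \<comment> \<open>The sum over \<open>q\<close> periods is computed in two ways: by periodicity,
    and by keeping only the multiples of \<open>q\<close>.\<close>
  have "W (Suc a) = W a" if "a < n" for a
  proof -
    let ?f = "\<lambda>i. dil_term q (Suc a) i * B i"
    have "real q * W (Suc a) = (\<Sum>i<q * M. ?f i)"
      unfolding W_def using that P(3)
      by (subst sum_periodic) (auto simp: B_period dil_term_periodic dvdM Suc_leI simp del: power_Suc)
    also have "\<dots> = (\<Sum>j<M. ?f (q * j))"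
      using q by (intro sum_multiples) (auto simp: dil_term_eq_0)
    also have "\<dots> = real q * W a"
      unfolding W_def by (simp add: dil_term_mult q B_mult sum_distrib_left mult.assoc)
    finally show ?thesis using q by simp
  qed
  then have W: "W a = W 0" if "a \<le> n" for a
    using that by (induction a) auto
  have "(\<Sum>j<M. dil_weight n P j) = (\<Sum>a<n. W (Suc a))"
    unfolding split W_def sum_distrib_right by (rule sum.swap)
  also have "\<dots> = (\<Sum>a<n. W 0)"
    by (intro sum.cong refl W) auto
  also have "\<dots> = real n * W 0"
    by simp
  finally have total: "(\<Sum>j<M. dil_weight n P j) = real n * W 0" .
  have "\<bar>dil_weight n P (q * j) - real q * dil_weight n P j\<bar>
      \<le> real q * (dil_term q 0 j * B j + dil_term q n j * B j)" for j
  proof -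
    have "dil_weight n P (q * j) - real q * dil_weight n P j
        = real q * ((\<Sum>a<n. dil_term q a j - dil_term q (Suc a) j) * B j)"
    proof -
      have "(\<Sum>a<n. dil_term q (Suc a) (q * j)) = real q * (\<Sum>a<n. dil_term q a j)"
        by (simp add: dil_term_mult q sum_distrib_left)
      then show ?thesis
        unfolding split B_mult sum_subtractf by (simp add: algebra_simps)
    qed
    also have "\<dots> = real q * ((dil_term q 0 j - dil_term q n j) * B j)"
      using sum_lessThan_telescope'[of "\<lambda>a. dil_term q a j" n] by simp
    finally have "\<bar>dil_weight n P (q * j) - real q * dil_weight n P j\<bar>
        = real q * (\<bar>dil_term q 0 j - dil_term q n j\<bar> * B j)"
      by (simp add: abs_mult B_nonneg)
    also have "\<dots> \<le> real q * ((dil_term q 0 j + dil_term q n j) * B j)"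
      using dil_term_nonneg[of q 0 j] dil_term_nonneg[of q n j] B_nonneg[of j]
      by (intro mult_left_mono mult_right_mono) auto
    finally show ?thesis by (simp add: distrib_right)
  qed
  then have "(\<Sum>j<M. \<bar>dil_weight n P (q * j) - real q * dil_weight n P j\<bar>)
      \<le> (\<Sum>j<M. real q * (dil_term q 0 j * B j + dil_term q n j * B j))"
    by (intro sum_mono)
  also have "\<dots> = real q * (W 0 + W n)"
    unfolding W_def by (simp add: sum.distrib flip: sum_distrib_left)
  also have "\<dots> = 2 * real q / real n * (\<Sum>j<M. dil_weight n P j)"
    unfolding total using n W[of n] by simp
  finally show ?thesis .
qed

section \<open>Blocks built from the dilation weights\<close>

lemma concat_replicate_periodic:
  assumes "\<And>i. f (i + M) = f i"
  shows "concat (replicate q (map f [0..<M])) = map f [0..<q * M]"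
proof (induction q)
  case (Suc q)
  have "map f [M..<M + q * M] = map f [0..<q * M]"
    by (rule nth_equalityI) (simp_all add: assms add.commute[of M])
  then show ?case
    using Suc by (simp add: upt_add_eq_append[of 0 M])
qed simp

text \<open>The counterpart of \<open>sum_multiples\<close> for lists: of each run of
  \<open>q\<close> consecutive positions only the first can survive the deletion of zeros.\<close>

lemma nonzeros_multiples:
  assumes q: "0 < q" and f: "\<And>i. \<not> q dvd i \<Longrightarrow> f i = 0"
  shows "nonzeros (map f [0..<q * M]) = nonzeros (map (\<lambda>j. f (q * j)) [0..<M])"
proof (induction M)
  case (Suc M)
  have "\<not> q dvd i" if i: "i \<in> set [Suc (q * M)..<q * M + q]" for i
  proof
    assume "q dvd i"
    then have "q dvd i - q * M" by simp
    then have "q \<le> i - q * M" using i by (intro dvd_imp_le) auto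
    then show False using i by auto
  qed
  then have "nonzeros (map f [Suc (q * M)..<q * M + q]) = []"
    using f by (auto simp: filter_empty_conv)
  then have "nonzeros (map f [q * M..<q * M + q]) = nonzeros [f (q * M)]"
    using q by (subst upt_conv_Cons) auto
  moreover have "[0..<q * Suc M] = [0..<q * M] @ [q * M..<q * M + q]"
    using upt_add_eq_append[of 0 "q * M" q] by (simp add: add.commute)
  ultimately show ?case
    using Suc by (simp only: map_append filter_append) simp
qed simp

text \<open>With the roots as entries, the weights are the \<open>p\<close>-th powers of the
  entries. The length is a common period, as \<open>q ^ a\<close> divides \<open>fact n ^ n\<close>
  for all primes \<open>q \<le> n\<close> and all \<open>a \<le> n\<close>.\<close>

definition dil_block :: "real \<Rightarrow> nat \<Rightarrow> real list"
  where "dil_block p n = map (\<lambda>j. dil_weight n {q. prime q \<and> q \<le> n} j powr (1 / p)) [0..<fact n ^ n]"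

lemma lp_sum_dil_block:
  "0 < p \<Longrightarrow> lp_sum p (dil_block p n) = (\<Sum>j<fact n ^ n. dil_weight n {q. prime q \<and> q \<le> n} j)"
  by (simp add: dil_block_def lp_sum_map_upt powr_powr dil_weight_nonneg abs_of_nonneg)

lemma lp_sum_dil_block_pos:
  assumes "0 < p" "0 < n"
  shows "0 < lp_sum p (dil_block p n)"
proof -
  let ?v = "dil_weight n {q. prime q \<and> q \<le> n}"
  have "0 < ?v 0"
    unfolding dil_weight_def dil_term_def using assms
    by (intro prod_pos sum_pos) (auto simp: prime_gt_0_nat)
  also have "?v 0 \<le> (\<Sum>j<fact n ^ n. ?v j)"
    by (intro member_le_sum) (auto simp: dil_weight_nonneg)
  finally show ?thesis using assms by (simp add: lp_sum_dil_block)
qed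

text \<open>The \<open>q\<close> copies of the block form one stretch of a periodic function that
  vanishes at the non-multiples of \<open>q\<close>. Deleting zeros leaves its values at
  \<open>q * j\<close>, whose \<open>p\<close>-th powers are compared with \<open>q\<close> times
  those at \<open>j\<close> by \<open>dil_weight_almost_invariant\<close>.\<close>

lemma dil_block_replicate:
  assumes N: "lp_like TYPE('z::real_normed_vector) p C N" and p: "1 < p"
    and q: "prime q" "q \<le> n"
  shows "\<bar>N (block_subst (dil_block p n) (L @ replicate q t @ R))
      - N (block_subst (dil_block p n) (L @ [real q powr (1 / p) * t] @ R))\<bar>
    \<le> (\<bar>t\<bar> powr p * (2 * real q / real n) * lp_sum p (dil_block p n)) powr (1 / p)"
proof -
  let ?P = "{q. prime q \<and> q \<le> n}"
  define v where "v = dil_weight n ?P"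
  define M :: nat where "M = fact n ^ n"
  define f where "f i = t * v i powr (1 / p)" for i
  let ?w = "dil_block p n"
  let ?L = "block_subst ?w L" and ?R = "block_subst ?w R"
  have q0: "0 < q" and n: "0 < n" using q prime_gt_0_nat[of q] by auto
  have v0: "0 \<le> v j" for j unfolding v_def by (rule dil_weight_nonneg)
  have fin: "finite ?P" by (rule finite_subset[of _ "{..n}"]) auto
  have dvd: "r ^ a dvd M" if "r \<in> ?P" "a \<le> n" for r a
  proof -
    have "r dvd fact n" using that by (intro dvd_fact) (auto dest: prime_gt_0_nat)
    then have "r ^ a dvd fact n ^ a" by (rule dvd_power_same)
    also have "\<dots> dvd M" unfolding M_def using that by (intro le_imp_power_dvd)
    finally show ?thesis .
  qed
  have period: "v (i + M) = v i" for i
    unfolding v_def dil_weight_def using dvd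
    by (intro prod.cong sum.cong dil_term_periodic) (auto simp del: power_Suc)
  have v_eq_0: "v i = 0" if "\<not> q dvd i" for i
    unfolding v_def dil_weight_def using fin q that
    by (intro prod_zero bexI[of _ q]) (auto simp: dil_term_eq_0)
  have w: "map ((*) c) ?w = map (\<lambda>j. c * v j powr (1 / p)) [0..<M]" for c
    by (simp add: dil_block_def v_def M_def)
  have rep: "block_subst ?w (replicate k t) = concat (replicate k (map f [0..<M]))" for k
    by (induction k) (simp_all add: w f_def)
  have "nonzeros (block_subst ?w (replicate q t)) = nonzeros (map (\<lambda>j. f (q * j)) [0..<M])"
  proof -
    have "concat (replicate q (map f [0..<M])) = map f [0..<q * M]"
      by (rule concat_replicate_periodic) (simp add: f_def period)
    moreover have "nonzeros (map f [0..<q * M]) = nonzeros (map (\<lambda>j. f (q * j)) [0..<M])"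
      using q0 by (rule nonzeros_multiples) (simp add: f_def v_eq_0)
    ultimately show ?thesis unfolding rep by simp
  qed
  then have "N (block_subst ?w (L @ replicate q t @ R)) = N (?L @ map (\<lambda>j. f (q * j)) [0..<M] @ ?R)"
    by (intro lp_like_nonzeros_cong[OF N]) simp
  moreover have "block_subst ?w (L @ [real q powr (1 / p) * t] @ R)
      = ?L @ map (\<lambda>j. real q powr (1 / p) * f j) [0..<M] @ ?R"
    by (simp add: w f_def mult.assoc)
  ultimately have "\<bar>N (block_subst ?w (L @ replicate q t @ R))
      - N (block_subst ?w (L @ [real q powr (1 / p) * t] @ R))\<bar>
    \<le> lp_list p (map2 (-) (map (\<lambda>j. f (q * j)) [0..<M]) (map (\<lambda>j. real q powr (1 / p) * f j) [0..<M]))"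
    using lp_like_context[OF N, of "map (\<lambda>j. f (q * j)) [0..<M]" "map (\<lambda>j. real q powr (1 / p) * f j) [0..<M]"]
    by simp
  also have "\<dots> \<le> (\<bar>t\<bar> powr p * (2 * real q / real n) * lp_sum p ?w) powr (1 / p)"
    unfolding lp_list_def
  proof (intro powr_mono2)
    have "map2 (-) (map (\<lambda>j. f (q * j)) [0..<M]) (map (\<lambda>j. real q powr (1 / p) * f j) [0..<M])
        = map (\<lambda>j. f (q * j) - real q powr (1 / p) * f j) [0..<M]"
      by (rule nth_equalityI) auto
    then have "lp_sum p (map2 (-) (map (\<lambda>j. f (q * j)) [0..<M]) (map (\<lambda>j. real q powr (1 / p) * f j) [0..<M]))
        = (\<Sum>j<M. \<bar>f (q * j) - real q powr (1 / p) * f j\<bar> powr p)"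
      by (simp add: lp_sum_map_upt)
    also have "\<dots> \<le> (\<Sum>j<M. \<bar>t\<bar> powr p * \<bar>v (q * j) - real q * v j\<bar>)"
    proof (intro sum_mono)
      fix j
      have "f (q * j) - real q powr (1 / p) * f j = t * (v (q * j) powr (1 / p) - (real q * v j) powr (1 / p))"
        unfolding f_def using v0 by (simp add: powr_mult algebra_simps)
      then have "\<bar>f (q * j) - real q powr (1 / p) * f j\<bar> powr p
          = \<bar>t\<bar> powr p * \<bar>v (q * j) powr (1 / p) - (real q * v j) powr (1 / p)\<bar> powr p"
        by (simp add: abs_mult powr_mult)
      also have "\<dots> \<le> \<bar>t\<bar> powr p * \<bar>v (q * j) - real q * v j\<bar>"
        using p v0 by (intro mult_left_mono abs_diff_powr_inverse_le) auto
      finally show "\<bar>f (q * j) - real q powr (1 / p) * f j\<bar> powr p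
          \<le> \<bar>t\<bar> powr p * \<bar>v (q * j) - real q * v j\<bar>" .
    qed
    also have "\<dots> = \<bar>t\<bar> powr p * (\<Sum>j<M. \<bar>v (q * j) - real q * v j\<bar>)"
      by (simp add: sum_distrib_left)
    also have "\<dots> \<le> \<bar>t\<bar> powr p * (2 * real q / real n * (\<Sum>j<M. v j))"
      unfolding v_def using fin q n dvd
      by (intro mult_left_mono dil_weight_almost_invariant) auto
    also have "\<dots> = \<bar>t\<bar> powr p * (2 * real q / real n) * lp_sum p ?w"
      using p by (simp add: lp_sum_dil_block v_def M_def)
    finally show "lp_sum p (map2 (-) (map (\<lambda>j. f (q * j)) [0..<M]) (map (\<lambda>j. real q powr (1 / p) * f j) [0..<M]))
        \<le> \<bar>t\<bar> powr p * (2 * real q / real n) * lp_sum p ?w" .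
  qed (use p in auto)
  finally show ?thesis .
qed

lemma map_abs_block_subst: "map abs (block_subst w (map abs xs)) = map abs (block_subst w xs)"
  by (induction xs) (auto simp: abs_mult)

lemma lp_like_dilation_invariant:
  assumes p: "1 < p" and N: "lp_like TYPE('z::real_normed_vector) p C N"
    and abs: "\<And>xs. N (map abs xs) = N xs"
  shows "\<exists>M. lp_like TYPE('z) p C M \<and> (\<forall>xs. M (map abs xs) = M xs) \<and>
    (\<forall>q L t R. prime q \<longrightarrow> M (L @ replicate q t @ R) = M (L @ [real q powr (1 / p) * t] @ R))"
proof -
  let ?w = "\<lambda>m. dil_block p (Suc m)"
  have w: "0 < lp_sum p (?w m)" for m
    using p by (intro lp_sum_dil_block_pos) auto
  obtain M where M: "lp_like TYPE('z) p C M"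
    and lim: "\<And>xs. ((\<lambda>m. N (block_subst (?w m) xs) / lp_list p (?w m)) \<longlongrightarrow> M xs) free_ultra"
    using lp_like_block_limit[where w = ?w, OF N w] by blast
  have block_abs: "N (block_subst u (map abs xs)) = N (block_subst u xs)" for u xs
    by (metis abs map_abs_block_subst)
  have "M (map abs xs) = M xs" for xs
    using tendsto_unique[OF free_ultra_neq_bot, OF lim[of "map abs xs"]] lim[of xs]
    unfolding block_abs by blast
  moreover have "M (L @ replicate q t @ R) = M (L @ [real q powr (1 / p) * t] @ R)" if q: "prime q" for q L t R
  proof (rule lp_like_limit_eq[where N = N and w = ?w and M = M, OF _ w lim,
        where c = "\<lambda>m. \<bar>t\<bar> powr p * (2 * real q / real (Suc m))"])
    show "eventually (\<lambda>m. \<bar>N (block_subst (?w m) (L @ replicate q t @ R))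
        - N (block_subst (?w m) (L @ [real q powr (1 / p) * t] @ R))\<bar>
        \<le> (\<bar>t\<bar> powr p * (2 * real q / real (Suc m)) * lp_sum p (?w m)) powr (1 / p)) sequentially"
      \<comment> \<open>The block with index \<open>m\<close> takes account of the primes up to
        \<open>Suc m\<close>, so the estimate is available from \<open>m = q\<close> on.\<close>
      using eventually_ge_at_top[of q]
      by eventually_elim (use dil_block_replicate[OF N p q] in \<open>simp del: of_nat_Suc\<close>)
    have "(\<lambda>m. \<bar>t\<bar> powr p * (2 * real q) * inverse (real (Suc m))) \<longlonglongrightarrow> 0"
      by (rule tendsto_mult_right_zero[OF LIMSEQ_inverse_real_of_nat])
    then show "(\<lambda>m. \<bar>t\<bar> powr p * (2 * real q / real (Suc m))) \<longlonglongrightarrow> 0"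
      by (simp add: divide_inverse mult.assoc)
  qed (use p in auto)
  ultimately show ?thesis using M by blast
qed

subsection \<open>Almost isometric copies\<close>

text \<open>Induction on the prime factorisation: \<open>q * d\<close> equal entries are
  \<open>d\<close> groups of \<open>q\<close>. Each group is contracted to one entry, and then the
  \<open>d\<close> resulting equal entries are contracted.\<close>

lemma lp_like_replicate:
  assumes abs: "\<And>q L t R. prime q \<Longrightarrow> N (L @ replicate q t @ R) = N (L @ [real q powr (1 / p) * t] @ R)"
    and d: "0 < (d::nat)"
  shows "N (L @ replicate d t @ R) = N (L @ [real d powr (1 / p) * t] @ R)"
  using d
proof (induction d arbitrary: L t R rule: prime_divisors_induct)
  case (unit d)
  then show ?case by simp
next
  case (factor q d)
  have blocks: "N (L @ replicate (k * q) t @ R) = N (L @ replicate k (real q powr (1 / p) * t) @ R)" for k L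
  proof (induction k arbitrary: L)
    case (Suc k)
    have "N (L @ replicate (Suc k * q) t @ R) = N (L @ replicate q t @ (replicate (k * q) t @ R))"
      by (simp add: replicate_add)
    also have "\<dots> = N (L @ [real q powr (1 / p) * t] @ (replicate (k * q) t @ R))"
      by (rule abs) fact
    also have "\<dots> = N ((L @ [real q powr (1 / p) * t]) @ replicate k (real q powr (1 / p) * t) @ R)"
      using Suc[of "L @ [real q powr (1 / p) * t]"] by simp
    finally show ?case by simp
  qed simp
  have "0 < d" using factor.prems by simp
  then show ?case
    using blocks[of L d] factor.IH[of L "real q powr (1 / p) * t" R]
    by (simp add: mult.commute[of q d] powr_mult ac_simps)
qed simp

lemma nat_floor_bounds:
  assumes "0 \<le> (y::real)"
  shows "real (nat \<lfloor>y\<rfloor>) \<le> y" "y \<le> real (nat \<lfloor>y\<rfloor>) + 1"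
proof -
  show "real (nat \<lfloor>y\<rfloor>) \<le> y" using assms by (rule of_nat_floor)
  show "y \<le> real (nat \<lfloor>y\<rfloor>) + 1" by linarith
qed

lemma abs_diff_divide_le:
  fixes c :: real
  assumes "0 < c" "m \<le> a * c" "a * c \<le> m + 1"
  shows "\<bar>a - m * (1 / c)\<bar> \<le> 1 / c"
proof -
  have "a - m * (1 / c) = (a * c - m) / c"
    using assms by (simp add: diff_divide_distrib)
  then show ?thesis
    using assms by (simp add: divide_right_mono)
qed

text \<open>If the \<open>p\<close>-th powers of the entries are integer multiples of a common
  number, each entry can be expanded into copies of one entry \<open>t\<close>, and all copies can
  then be contracted to a single entry. Nonnegative lists are approximated by such lists, and the
  Lipschitz estimate passes to the limit.\<close>

lemma lp_like_eq_multiple_lp_list: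
  assumes p: "1 < p" and N: "lp_like TYPE('z::real_normed_vector) p C N"
    and abs: "\<And>xs. N (map abs xs) = N xs"
    and dil: "\<And>q L t R. prime q \<Longrightarrow> N (L @ replicate q t @ R) = N (L @ [real q powr (1 / p) * t] @ R)"
  shows "N xs = N [1] * lp_list p xs"
proof -
  have rep: "finitely_represented TYPE('z) N" using N by (simp add: lp_like_def)
  have single: "N [x] = \<bar>x\<bar> * N [1]" for x
    using finitely_represented_scale[OF rep, of x "[1]"] by simp
  have repl: "N (L @ replicate m t @ R) = N (L @ [real m powr (1 / p) * t] @ R)" for L m t R
  proof (cases "m = 0")
    case True
    then show ?thesis by (intro lp_like_nonzeros_cong[OF N]) simp
  qed (use lp_like_replicate[OF dil] in simp)
  have expand: "N (L @ replicate (sum_list ms) t) = N (L @ map (\<lambda>m. real m powr (1 / p) * t) ms)" for L t ms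
  proof (induction ms arbitrary: L)
    case (Cons m ms)
    show ?case
      using repl[of L m t "replicate (sum_list ms) t"] Cons[of "L @ [real m powr (1 / p) * t]"]
      by (simp add: replicate_add)
  qed simp
  have scaled: "N (map (\<lambda>m. real m powr (1 / p) * t) ms) = N [1] * lp_list p (map (\<lambda>m. real m powr (1 / p) * t) ms)"
    for ms :: "nat list" and t
  proof -
    have "N (map (\<lambda>m. real m powr (1 / p) * t) ms) = N [real (sum_list ms) powr (1 / p) * t]"
      using expand[of "[]" ms t] repl[of "[]" "sum_list ms" t "[]"] by simp
    moreover have "lp_sum p (map (\<lambda>m. real m powr (1 / p) * t) ms) = real (sum_list ms) * \<bar>t\<bar> powr p"
      using p by (induction ms) (simp_all add: abs_mult powr_mult powr_powr distrib_right)
    then have "lp_list p (map (\<lambda>m. real m powr (1 / p) * t) ms) = real (sum_list ms) powr (1 / p) * \<bar>t\<bar>"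
      using p by (simp add: lp_list_def powr_mult powr_powr)
    ultimately show ?thesis
      using single[of "real (sum_list ms) powr (1 / p) * t"] by (simp add: abs_mult)
  qed
  \<comment> \<open>The \<open>p\<close>-th powers are rounded down to multiples of
    \<open>1 / Suc k\<close>, which is the \<open>p\<close>-th power of \<open>t k\<close>; thus
    \<open>ys k\<close> has the form treated in \<open>scaled\<close>.\<close>
  define ms where "ms k = map (\<lambda>x. nat \<lfloor>\<bar>x\<bar> powr p * real (Suc k)\<rfloor>) xs" for k
  define t where "t k = (1 / real (Suc k)) powr (1 / p)" for k
  define ys where "ys k = map (\<lambda>m. real m powr (1 / p) * t k) (ms k)" for k
  have len: "length (map abs xs) = length (ys k)" for k
    by (simp add: ys_def ms_def)
  have close: "lp_sum p (map2 (-) (map abs xs) (ys k)) \<le> real (length xs) * (1 / real (Suc k))" for k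
    unfolding ys_def ms_def
  proof (induction xs)
    case (Cons x xs)
    let ?m = "real (nat \<lfloor>\<bar>x\<bar> powr p * real (Suc k)\<rfloor>)"
    have m: "?m \<le> \<bar>x\<bar> powr p * real (Suc k)" "\<bar>x\<bar> powr p * real (Suc k) \<le> ?m + 1"
      by (simp_all only: nat_floor_bounds abs_ge_zero powr_ge_zero of_nat_0_le_iff mult_nonneg_nonneg)
    have "\<bar>(\<bar>x\<bar> powr p) powr (1 / p) - (?m * (1 / real (Suc k))) powr (1 / p)\<bar> powr p
        \<le> \<bar>\<bar>x\<bar> powr p - ?m * (1 / real (Suc k))\<bar>"
      using p by (intro abs_diff_powr_inverse_le) auto
    also have "\<dots> \<le> 1 / real (Suc k)"
      using m by (intro abs_diff_divide_le) auto
    finally have "\<bar>\<bar>x\<bar> - ?m powr (1 / p) * t k\<bar> powr p \<le> 1 / real (Suc k)"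
      using p by (simp only: t_def powr_mult powr_powr) simp
    moreover have split: "real (length (x # xs)) * c = c + real (length xs) * c" for c
      by (simp add: distrib_right)
    ultimately show ?case
      using Cons.IH unfolding split by (simp del: of_nat_Suc length_Cons)
  qed simp
  have lim: "(\<lambda>k. lp_list p (map2 (-) (map abs xs) (ys k))) \<longlonglongrightarrow> 0"
  proof (rule tendsto_sandwich[OF _ _ tendsto_const])
    have "(\<lambda>k. real (length xs) * (1 / real (Suc k))) \<longlonglongrightarrow> 0"
      using tendsto_mult_right_zero[OF LIMSEQ_inverse_real_of_nat] by (simp add: divide_inverse)
    then show "(\<lambda>k. (real (length xs) * (1 / real (Suc k))) powr (1 / p)) \<longlonglongrightarrow> 0"
      using p by (intro tendsto_zero_powrI[OF _ tendsto_const]) auto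
    show "eventually (\<lambda>k. lp_list p (map2 (-) (map abs xs) (ys k)) \<le> (real (length xs) * (1 / real (Suc k))) powr (1 / p)) sequentially"
      unfolding lp_list_def using close p by (intro always_eventually allI powr_mono2) auto
  qed simp
  have "(\<lambda>k. N (map abs xs) - N (ys k)) \<longlonglongrightarrow> 0"
    using lp_like_Lipschitz[OF N len] by (intro Lim_null_comparison[OF _ lim] always_eventually allI) simp
  then have "(\<lambda>k. N (map abs xs) - (N (map abs xs) - N (ys k))) \<longlonglongrightarrow> N (map abs xs) - 0"
    by (intro tendsto_diff tendsto_const)
  then have N_lim: "(\<lambda>k. N [1] * lp_list p (ys k)) \<longlonglongrightarrow> N xs"
    using scaled by (simp add: abs ys_def)
  have "\<bar>lp_sum p (ys k) - lp_sum p xs\<bar> \<le> real (length xs) * (1 / real (Suc k))" for k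
    unfolding ys_def ms_def
  proof (induction xs)
    case (Cons x xs)
    let ?m = "real (nat \<lfloor>\<bar>x\<bar> powr p * real (Suc k)\<rfloor>)"
    have m: "?m \<le> \<bar>x\<bar> powr p * real (Suc k)" "\<bar>x\<bar> powr p * real (Suc k) \<le> ?m + 1"
      by (simp_all only: nat_floor_bounds abs_ge_zero powr_ge_zero of_nat_0_le_iff mult_nonneg_nonneg)
    have "\<bar>?m powr (1 / p) * t k\<bar> powr p = ?m * (1 / real (Suc k))"
      using p by (simp add: t_def abs_mult powr_mult powr_powr del: of_nat_Suc)
    moreover have "\<bar>\<bar>x\<bar> powr p - ?m * (1 / real (Suc k))\<bar> \<le> 1 / real (Suc k)"
      using m by (intro abs_diff_divide_le) auto
    ultimately have "\<bar>\<bar>?m powr (1 / p) * t k\<bar> powr p - \<bar>x\<bar> powr p\<bar> \<le> 1 / real (Suc k)"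
      by (simp only: abs_minus_commute)
    moreover have split: "real (length (x # xs)) * c = c + real (length xs) * c" for c
      by (simp add: distrib_right)
    ultimately show ?case
      using Cons.IH unfolding split by (simp del: of_nat_Suc length_Cons) linarith
  qed simp
  moreover have "(\<lambda>k. real (length xs) * (1 / real (Suc k))) \<longlonglongrightarrow> 0"
    using tendsto_mult_right_zero[OF LIMSEQ_inverse_real_of_nat] by (simp add: divide_inverse)
  ultimately have "(\<lambda>k. lp_sum p (ys k) - lp_sum p xs) \<longlonglongrightarrow> 0"
    by (intro Lim_null_comparison[of "\<lambda>k. lp_sum p (ys k) - lp_sum p xs"] always_eventually allI) simp_all
  then have "(\<lambda>k. lp_sum p (ys k)) \<longlonglongrightarrow> lp_sum p xs"
    by (simp add: LIM_zero_iff)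
  then have "(\<lambda>k. lp_list p (ys k)) \<longlonglongrightarrow> lp_list p xs"
    unfolding lp_list_def using p by (intro tendsto_powr'[OF _ tendsto_const]) auto
  then have "(\<lambda>k. N [1] * lp_list p (ys k)) \<longlonglongrightarrow> N [1] * lp_list p xs"
    by (rule tendsto_mult_left)
  then show ?thesis
    using N_lim LIMSEQ_unique by blast
qed

theorem lp_list_finitely_represented:
  assumes p: "1 < p" and Z: "uniformly_contains_lp p (UNIV :: 'z::real_normed_vector set)"
  shows "finitely_represented TYPE('z) (lp_list p)"
proof -
  obtain C N where C: "1 \<le> C" and "lp_like TYPE('z) p C N"
    using uniformly_contains_lp_imp_lp_like[OF p Z] .
  then obtain N1 where "lp_like TYPE('z) p C N1" "\<And>xs. N1 (map abs xs) = N1 xs"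
    using lp_like_sign_invariant[OF p] by blast
  then obtain N2 where N2: "lp_like TYPE('z) p C N2" "\<And>xs. N2 (map abs xs) = N2 xs"
    "\<And>q L t R. prime q \<Longrightarrow> N2 (L @ replicate q t @ R) = N2 (L @ [real q powr (1 / p) * t] @ R)"
    using lp_like_dilation_invariant[OF p] by meson
  \<comment> \<open>The lower estimate has survived all limits and shows that the factor
    \<open>N2 [1]\<close> can be divided out.\<close>
  have "lp_list p [1] / C \<le> N2 [1]"
    using N2(1) unfolding lp_like_def by blast
  moreover have "0 < lp_list p [1] / C"
    using C by (simp add: lp_list_def)
  ultimately have pos: "0 < N2 [1]" by linarith
  have id: "block_subst [1] xs = xs" for xs
    by (induction xs) auto
  \<comment> \<open>Blocks of length one turn the block lemma into mere division by a positive
    constant.\<close>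
  have "finitely_represented TYPE('z) (\<lambda>xs. N2 (block_subst [1] xs) / N2 [1])"
    using N2(1) pos by (intro finitely_represented_block_subst) (auto simp: lp_like_def)
  moreover have "N2 (block_subst [1] xs) / N2 [1] = lp_list p xs" for xs
    using lp_like_eq_multiple_lp_list[OF p N2, of xs] pos by (simp add: id)
  ultimately show ?thesis by simp
qed

text \<open>A finite net of the cube reduces this to finitely many sequences.\<close>

theorem almost_isometric_lp_fin:
  assumes p: "1 < p" and Z: "uniformly_contains_lp p (UNIV :: 'z::real_normed_vector set)"
    and \<epsilon>: "0 < \<epsilon>"
  obtains z :: "nat \<Rightarrow> 'z::real_normed_vector" where
    "\<And>a. (\<And>i. i < k \<Longrightarrow> \<bar>a i\<bar> \<le> r) \<Longrightarrow> \<bar>norm (\<Sum>i<k. a i *\<^sub>R z i) - lp_list p (map a [0..<k])\<bar> \<le> \<epsilon>"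
proof -
  have rep: "finitely_represented TYPE('z) (lp_list p)"
    by (rule lp_list_finitely_represented[OF p Z])
  \<comment> \<open>The mesh \<open>1 / m\<close> is such that three errors of size
    \<open>k / m\<close> fit into a third of the tolerance: two from vectors of norm at most 2, one
    from the \<open>l_p\<close> norm.\<close>
  define m where "m = Suc (nat \<lceil>9 * real k / \<epsilon>\<rceil>)"
  define G where "G = (\<lambda>j. real_of_int j / real m) ` {-\<lceil>\<bar>r\<bar> * real m\<rceil> - 1..\<lceil>\<bar>r\<bar> * real m\<rceil>}"
  \<comment> \<open>The unit vectors are included to bound the norms of the \<open>z i\<close>,
    whence the bound 1 in the tolerance \<open>min (\<epsilon> / 3) 1\<close>.\<close>
  define A where "A = {xs. set xs \<subseteq> G \<and> length xs = k} \<union> (\<lambda>i. map (\<lambda>j. if j = i then 1 else 0) [0..<k]) ` {..<k}"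
  have "finite A" by (simp add: A_def G_def finite_lists_length_eq)
  then obtain z :: "nat \<Rightarrow> 'z" where z: "\<And>xs. xs \<in> A \<Longrightarrow> \<bar>norm (lin_comb z xs) - lp_list p xs\<bar> < min (\<epsilon> / 3) 1"
    using finitely_representedD[OF rep, of A "min (\<epsilon> / 3) 1"] \<epsilon> by auto
  have m: "0 < m" "3 * (real k / real m) \<le> \<epsilon> / 3"
  proof -
    have "9 * real k / \<epsilon> \<le> real m" unfolding m_def by linarith
    then have "9 * real k \<le> real m * \<epsilon>" using \<epsilon> by (simp add: pos_divide_le_eq)
    moreover show "0 < m" by (simp add: m_def)
    ultimately show "3 * (real k / real m) \<le> \<epsilon> / 3" by (simp add: field_simps)
  qed
  have z_le: "norm (z i) \<le> 2" if "i < k" for i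
  proof -
    let ?e = "map (\<lambda>j. if j = i then 1 else 0 :: real) [0..<k]"
    have "lin_comb z ?e = (\<Sum>j<k. if j = i then z j else 0)"
      unfolding lin_comb_map_upt by (intro sum.cong) auto
    then have "lin_comb z ?e = z i" using that by simp
    moreover have "lp_sum p ?e = (\<Sum>j<k. if j = i then 1 else 0)"
      unfolding lp_sum_map_upt by (intro sum.cong) auto
    then have "lp_list p ?e = 1" using that by (simp add: lp_list_def)
    moreover have "?e \<in> A" using that by (auto simp: A_def)
    ultimately show ?thesis using z[of ?e] by (simp add: abs_less_iff)
  qed
  show ?thesis
  proof (rule that)
    fix a :: "nat \<Rightarrow> real" assume a: "\<And>i. i < k \<Longrightarrow> \<bar>a i\<bar> \<le> r"
    define b where "b i = real_of_int \<lfloor>a i * real m\<rfloor> / real m" for i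
    have ab: "\<bar>a i - b i\<bar> \<le> 1 / real m" for i
    proof -
      have "\<bar>a i * real m - real_of_int \<lfloor>a i * real m\<rfloor>\<bar> \<le> 1" by linarith
      moreover have "a i - b i = (a i * real m - real_of_int \<lfloor>a i * real m\<rfloor>) / real m"
        using m(1) by (simp add: b_def diff_divide_distrib)
      ultimately show ?thesis by (simp add: divide_right_mono)
    qed
    have "b i \<in> G" if "i < k" for i
    proof -
      have "\<bar>a i * real m\<bar> \<le> \<bar>r\<bar> * real m"
        using a[OF that] by (auto simp: abs_mult intro!: mult_right_mono)
      then have "\<lfloor>a i * real m\<rfloor> \<in> {-\<lceil>\<bar>r\<bar> * real m\<rceil> - 1..\<lceil>\<bar>r\<bar> * real m\<rceil>}"
        by (simp add: abs_le_iff) linarith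
      then show ?thesis unfolding G_def b_def by (rule imageI)
    qed
    then have "map b [0..<k] \<in> A" by (auto simp: A_def)
    then have "\<bar>norm (\<Sum>i<k. b i *\<^sub>R z i) - lp_list p (map b [0..<k])\<bar> \<le> \<epsilon> / 3"
      using z[of "map b [0..<k]"] by (simp add: lin_comb_map_upt)
    moreover have "\<bar>norm (\<Sum>i<k. a i *\<^sub>R z i) - norm (\<Sum>i<k. b i *\<^sub>R z i)\<bar> \<le> 2 * (real k / real m)"
    proof -
      have "\<bar>norm (\<Sum>i<k. a i *\<^sub>R z i) - norm (\<Sum>i<k. b i *\<^sub>R z i)\<bar>
          \<le> norm (\<Sum>i<k. (a i - b i) *\<^sub>R z i)"
        using norm_triangle_ineq3[of "\<Sum>i<k. a i *\<^sub>R z i" "\<Sum>i<k. b i *\<^sub>R z i"]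
        by (simp add: sum_subtractf scaleR_diff_left)
      also have "\<dots> \<le> (\<Sum>i<k. (1 / real m) * 2)"
        using ab z_le by (intro sum_norm_le) (auto intro!: mult_mono simp del: times_divide_eq_left)
      finally show ?thesis by (simp add: mult.commute)
    qed
    moreover have "\<bar>lp_list p (map a [0..<k]) - lp_list p (map b [0..<k])\<bar> \<le> real k / real m"
    proof -
      have "\<bar>lp_list p (map a [0..<k]) - lp_list p (map b [0..<k])\<bar>
          \<le> lp_list p (map2 (-) (map a [0..<k]) (map b [0..<k]))"
        by (rule finitely_represented_triangle[OF rep]) simp
      also have "map2 (-) (map a [0..<k]) (map b [0..<k]) = map (\<lambda>i. a i - b i) [0..<k]"
        by (rule nth_equalityI) auto
      also have "lp_list p (map (\<lambda>i. a i - b i) [0..<k]) \<le> (\<Sum>i<k. (1 / real m) powr p) powr (1 / p)"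
        unfolding lp_list_def lp_sum_map_upt using ab p
        by (intro powr_mono2 sum_mono sum_nonneg) auto
      also have "\<dots> = real k powr (1 / p) * (1 / real m)"
        using p by (simp add: powr_mult powr_powr)
      also have "\<dots> \<le> real k * (1 / real m)"
      proof (cases "k = 0")
        case False
        then show ?thesis
          using p powr_mono[of "1 / p" 1 "real k"] by (intro mult_right_mono) auto
      qed simp
      finally show ?thesis by simp
    qed
    ultimately show "\<bar>norm (\<Sum>i<k. a i *\<^sub>R z i) - lp_list p (map a [0..<k])\<bar> \<le> \<epsilon>"
      using m(2) by linarith
  qed
qed

section \<open>Correcting distances\<close>

subsection \<open>A covering lemma\<close>

definition unit_vec :: "nat \<Rightarrow> (nat \<Rightarrow> real) \<Rightarrow> nat \<Rightarrow> real"
  where "unit_vec m v = (\<lambda>i. if i < m then v i / sqrt (\<Sum>j<m. (v j)\<^sup>2) else 0)"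

lemma sum_squares_unit_vec:
  assumes "\<exists>i<m. v i \<noteq> 0"
  shows "(\<Sum>i<m. (unit_vec m v i)\<^sup>2) = 1"
proof -
  have "0 < (\<Sum>j<m. (v j)\<^sup>2)"
  proof -
    obtain i where "i < m" "v i \<noteq> 0" using assms by blast
    then show ?thesis by (intro sum_pos2[of "{..<m}" i]) auto
  qed
  then show ?thesis
    by (simp add: unit_vec_def power_divide sum_nonneg flip: sum_divide_distrib)
qed

text \<open>Radial projection of a nowhere vanishing family is a homotopy in the sphere.\<close>

lemma homotopic_unit_vec:
  fixes K :: "real \<times> (nat \<Rightarrow> real) \<Rightarrow> nat \<Rightarrow> real" and m :: nat
  defines "S \<equiv> {x. (\<Sum>i<m. (x i)\<^sup>2) = 1 \<and> (\<forall>i\<ge>m. x i = 0)}"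
  assumes cont: "\<And>i. i < m \<Longrightarrow> continuous_on ({0..1} \<times> S) (\<lambda>z. K z i)"
    and nz: "\<And>s x. 0 \<le> s \<Longrightarrow> s \<le> 1 \<Longrightarrow> x \<in> S \<Longrightarrow> \<exists>i<m. K (s, x) i \<noteq> 0"
  shows "homotopic_with_canon (\<lambda>_. True) S S (\<lambda>x. unit_vec m (K (0, x))) (\<lambda>x. unit_vec m (K (1, x)))"
proof -
  have pos: "0 < (\<Sum>j<m. (K z j)\<^sup>2)" if z: "z \<in> {0..1} \<times> S" for z
  proof -
    obtain i where "i < m" "K z i \<noteq> 0"
      using nz[of "fst z" "snd z"] z by auto
    then show ?thesis by (intro sum_pos2[of "{..<m}" i]) auto
  qed
  have "continuous_on ({0..1} \<times> S) (\<lambda>z. unit_vec m (K z) i)" for i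
  proof (cases "i < m")
    case True
    have "continuous_on ({0..1} \<times> S) (\<lambda>z. K z i / sqrt (\<Sum>j<m. (K z j)\<^sup>2))"
      using pos True by (intro continuous_intros cont) (auto simp: less_imp_neq[symmetric] dest: pos)
    then show ?thesis using True by (simp add: unit_vec_def)
  qed (simp add: unit_vec_def)
  then have "continuous_on ({0..1} \<times> S) (\<lambda>z. unit_vec m (K z))"
    by (rule continuous_on_coordinatewise_then_product)
  moreover have "unit_vec m (K (s, x)) \<in> S" if "0 \<le> s" "s \<le> 1" "x \<in> S" for s x
    using sum_squares_unit_vec[OF nz[OF that]] by (simp add: S_def) (simp add: unit_vec_def)
  ultimately show ?thesis
    unfolding homotopic_with_def
    by (intro exI[of _ "\<lambda>z. unit_vec m (K z)"])
       (auto simp: prod_topology_subtopology_eu continuous_map_subtopology_eu)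
qed

lemma sphere_not_contractible:
  "\<not> contractible {x :: nat \<Rightarrow> real. (\<Sum>i<Suc n. (x i)\<^sup>2) = 1 \<and> (\<forall>i\<ge>Suc n. x i = 0)}"
  using non_contractible_space_nsphere[of n]
  unfolding nsphere euclidean_product_topology contractible_space_top_of_set
  by (simp add: lessThan_Suc_atMost Suc_le_eq)

text \<open>
  If the image missed the origin, radial projection of \<open>G\<close> would provide a homotopy from the
  identity of the sphere to a constant map.
\<close>

lemma zero_of_almost_identity:
  fixes G :: "(nat \<Rightarrow> real) \<Rightarrow> nat \<Rightarrow> real"
  defines "B \<equiv> \<lambda>m r. {t :: nat \<Rightarrow> real. (\<forall>i\<ge>m. t i = 0) \<and> (\<Sum>i<m. (t i)\<^sup>2) \<le> r\<^sup>2}"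
  assumes r: "0 < r"
    and cont: "\<And>i. i < m \<Longrightarrow> continuous_on (B m r) (\<lambda>t. G t i)"
    and near: "\<And>t. t \<in> B m r \<Longrightarrow> (\<Sum>i<m. (t i)\<^sup>2) = r\<^sup>2 \<Longrightarrow> (\<Sum>i<m. (G t i - t i)\<^sup>2) < r\<^sup>2"
  shows "\<exists>t\<in>B m r. \<forall>i<m. G t i = 0"
proof (cases m)
  case 0
  then show ?thesis by (auto simp: B_def)
next
  case (Suc n)
  define S where "S = {x :: nat \<Rightarrow> real. (\<Sum>i<m. (x i)\<^sup>2) = 1 \<and> (\<forall>i\<ge>m. x i = 0)}"
  have scale: "(\<Sum>i<m. (c * x i)\<^sup>2) = c\<^sup>2" if "x \<in> S" for c x
    using that by (simp add: S_def power_mult_distrib flip: sum_distrib_left)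
  have mem: "(\<lambda>i. s * (r * x i)) \<in> B m r" if "0 \<le> s" "s \<le> 1" "x \<in> S" for s x
  proof -
    have "(s * r)\<^sup>2 \<le> r\<^sup>2"
      using that r by (intro power_mono) (auto simp: mult_left_le_one_le)
    then show ?thesis
      using scale[of x "s * r"] that by (simp add: B_def S_def mult.assoc)
  qed
  show ?thesis
  proof (rule ccontr)
    assume "\<not> ?thesis"
    then have nz: "\<exists>i<m. G t i \<noteq> 0" if "t \<in> B m r" for t
      using that by blast
    have coord: "continuous_on A (\<lambda>z. snd z i :: real)" for A :: "(real \<times> (nat \<Rightarrow> real)) set" and i
      by (rule continuous_on_compose2[OF continuous_on_product_coordinates continuous_on_snd[OF continuous_on_id]]) simp
    have contG: "continuous_on ({0..1} \<times> S) (\<lambda>z. G (\<lambda>j. fst z * (r * snd z j)) i)" if "i < m" for i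
    proof (rule continuous_on_compose2[OF cont[OF that]])
      show "continuous_on ({0..1} \<times> S) (\<lambda>z j. fst z * (r * snd z j))"
        by (intro continuous_on_coordinatewise_then_product continuous_on_mult continuous_on_const
            continuous_on_fst continuous_on_id) (rule coord)
    qed (use mem in auto)
    have contG1: "continuous_on ({0..1::real} \<times> S) (\<lambda>z. G (\<lambda>j. 1 * (r * snd z j)) i)" if "i < m" for i
    proof (rule continuous_on_compose2[OF cont[OF that]])
      show "continuous_on ({0..1::real} \<times> S) (\<lambda>z j. 1 * (r * snd z j))"
        by (intro continuous_on_coordinatewise_then_product continuous_on_mult continuous_on_const) (rule coord)
    qed (use mem[of 1] in auto)
    \<comment> \<open>The straight line from \<open>r * x\<close> to its value under
      \<open>G\<close>. A zero on it would force the displacement of \<open>G\<close> to have length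
      at least \<open>r\<close>, against \<open>near\<close>. The terms \<open>fst (0, x)\<close>
      stay unevaluated to match \<open>homotopic_unit_vec\<close>.\<close>
    have H1: "homotopic_with_canon (\<lambda>_. True) S S
        (\<lambda>x. unit_vec m (\<lambda>i. (1 - fst (0::real, x)) * (r * snd (0::real, x) i) + fst (0::real, x) * G (\<lambda>j. 1 * (r * snd (0::real, x) j)) i))
        (\<lambda>x. unit_vec m (\<lambda>i. (1 - fst (1::real, x)) * (r * snd (1::real, x) i) + fst (1::real, x) * G (\<lambda>j. 1 * (r * snd (1::real, x) j)) i))"
      unfolding S_def
    proof (rule homotopic_unit_vec, fold S_def)
      show "continuous_on ({0..1} \<times> S) (\<lambda>z. (1 - fst z) * (r * snd z i) + fst z * G (\<lambda>j. 1 * (r * snd z j)) i)"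
        if "i < m" for i
        by (intro continuous_intros coord contG1 that)
      fix s :: real and x assume s: "0 \<le> s" "s \<le> 1" and x: "x \<in> S"
      show "\<exists>i<m. (1 - fst (s, x)) * (r * snd (s, x) i) + fst (s, x) * G (\<lambda>j. 1 * (r * snd (s, x) j)) i \<noteq> 0"
      proof (rule ccontr)
        let ?t = "\<lambda>j. 1 * (r * x j)"
        assume "\<not> ?thesis"
        then have "r * x i = - s * (G ?t i - ?t i)" if "i < m" for i
          using that by (auto simp: algebra_simps)
        then have "(\<Sum>i<m. (r * x i)\<^sup>2) = (\<Sum>i<m. (- s * (G ?t i - ?t i))\<^sup>2)"
          by (intro sum.cong) auto
        also have "\<dots> = s\<^sup>2 * (\<Sum>i<m. (G ?t i - ?t i)\<^sup>2)"
          by (simp add: power_mult_distrib sum_distrib_left)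
        also have "\<dots> \<le> 1 * (\<Sum>i<m. (G ?t i - ?t i)\<^sup>2)"
          using s by (intro mult_right_mono sum_nonneg) (auto simp: power_le_one)
        also have "\<dots> < r\<^sup>2"
          using near[OF mem[OF _ _ x, of 1]] scale[OF x, of r] by simp
        finally show False
          using scale[OF x, of r] by simp
      qed
    qed
    \<comment> \<open>Now the radius shrinks from \<open>r\<close> to 0; this uses that
      \<open>G\<close> has no zero anywhere in the ball.\<close>
    have H2: "homotopic_with_canon (\<lambda>_. True) S S
        (\<lambda>x. unit_vec m (G (\<lambda>j. fst (0::real, x) * (r * snd (0::real, x) j))))
        (\<lambda>x. unit_vec m (G (\<lambda>j. fst (1::real, x) * (r * snd (1::real, x) j))))"
      unfolding S_def
    proof (rule homotopic_unit_vec, fold S_def)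
      show "\<exists>i<m. G (\<lambda>j. fst (s, x) * (r * snd (s, x) j)) i \<noteq> 0"
        if "0 \<le> s" "s \<le> 1" "x \<in> S" for s x
        using nz[OF mem[OF that]] by simp
    qed (use contG in auto)
    have unit: "unit_vec m (\<lambda>i. r * x i) = x" if "x \<in> S" for x
      unfolding unit_vec_def using scale[OF that, of r] r that by (auto simp: fun_eq_iff S_def)
    have "homotopic_with_canon (\<lambda>_. True) S S (\<lambda>x. unit_vec m (\<lambda>i. r * x i)) (\<lambda>x. unit_vec m (G (\<lambda>j. r * x j)))"
      using H1 by simp
    then have "homotopic_with_canon (\<lambda>_. True) S S id (\<lambda>x. unit_vec m (G (\<lambda>j. r * x j)))"
      by (rule homotopic_with_eq) (simp_all add: unit)
    moreover have "homotopic_with_canon (\<lambda>_. True) S S (\<lambda>x. unit_vec m (G (\<lambda>j. r * x j))) (\<lambda>x. unit_vec m (G (\<lambda>_. 0)))"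
      by (rule homotopic_with_symD) (use H2 in simp)
    ultimately have "homotopic_with_canon (\<lambda>_. True) S S id (\<lambda>x. unit_vec m (G (\<lambda>_. 0)))"
      by (rule homotopic_with_trans)
    then have "contractible S"
      unfolding contractible_def by blast
    then show False
      using sphere_not_contractible[of n] unfolding S_def Suc by blast
  qed
qed

subsection \<open>Perturbing distances\<close>

definition dpow :: "real \<Rightarrow> real \<Rightarrow> real"
  where "dpow p s = sgn s * \<bar>s\<bar> powr (p - 1)"

lemma has_real_derivative_abs_powr:
  assumes p: "1 < p"
  shows "((\<lambda>s. \<bar>s\<bar> powr p) has_real_derivative p * dpow p s) (at s)"
proof -
  consider "0 < s" | "s < 0" | "s = 0" by linarith
  then show ?thesis
  proof cases
    case 1
    have "((\<lambda>s. s powr p) has_real_derivative p * s powr (p - 1)) (at s)"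
      using 1 by (rule has_real_derivative_powr)
    then have "((\<lambda>s. \<bar>s\<bar> powr p) has_real_derivative p * s powr (p - 1)) (at s)"
      by (rule has_field_derivative_transform_within_open[of _ _ _ "{0<..}"]) (use 1 in auto)
    then show ?thesis using 1 by (simp add: dpow_def)
  next
    case 2
    have "((\<lambda>s. (- s) powr p) has_real_derivative p * (- s) powr (p - 1) * (- 1)) (at s)"
      using 2 by (intro DERIV_chain2[OF has_real_derivative_powr]) (auto intro!: derivative_eq_intros)
    then have "((\<lambda>s. \<bar>s\<bar> powr p) has_real_derivative p * (- s) powr (p - 1) * (- 1)) (at s)"
      by (rule has_field_derivative_transform_within_open[of _ _ _ "{..<0}"]) (use 2 in auto)
    then show ?thesis using 2 by (simp add: dpow_def)
  next
    case 3
    have "((\<lambda>h::real. \<bar>h\<bar> powr (p - 1)) \<longlongrightarrow> 0) (at 0)"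
      using p by (intro tendsto_zero_powrI[OF _ tendsto_const]) (auto intro!: tendsto_eq_intros)
    then have "((\<lambda>h::real. \<bar>h\<bar> powr p / h) \<longlongrightarrow> 0) (at 0)"
    proof (rule Lim_null_comparison[rotated])
      have "norm (\<bar>h\<bar> powr p / h) \<le> \<bar>h\<bar> powr (p - 1)" for h :: real
        by (cases "h = 0") (auto simp: powr_diff)
      then show "eventually (\<lambda>h. norm (\<bar>h\<bar> powr p / h) \<le> \<bar>h\<bar> powr (p - 1)) (at 0)"
        by (intro always_eventually allI)
    qed
    then show ?thesis using 3 by (simp add: DERIV_def dpow_def)
  qed
qed

lemma abs_powr_expansion:
  assumes p: "1 < p" and \<eta>: "0 < \<eta>" and W: "finite W"
  shows "\<exists>d>0. \<forall>s\<in>W. \<forall>h. \<bar>h\<bar> \<le> d \<longrightarrow> \<bar>\<bar>s + h\<bar> powr p - \<bar>s\<bar> powr p - p * dpow p s * h\<bar> \<le> \<eta> * \<bar>h\<bar>"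
  using W
proof (induction W)
  case empty
  show ?case by (auto intro: exI[of _ 1])
next
  case (insert s W)
  obtain d where d: "0 < d" "\<forall>s\<in>W. \<forall>h. \<bar>h\<bar> \<le> d \<longrightarrow> \<bar>\<bar>s + h\<bar> powr p - \<bar>s\<bar> powr p - p * dpow p s * h\<bar> \<le> \<eta> * \<bar>h\<bar>"
    using insert.IH by blast
  have "((\<lambda>h. (\<bar>s + h\<bar> powr p - \<bar>s\<bar> powr p) / h) \<longlongrightarrow> p * dpow p s) (at 0)"
    using has_real_derivative_abs_powr[OF p, of s] by (simp add: DERIV_def)
  then obtain e where e: "0 < e"
    "\<And>h. h \<noteq> 0 \<Longrightarrow> \<bar>h\<bar> < e \<Longrightarrow> \<bar>(\<bar>s + h\<bar> powr p - \<bar>s\<bar> powr p) / h - p * dpow p s\<bar> < \<eta>"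
    using \<eta> by (force simp: LIM_eq)
  have "\<bar>\<bar>s + h\<bar> powr p - \<bar>s\<bar> powr p - p * dpow p s * h\<bar> \<le> \<eta> * \<bar>h\<bar>" if "\<bar>h\<bar> < e" for h
  proof (cases "h = 0")
    case False
    then have "\<bar>s + h\<bar> powr p - \<bar>s\<bar> powr p - p * dpow p s * h
        = ((\<bar>s + h\<bar> powr p - \<bar>s\<bar> powr p) / h - p * dpow p s) * h"
      by (simp add: field_simps)
    then show ?thesis
      using e(2)[OF False that] by (simp add: abs_mult mult_right_mono)
  qed simp
  with d e(1) show ?case
    by (intro exI[of _ "min d (e / 2)"]) auto
qed

lemma almost_isometric_lp_fin_powr:
  assumes p: "1 < p" and Z: "uniformly_contains_lp p (UNIV :: 'z::real_normed_vector set)"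
    and \<epsilon>: "0 < \<epsilon>"
  obtains z :: "nat \<Rightarrow> 'z::real_normed_vector" where
    "\<And>a. (\<And>i. i < k \<Longrightarrow> \<bar>a i\<bar> \<le> r) \<Longrightarrow> \<bar>norm (\<Sum>i<k. a i *\<^sub>R z i) powr p - (\<Sum>i<k. \<bar>a i\<bar> powr p)\<bar> \<le> \<epsilon>"
proof -
  \<comment> \<open>\<open>b\<close> bounds the \<open>l_p\<close> norms of all admissible
    \<open>a\<close>. An error of at most 1 keeps the norms in the copy below \<open>b + 1\<close>,
    so uniform continuity on that interval applies.\<close>
  define b where "b = (real k * \<bar>r\<bar> powr p) powr (1 / p)"
  have "continuous_on {0..b + 1} (\<lambda>s. s powr p)"
    using p by (intro continuous_on_powr' continuous_intros) auto
  then have "uniformly_continuous_on {0..b + 1} (\<lambda>s. s powr p)"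
    by (rule compact_uniformly_continuous) simp
  then obtain d where d: "0 < d" "\<And>s t. s \<in> {0..b + 1} \<Longrightarrow> t \<in> {0..b + 1} \<Longrightarrow> dist t s < d \<Longrightarrow> dist (t powr p) (s powr p) < \<epsilon>"
    using \<epsilon> unfolding uniformly_continuous_on_def by meson
  have d2: "0 < min 1 (d / 2)" using d(1) by simp
  obtain z :: "nat \<Rightarrow> 'z" where z:
    "\<And>a. (\<And>i. i < k \<Longrightarrow> \<bar>a i\<bar> \<le> r) \<Longrightarrow> \<bar>norm (\<Sum>i<k. a i *\<^sub>R z i) - lp_list p (map a [0..<k])\<bar> \<le> min 1 (d / 2)"
    by (rule almost_isometric_lp_fin[OF p Z d2, of k r]) blast
  show ?thesis
  proof (rule that)
    fix a :: "nat \<Rightarrow> real" assume a: "\<And>i. i < k \<Longrightarrow> \<bar>a i\<bar> \<le> r"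
    have "(\<Sum>i<k. \<bar>a i\<bar> powr p) \<le> (\<Sum>i<k. \<bar>r\<bar> powr p)"
      using p a by (intro sum_mono powr_mono2) (auto intro: order_trans[OF _ abs_ge_self])
    then have "lp_list p (map a [0..<k]) \<le> b"
      unfolding lp_list_def lp_sum_map_upt b_def using p by (intro powr_mono2 sum_nonneg) auto
    moreover have "\<bar>norm (\<Sum>i<k. a i *\<^sub>R z i) - lp_list p (map a [0..<k])\<bar> \<le> min 1 (d / 2)"
      using a by (rule z)
    ultimately have "dist (norm (\<Sum>i<k. a i *\<^sub>R z i) powr p) (lp_list p (map a [0..<k]) powr p) < \<epsilon>"
      using d(1) by (intro d(2)) (auto simp: dist_real_def abs_le_iff)
    moreover have "lp_list p (map a [0..<k]) powr p = (\<Sum>i<k. \<bar>a i\<bar> powr p)"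
      using p by (simp add: lp_list_def lp_sum_map_upt powr_powr sum_nonneg)
    ultimately show "\<bar>norm (\<Sum>i<k. a i *\<^sub>R z i) powr p - (\<Sum>i<k. \<bar>a i\<bar> powr p)\<bar> \<le> \<epsilon>"
      by (simp add: dist_real_def)
  qed
qed

lemma finite_family_bound:
  fixes f :: "'a \<Rightarrow> real"
  assumes "finite A"
  obtains h where "0 \<le> h" "\<And>a. a \<in> A \<Longrightarrow> \<bar>f a\<bar> \<le> h"
proof
  show "0 \<le> (\<Sum>a\<in>A. \<bar>f a\<bar>)" by (rule sum_nonneg) simp
  show "\<bar>f a\<bar> \<le> (\<Sum>a\<in>A. \<bar>f a\<bar>)" if "a \<in> A" for a
    using that assms by (intro member_le_sum) auto
qed

text \<open>
  The directions \<open>V k\<close> invert the derivative of the map sending a tuple to the \<open>p\<close>-th powers of its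
  distances, so moving the tuple along them corrects the errors made by truncating the sequences
  and by passing to an almost isometric copy.
\<close>

proposition embedding_of_regular_tuple:
  fixes x :: "nat \<Rightarrow> nat \<Rightarrow> real" and m n :: nat and \<sigma> :: "nat \<Rightarrow> nat \<times> nat"
  assumes p: "1 < p" and Z: "uniformly_contains_lp p (UNIV :: 'z::real_normed_vector set)"
    and x: "\<And>i. i < n \<Longrightarrow> x i \<in> lp_space p"
    and \<sigma>: "\<And>k. k < m \<Longrightarrow> fst (\<sigma> k) < n \<and> snd (\<sigma> k) < n"
    and V: "\<And>k k'. k < m \<Longrightarrow> k' < m \<Longrightarrow> (\<Sum>l<n. p * dpow p (x (fst (\<sigma> k)) l - x (snd (\<sigma> k)) l) *
        (V k' (fst (\<sigma> k)) l - V k' (snd (\<sigma> k)) l)) = (if k = k' then 1 else 0)"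
  obtains \<zeta> :: "nat \<Rightarrow> 'z::real_normed_vector"
    where "\<And>k. k < m \<Longrightarrow> norm (\<zeta> (fst (\<sigma> k)) - \<zeta> (snd (\<sigma> k))) = lp_norm p (x (fst (\<sigma> k)) - x (snd (\<sigma> k)))"
proof -
  define w where "w k l = x (fst (\<sigma> k)) l - x (snd (\<sigma> k)) l" for k l
  define v where "v k k' l = (if l < n then V k' (fst (\<sigma> k)) l - V k' (snd (\<sigma> k)) l else 0)" for k k' l
  define h where "h k t l = (\<Sum>k'<m. t k' * v k k' l)" for k t l
  have w_mem: "w k \<in> lp_space p" and w_eq: "w k = x (fst (\<sigma> k)) - x (snd (\<sigma> k))" if "k < m" for k
  proof -
    show "w k = x (fst (\<sigma> k)) - x (snd (\<sigma> k))" by (auto simp: w_def)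
    then show "w k \<in> lp_space p"
      using \<sigma>[OF that] x by (auto intro: subspace_diff[OF subspace_lp_space[OF p]])
  qed
  have sums: "(\<lambda>l. \<bar>w k l\<bar> powr p) sums (lp_norm p (w k) powr p)" if "k < m" for k
    using w_mem[OF that] lp_norm_powr[OF p] by (simp add: lp_space_iff summable_sums)
  \<comment> \<open>The derivative of the \<open>k\<close>-th distance power along the displacement
    with parameter \<open>t\<close> is \<open>t k\<close>, so the linearised correction map is the
    identity.\<close>
  have lin: "(\<Sum>l<n. p * dpow p (w k l) * h k t l) = t k" if "k < m" for k t
  proof -
    have "(\<Sum>l<n. p * dpow p (w k l) * h k t l) = (\<Sum>k'<m. t k' * (\<Sum>l<n. p * dpow p (w k l) * v k k' l))"
      unfolding h_def sum_distrib_left by (subst sum.swap) (simp add: mult.assoc mult.left_commute)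
    also have "\<dots> = (\<Sum>k'<m. if k' = k then t k' else 0)"
    proof (intro sum.cong refl)
      fix k' assume "k' \<in> {..<m}"
      then show "t k' * (\<Sum>l<n. p * dpow p (w k l) * v k k' l) = (if k' = k then t k' else 0)"
        using V[OF that, of k'] by (simp add: v_def w_def)
    qed
    finally show ?thesis using that by simp
  qed
  obtain H0 where H0: "0 \<le> H0" "\<And>a. a \<in> {..<m} \<times> {..<m} \<times> {..<n} \<Longrightarrow> \<bar>(\<lambda>(k, k', l). v k k' l) a\<bar> \<le> H0"
    by (rule finite_family_bound[of "{..<m} \<times> {..<m} \<times> {..<n}" "\<lambda>(k, k', l). v k k' l"]) auto
  have H0': "\<bar>v k k' l\<bar> \<le> H0" if "k < m" "k' < m" for k k' l
    using H0(2)[of "(k, k', l)"] H0(1) that by (cases "l < n") (auto simp: v_def)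
  define H where "H = 1 + real m * H0"
  have H: "0 < H" using H0(1) by (simp add: H_def add_pos_nonneg)
  have h_le: "\<bar>h k t l\<bar> \<le> r * H" if k: "k < m" and t: "\<And>k'. k' < m \<Longrightarrow> \<bar>t k'\<bar> \<le> r" and r: "0 \<le> r" for k t l r
  proof -
    have "\<bar>h k t l\<bar> \<le> (\<Sum>k'<m. \<bar>t k' * v k k' l\<bar>)"
      unfolding h_def by (rule sum_abs)
    also have "\<dots> \<le> (\<Sum>k'<m. r * H0)"
      using t H0' k r by (intro sum_mono) (auto simp: abs_mult intro!: mult_mono)
    also have "\<dots> \<le> r * H" using r by (simp add: H_def algebra_simps)
    finally show ?thesis .
  qed
  \<comment> \<open>The constants \<open>\<eta>\<close>, \<open>r\<close> and
    \<open>\<delta>\<close> make the linearisation error \<open>Suc n * \<eta> * d\<close> equal to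
    \<open>2 * \<delta>\<close>. Truncation and the almost isometry add \<open>\<delta>\<close>
    each. The total \<open>4 * \<delta>\<close> is \<open>r / (2 * Suc m)\<close>, small enough for
    the sum of \<open>m\<close> squares to stay below the square of \<open>r\<close>.\<close>
  define \<eta> where "\<eta> = 1 / (4 * real (Suc m) * real (Suc n) * H)"
  have \<eta>: "0 < \<eta>" using H by (simp add: \<eta>_def)
  obtain d where d: "0 < d" "\<And>k l g. k < m \<Longrightarrow> l < n \<Longrightarrow> \<bar>g\<bar> \<le> d \<Longrightarrow>
      \<bar>\<bar>w k l + g\<bar> powr p - \<bar>w k l\<bar> powr p - p * dpow p (w k l) * g\<bar> \<le> \<eta> * \<bar>g\<bar>"
    using abs_powr_expansion[OF p \<eta>, of "(\<lambda>(k, l). w k l) ` ({..<m} \<times> {..<n})"] by force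
  define r where "r = d / H"
  have r: "0 < r" "r * H = d" using d(1) H by (auto simp: r_def)
  define \<delta> where "\<delta> = r / (8 * real (Suc m))"
  have \<delta>: "0 < \<delta>" using r(1) by (simp add: \<delta>_def)
  have "eventually (\<lambda>N. \<forall>k\<in>{..<m}. dist (\<Sum>l<N. \<bar>w k l\<bar> powr p) (lp_norm p (w k) powr p) < \<delta>) sequentially"
    using sums \<delta> by (intro eventually_ball_finite ballI tendstoD) (auto simp: sums_def)
  then have "eventually (\<lambda>N. n \<le> N \<and> (\<forall>k\<in>{..<m}. dist (\<Sum>l<N. \<bar>w k l\<bar> powr p) (lp_norm p (w k) powr p) < \<delta>)) sequentially"
    using eventually_ge_at_top[of n] by eventually_elim auto
  then obtain N where N: "n \<le> N" "\<And>k. k < m \<Longrightarrow> \<bar>(\<Sum>l<N. \<bar>w k l\<bar> powr p) - lp_norm p (w k) powr p\<bar> < \<delta>"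
    by (auto simp: dist_real_def eventually_sequentially)
  obtain R where R: "0 \<le> R" "\<And>a. a \<in> {..<m} \<times> {..<N} \<Longrightarrow> \<bar>(\<lambda>(k, l). w k l) a\<bar> \<le> R"
    by (rule finite_family_bound[of "{..<m} \<times> {..<N}" "\<lambda>(k, l). w k l"]) auto
  obtain z :: "nat \<Rightarrow> 'z" where z: "\<And>a. (\<And>i. i < N \<Longrightarrow> \<bar>a i\<bar> \<le> R + d) \<Longrightarrow>
      \<bar>norm (\<Sum>i<N. a i *\<^sub>R z i) powr p - (\<Sum>i<N. \<bar>a i\<bar> powr p)\<bar> \<le> \<delta>"
    by (rule almost_isometric_lp_fin_powr[OF p Z \<delta>, of N "R + d"]) blast
  \<comment> \<open>A zero of \<open>G\<close> makes all distances exact at once.\<close>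
  define G where "G t k = norm (\<Sum>l<N. (w k l + h k t l) *\<^sub>R z l) powr p - lp_norm p (w k) powr p" for t k
  have near: "\<bar>G t k - t k\<bar> \<le> 4 * \<delta>" if k: "k < m" and t: "\<And>k'. k' < m \<Longrightarrow> \<bar>t k'\<bar> \<le> r" for t k
  proof -
    have h_d: "\<bar>h k t l\<bar> \<le> d" for l
      using h_le[OF k t] r by auto
    have "\<bar>w k l + h k t l\<bar> \<le> R + d" if "l < N" for l
      using R(2)[of "(k, l)"] h_d[of l] k that by auto
    then have 1: "\<bar>norm (\<Sum>l<N. (w k l + h k t l) *\<^sub>R z l) powr p - (\<Sum>l<N. \<bar>w k l + h k t l\<bar> powr p)\<bar> \<le> \<delta>"
      by (rule z)
    have h0: "h k t l = 0" if "\<not> l < n" for l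
      using that by (simp add: h_def v_def)
    have split: "(\<Sum>l<N. f l) = (\<Sum>l<n. f l) + (\<Sum>l=n..<N. f l)" for f :: "nat \<Rightarrow> real"
      using N(1) by (metis sum.atLeastLessThan_concat atLeast0LessThan le0)
    have "(\<Sum>l<N. \<bar>w k l + h k t l\<bar> powr p) - (\<Sum>l<N. \<bar>w k l\<bar> powr p) - t k
        = (\<Sum>l<n. \<bar>w k l + h k t l\<bar> powr p - \<bar>w k l\<bar> powr p - p * dpow p (w k l) * h k t l)"
      unfolding split sum_subtractf lin[OF k] by (simp add: h0)
    also have "\<bar>\<dots>\<bar> \<le> (\<Sum>l<n. \<eta> * d)"
    proof (rule order_trans[OF sum_abs], rule sum_mono)
      fix l assume "l \<in> {..<n}"
      then have "\<bar>\<bar>w k l + h k t l\<bar> powr p - \<bar>w k l\<bar> powr p - p * dpow p (w k l) * h k t l\<bar> \<le> \<eta> * \<bar>h k t l\<bar>"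
        using d(2)[OF k _ h_d] by auto
      also have "\<dots> \<le> \<eta> * d" using \<eta> h_d by (intro mult_left_mono) auto
      finally show "\<bar>\<bar>w k l + h k t l\<bar> powr p - \<bar>w k l\<bar> powr p - p * dpow p (w k l) * h k t l\<bar> \<le> \<eta> * d" .
    qed
    also have "\<dots> \<le> real (Suc n) * (\<eta> * d)"
      using \<eta> d(1) by (simp add: distrib_right)
    also have "\<dots> = 2 * \<delta>"
      using H r by (simp add: \<eta>_def \<delta>_def field_simps del: of_nat_Suc)
    finally have 2: "\<bar>(\<Sum>l<N. \<bar>w k l + h k t l\<bar> powr p) - (\<Sum>l<N. \<bar>w k l\<bar> powr p) - t k\<bar> \<le> 2 * \<delta>" .
    show ?thesis
      unfolding G_def using 1 2 N(2)[OF k] by linarith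
  qed
  have cont: "continuous_on A (\<lambda>t. G t k)" for A k
  proof -
    have "continuous_on A (\<lambda>t :: nat \<Rightarrow> real. t k')" for k'
      using continuous_on_product_coordinates by (rule continuous_on_subset) simp
    then show ?thesis
      unfolding G_def h_def using p by (intro continuous_intros continuous_on_powr') auto
  qed
  define B where "B = {t :: nat \<Rightarrow> real. (\<forall>i\<ge>m. t i = 0) \<and> (\<Sum>i<m. (t i)\<^sup>2) \<le> r\<^sup>2}"
  have B_le: "\<bar>t k\<bar> \<le> r" if "t \<in> B" "k < m" for t k
  proof -
    have "(t k)\<^sup>2 \<le> (\<Sum>i<m. (t i)\<^sup>2)"
      using that(2) by (intro member_le_sum) auto
    then have "(t k)\<^sup>2 \<le> r\<^sup>2" using that(1) by (simp add: B_def)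
    then show ?thesis using r(1) by (simp add: abs_le_square_iff[symmetric])
  qed
  have "\<exists>t\<in>B. \<forall>i<m. G t i = 0"
  proof (rule zero_of_almost_identity[OF r(1), of m G, folded B_def])
    show "continuous_on B (\<lambda>t. G t i)" for i by (rule cont)
    fix t assume tB: "t \<in> B"
    have "(\<Sum>i<m. (G t i - t i)\<^sup>2) \<le> (\<Sum>i<m. (4 * \<delta>)\<^sup>2)"
    proof (rule sum_mono)
      fix i assume "i \<in> {..<m}"
      then have "\<bar>G t i - t i\<bar> \<le> \<bar>4 * \<delta>\<bar>"
        using near[of i t] B_le[OF tB] \<delta> by simp
      then show "(G t i - t i)\<^sup>2 \<le> (4 * \<delta>)\<^sup>2"
        by (simp only: abs_le_square_iff)
    qed
    also have "\<dots> = real m * (r / (2 * real (Suc m)))\<^sup>2"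
    proof -
      have "4 * \<delta> = r / (2 * real (Suc m))"
        by (simp add: \<delta>_def field_simps del: of_nat_Suc)
      then show ?thesis by simp
    qed
    also have "\<dots> < (real (Suc m) * real (Suc m) * 4) * (r / (2 * real (Suc m)))\<^sup>2"
    proof (rule mult_strict_right_mono)
      show "real m < real (Suc m) * real (Suc m) * 4" by (simp add: algebra_simps add_pos_nonneg)
    qed (use r(1) in simp)
    also have "\<dots> = r\<^sup>2"
      by (simp add: power2_eq_square field_simps del: of_nat_Suc)
    finally show "(\<Sum>i<m. (G t i - t i)\<^sup>2) < r\<^sup>2" .
  qed
  then obtain t where t: "t \<in> B" "\<And>k. k < m \<Longrightarrow> G t k = 0" by blast
  \<comment> \<open>The moved points, cut off at coordinate \<open>N\<close> and carried over by the
    almost isometric copy; only the first \<open>n\<close> coordinates are moved.\<close>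
  define \<zeta> where "\<zeta> i = (\<Sum>l<N. (x i l + (if l < n then \<Sum>k'<m. t k' * V k' i l else 0)) *\<^sub>R z l)" for i
  show ?thesis
  proof (rule that)
    fix k assume k: "k < m"
    have "\<zeta> (fst (\<sigma> k)) - \<zeta> (snd (\<sigma> k)) = (\<Sum>l<N. (w k l + h k t l) *\<^sub>R z l)"
      unfolding \<zeta>_def sum_subtractf[symmetric] scaleR_diff_left[symmetric]
      by (intro sum.cong refl arg_cong2[of _ _ _ _ scaleR])
         (simp add: w_def h_def v_def right_diff_distrib sum_subtractf)
    then have "norm (\<zeta> (fst (\<sigma> k)) - \<zeta> (snd (\<sigma> k))) powr p = lp_norm p (w k) powr p"
      using t(2)[OF k] by (simp add: G_def)
    then have "(norm (\<zeta> (fst (\<sigma> k)) - \<zeta> (snd (\<sigma> k))) powr p) powr (1 / p) = (lp_norm p (w k) powr p) powr (1 / p)"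
      by simp
    then show "norm (\<zeta> (fst (\<sigma> k)) - \<zeta> (snd (\<sigma> k))) = lp_norm p (x (fst (\<sigma> k)) - x (snd (\<sigma> k)))"
      using p by (simp add: powr_powr w_eq[OF k] lp_norm_nonneg)
  qed
qed

subsection \<open>Regular tuples\<close>

text \<open>
  Row \<open>l\<close> of the matrix for \<open>i\<close> is, up to the factor \<open>p\<close>, the derivative of the \<open>p\<close>-th powers of the
  distances from \<open>x i\<close> to the \<open>k\<close> points following it, with respect to coordinate \<open>l\<close> of \<open>x i\<close>.
\<close>

definition dist_mat :: "real \<Rightarrow> (nat \<Rightarrow> nat \<Rightarrow> real) \<Rightarrow> nat \<Rightarrow> nat \<Rightarrow> real mat"
  where "dist_mat p x i k = Matrix.mat k k (\<lambda>(l, j). dpow p (x i l - x (Suc (i + j)) l))"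

text \<open>Grouping pairs by their smaller index makes the derivative block triangular. These are
  the diagonal blocks, cut down to as many coordinates as there are points after \<open>x i\<close>;
  for the last point the matrix is empty, with determinant 1.\<close>

definition regular :: "real \<Rightarrow> nat \<Rightarrow> (nat \<Rightarrow> nat \<Rightarrow> real) \<Rightarrow> bool"
  where "regular p n x \<longleftrightarrow> (\<forall>i<n. Determinant.det (dist_mat p x i (n - Suc i)) \<noteq> 0)"

lemma dist_mat_carrier: "dist_mat p x i k \<in> carrier_mat k k"
  by (simp add: dist_mat_def)

lemma left_inverse_entries:
  fixes A :: "real mat"
  assumes A: "A \<in> carrier_mat k k" and det: "Determinant.det A \<noteq> 0"
  obtains c where "\<And>j j'. j < k \<Longrightarrow> j' < k \<Longrightarrow> (\<Sum>l<k. c j l * A $$ (l, j')) = (if j = j' then 1 else 0)"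
proof (rule that)
  fix j j' assume j: "j < k" "j' < k"
  let ?d = "Determinant.det A"
  have adj: "adj_mat A \<in> carrier_mat k k" "adj_mat A * A = ?d \<cdot>\<^sub>m 1\<^sub>m k"
    using adj_mat[OF A] by auto
  have "(\<Sum>l<k. adj_mat A $$ (j, l) * A $$ (l, j')) = (adj_mat A * A) $$ (j, j')"
    using adj(1) A j by (simp add: scalar_prod_def atLeast0LessThan)
  also have "\<dots> = (if j = j' then ?d else 0)"
    using j by (simp add: adj(2))
  finally show "(\<Sum>l<k. (adj_mat A $$ (j, l) / ?d) * A $$ (l, j')) = (if j = j' then 1 else 0)"
    using det by (simp flip: sum_divide_distrib)
qed

text \<open>The derivative at \<open>x\<close>, in a direction \<open>v\<close> supported in the
  first \<open>n\<close> coordinates, of the \<open>p\<close>-th power of the distance between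
  points \<open>i\<close> and \<open>j\<close>.\<close>

definition dist_deriv :: "real \<Rightarrow> nat \<Rightarrow> (nat \<Rightarrow> nat \<Rightarrow> real) \<Rightarrow> (nat \<Rightarrow> nat \<Rightarrow> real) \<Rightarrow> nat \<Rightarrow> nat \<Rightarrow> real"
  where "dist_deriv p n x v i j = (\<Sum>l<n. p * dpow p (x i l - x j l) * (v i l - v j l))"

lemma dist_deriv_diff_sum:
  "dist_deriv p n x (\<lambda>i l. u i l - (\<Sum>a\<in>A. r a * v a i l)) i j
    = dist_deriv p n x u i j - (\<Sum>a\<in>A. r a * dist_deriv p n x (v a) i j)"
proof -
  have "(\<Sum>a\<in>A. r a * dist_deriv p n x (v a) i j)
      = (\<Sum>l<n. \<Sum>a\<in>A. r a * (p * dpow p (x i l - x j l) * (v a i l - v a j l)))"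
    unfolding dist_deriv_def sum_distrib_left by (rule sum.swap)
  also have "\<dots> = (\<Sum>l<n. p * dpow p (x i l - x j l) * ((\<Sum>a\<in>A. r a * v a i l) - (\<Sum>a\<in>A. r a * v a j l)))"
    by (intro sum.cong refl) (simp add: sum_distrib_left sum_subtractf right_diff_distrib left_diff_distrib mult_ac)
  finally have eq: "(\<Sum>a\<in>A. r a * dist_deriv p n x (v a) i j) = \<dots>" .
  define S where "S i l = (\<Sum>a\<in>A. r a * v a i l)" for i l
  show ?thesis
    unfolding eq unfolding dist_deriv_def S_def[symmetric] sum_subtractf[symmetric]
    by (intro sum.cong refl) (simp add: algebra_simps)
qed

text \<open>
  Moving \<open>x i\<close> alone changes the distances to later points in any prescribed way; the effect on the
  distances to earlier points is then compensated by the directions already constructed for these.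
\<close>

lemma regular_imp_directions:
  assumes p: "1 < p" and x: "regular p n x"
  shows "i < j \<Longrightarrow> j < n \<Longrightarrow> \<exists>v. \<forall>a b. a < b \<longrightarrow> b < n \<longrightarrow>
    dist_deriv p n x v a b = (if a = i \<and> b = j then 1 else 0)"
proof (induction i arbitrary: j rule: less_induct)
  case (less i)
  define k where "k = n - Suc i"
  have det: "Determinant.det (dist_mat p x i k) \<noteq> 0"
    using x less.prems by (simp add: regular_def k_def)
  obtain c where c: "\<And>j j'. j < k \<Longrightarrow> j' < k \<Longrightarrow>
      (\<Sum>l<k. c j l * dist_mat p x i k $$ (l, j')) = (if j = j' then 1 else 0)"
    by (rule left_inverse_entries[OF dist_mat_carrier det]) blast
  \<comment> \<open>A row of the inverse matrix gives the motion of \<open>x i\<close>; the division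
    by \<open>p\<close> cancels the factor in \<open>dist_deriv\<close>.\<close>
  define u where "u = (\<lambda>a l. if a = i \<and> l < k then c (j - Suc i) l / p else 0)"
  have u_i: "dist_deriv p n x u i b = (if b = j then 1 else 0)" if "i < b" "b < n" for b
  proof -
    have "dist_deriv p n x u i b = (\<Sum>l<k. p * dpow p (x i l - x b l) * (u i l - u b l))"
      unfolding dist_deriv_def using that
      by (intro sum.mono_neutral_right) (auto simp: u_def k_def)
    also have "\<dots> = (\<Sum>l<k. c (j - Suc i) l * dist_mat p x i k $$ (l, b - Suc i))"
      using that p by (intro sum.cong) (auto simp: u_def k_def dist_mat_def)
    also have "\<dots> = (if j - Suc i = b - Suc i then 1 else 0)"
      using that less.prems by (intro c) (auto simp: k_def)
    finally show ?thesis using that less.prems by auto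
  qed
  have u_0: "dist_deriv p n x u a b = 0" if "a \<noteq> i" "b \<noteq> i" for a b
    using that by (simp add: dist_deriv_def u_def)
  have "\<forall>a. \<exists>v. a < i \<longrightarrow> (\<forall>a' b'. a' < b' \<longrightarrow> b' < n \<longrightarrow>
      dist_deriv p n x v a' b' = (if a' = a \<and> b' = i then 1 else 0))"
    using less.IH[of _ i] less.prems by (metis less_trans)
  then obtain v where v: "\<And>a a' b'. a < i \<Longrightarrow> a' < b' \<Longrightarrow> b' < n \<Longrightarrow>
      dist_deriv p n x (v a) a' b' = (if a' = a \<and> b' = i then 1 else 0)"
    by metis
  \<comment> \<open>Each \<open>v a\<close> affects the pair \<open>(a, i)\<close> alone, so
    subtracting these multiples repairs the earlier pairs and leaves the later ones intact.\<close>
  let ?w = "\<lambda>b l. u b l - (\<Sum>a<i. dist_deriv p n x u a i * v a b l)"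
  have "dist_deriv p n x ?w a b = (if a = i \<and> b = j then 1 else 0)" if ab: "a < b" "b < n" for a b
  proof -
    have "(\<Sum>a'<i. dist_deriv p n x u a' i * dist_deriv p n x (v a') a b)
        = (\<Sum>a'<i. if a' = a then (if b = i then dist_deriv p n x u a i else 0) else 0)"
      using ab by (intro sum.cong refl) (auto simp: v)
    also have "\<dots> = (if a < i \<and> b = i then dist_deriv p n x u a i else 0)"
      by simp
    finally show ?thesis
      unfolding dist_deriv_diff_sum using ab u_i[of b] u_0[of a b] by (cases "a = i"; cases "b = i") auto
  qed
  then show ?case by blast
qed

proposition regular_tuple_embeds:
  fixes x :: "nat \<Rightarrow> nat \<Rightarrow> real"
  assumes p: "1 < p" and Z: "uniformly_contains_lp p (UNIV :: 'z::real_normed_vector set)"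
    and x: "x \<in> tuples n (lp_space p)" "inj_on x {..<n}" and reg: "regular p n x"
  shows "embeds_isometrically (x ` {..<n}) (\<lambda>u v. lp_norm p (u - v)) (UNIV :: 'z set)"
proof -
  define E where "E = {(i, j). i < j \<and> j < n}"
  have fin: "finite E"
    by (rule finite_subset[of _ "{..<n} \<times> {..<n}"]) (auto simp: E_def)
  define m where "m = card E"
  obtain \<sigma> where \<sigma>: "bij_betw \<sigma> {0..<m} E"
    using ex_bij_betw_nat_finite[OF fin] unfolding m_def by blast
  have \<sigma>_E: "fst (\<sigma> k) < snd (\<sigma> k) \<and> snd (\<sigma> k) < n" if "k < m" for k
  proof -
    have "\<sigma> k \<in> E" using bij_betwE[OF \<sigma>] that by simp
    then show ?thesis by (cases "\<sigma> k") (simp add: E_def)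
  qed
  have "\<exists>v. k < m \<longrightarrow> (\<forall>a b. a < b \<longrightarrow> b < n \<longrightarrow>
      dist_deriv p n x v a b = (if a = fst (\<sigma> k) \<and> b = snd (\<sigma> k) then 1 else 0))" for k
    using regular_imp_directions[OF p reg] \<sigma>_E[of k] by blast
  then obtain V where V: "\<And>k a b. k < m \<Longrightarrow> a < b \<Longrightarrow> b < n \<Longrightarrow>
      dist_deriv p n x (V k) a b = (if a = fst (\<sigma> k) \<and> b = snd (\<sigma> k) then 1 else 0)"
    by metis
  have inj: "fst (\<sigma> k) = fst (\<sigma> k') \<and> snd (\<sigma> k) = snd (\<sigma> k') \<longleftrightarrow> k = k'" if "k < m" "k' < m" for k k'
    using bij_betw_imp_inj_on[OF \<sigma>] that by (auto simp: inj_on_def prod_eq_iff)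
  obtain \<zeta> :: "nat \<Rightarrow> 'z" where \<zeta>: "\<And>k. k < m \<Longrightarrow>
      norm (\<zeta> (fst (\<sigma> k)) - \<zeta> (snd (\<sigma> k))) = lp_norm p (x (fst (\<sigma> k)) - x (snd (\<sigma> k)))"
  proof (rule embedding_of_regular_tuple[OF p Z, of n x m \<sigma> V])
    show "x i \<in> lp_space p" if "i < n" for i
      using x(1) that by (simp add: tuples_def)
    show "fst (\<sigma> k) < n \<and> snd (\<sigma> k) < n" if "k < m" for k
      using \<sigma>_E[OF that] by simp
    show "(\<Sum>l<n. p * dpow p (x (fst (\<sigma> k)) l - x (snd (\<sigma> k)) l) *
        (V k' (fst (\<sigma> k)) l - V k' (snd (\<sigma> k)) l)) = (if k = k' then 1 else 0)" if "k < m" "k' < m" for k k'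
      using V[OF that(2), of "fst (\<sigma> k)" "snd (\<sigma> k)"] \<sigma>_E[OF that(1)] inj[OF that]
      unfolding dist_deriv_def by simp
  qed blast
  have less: "norm (\<zeta> i - \<zeta> j) = lp_norm p (x i - x j)" if "i < j" "j < n" for i j
  proof -
    have "(i, j) \<in> \<sigma> ` {0..<m}"
      using bij_betw_imp_surj_on[OF \<sigma>] that by (auto simp: E_def)
    then obtain k where "k < m" "\<sigma> k = (i, j)" by auto
    with \<zeta>[of k] show ?thesis by simp
  qed
  have all: "norm (\<zeta> i - \<zeta> j) = lp_norm p (x i - x j)" if "i < n" "j < n" for i j
  proof -
    consider "i < j" | "j < i" | "i = j" by linarith
    then show ?thesis
    proof cases
      case 2
      then show ?thesis
        using less[of j i] that by (simp add: norm_minus_commute lp_norm_minus_commute)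
    next
      case 3
      have "lp_norm p 0 = 0" by (simp add: lp_norm_def)
      then show ?thesis using 3 by simp
    qed (use less that in auto)
  qed
  show ?thesis
    unfolding embeds_isometrically_def
    \<comment> \<open>The embedding must be a function of the points rather than of their indices;
      injectivity of \<open>x\<close> recovers the index.\<close>
    by (intro bexI[of _ "\<lambda>u. \<zeta> (the_inv_into {..<n} x u)"])
       (auto simp: the_inv_into_f_f[OF x(2)] dist_norm all)
qed

section \<open>Irregular tuples form a small set\<close>

subsection \<open>Almost every perturbation is regular\<close>

lemma dpow_inj:
  assumes p: "1 < p" and eq: "dpow p s = dpow p t"
  shows "s = t"
proof -
  have sgn: "sgn (dpow p u) = sgn u" for u
    by (cases "u = 0") (auto simp: dpow_def sgn_mult sgn_1_pos)
  have abs: "\<bar>dpow p u\<bar> powr (1 / (p - 1)) = \<bar>u\<bar>" for u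
    using p by (simp add: dpow_def abs_mult powr_powr abs_sgn_eq)
  have "sgn s * \<bar>s\<bar> = sgn t * \<bar>t\<bar>"
    using sgn[of s] sgn[of t] abs[of s] abs[of t] eq by simp
  then show ?thesis by (simp add: sgn_mult_abs)
qed

lemma isCont_dpow:
  assumes p: "1 < p"
  shows "isCont (dpow p) s"
proof (cases "s = 0")
  case True
  have "((\<lambda>h::real. \<bar>h\<bar> powr (p - 1)) \<longlongrightarrow> 0) (at 0)"
    using p by (intro tendsto_zero_powrI[OF _ tendsto_const]) (auto intro!: tendsto_eq_intros)
  moreover have "norm (dpow p h) \<le> \<bar>h\<bar> powr (p - 1)" for h
    by (simp add: dpow_def abs_mult abs_sgn_eq)
  ultimately have "(dpow p \<longlongrightarrow> 0) (at 0)"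
    by (intro Lim_null_comparison[of "dpow p"] always_eventually allI) auto
  then show ?thesis using True by (simp add: isCont_def dpow_def)
next
  case False
  then show ?thesis
    unfolding isCont_def dpow_def by (intro tendsto_intros) auto
qed

lemma borel_measurable_dpow:
  assumes p: "1 < p"
  shows "dpow p \<in> borel_measurable borel"
  using isCont_dpow[OF p] by (intro borel_measurable_continuous_onI continuous_at_imp_continuous_on) auto

text \<open>The Leibniz formula exhibits the determinant as a finite sum of products of
  \<open>dpow\<close> values, from which measurability and continuity follow.\<close>

lemma det_dist_mat:
  "Determinant.det (dist_mat p x i k) =
    (\<Sum>q | q permutes {0..<k}. signof q * (\<Prod>l=0..<k. dpow p (x i l - x (Suc (i + q l)) l)))"
  unfolding det_def'[OF dist_mat_carrier]
proof (intro sum.cong refl arg_cong2[of _ _ _ _ "(*)"] prod.cong)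
  fix q l assume "q \<in> {q. q permutes {0..<k}}" "l \<in> {0..<k}"
  then show "dist_mat p x i k $$ (l, q l) = dpow p (x i l - x (Suc (i + q l)) l)"
    using permutes_in_image[of q "{0..<k}" l] by (simp add: dist_mat_def)
qed

text \<open>Expanding along the last row, the determinant is affine in the last entry.\<close>

lemma det_zero_last_entry_unique:
  fixes A A' :: "real mat"
  assumes A: "A \<in> carrier_mat (Suc k) (Suc k)" "A' \<in> carrier_mat (Suc k) (Suc k)"
    and eq: "\<And>l j. l \<le> k \<Longrightarrow> j \<le> k \<Longrightarrow> l \<noteq> k \<or> j \<noteq> k \<Longrightarrow> A $$ (l, j) = A' $$ (l, j)"
    and zero: "Determinant.det A = 0" "Determinant.det A' = 0"
    and minor: "Determinant.det (mat_delete A k k) \<noteq> 0"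
  shows "A $$ (k, k) = A' $$ (k, k)"
proof -
  have del: "mat_delete A k j = mat_delete A' k j" for j
    using A eq by (intro eq_matI) (auto simp: mat_delete_def)
  have cof: "cofactor A k j = cofactor A' k j" for j
    by (simp add: cofactor_def del)
  have "0 = (\<Sum>j<Suc k. A $$ (k, j) * cofactor A k j) - (\<Sum>j<Suc k. A' $$ (k, j) * cofactor A' k j)"
    using laplace_expansion_row[OF A(1), of k] laplace_expansion_row[OF A(2), of k] zero by simp
  also have "\<dots> = (A $$ (k, k) - A' $$ (k, k)) * cofactor A k k"
    using eq by (simp add: cof algebra_simps)
  finally show ?thesis
    using minor by (simp add: cofactor_def)
qed

text \<open>Fubini, integrating the coordinate \<open>e\<close> first. It suffices that each fibre
  lies in a null set; in the application this is a singleton.\<close>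

lemma null_set_by_fibers:
  assumes M: "\<And>i. prob_space (M i)" and I: "finite I" "e \<in> I"
    and S: "S \<in> sets (Pi\<^sub>M I M)"
    and fib: "\<And>\<omega>. \<omega> \<in> space (Pi\<^sub>M (I - {e}) M) \<Longrightarrow> \<exists>N\<in>null_sets (M e). {y \<in> space (M e). fun_upd \<omega> e y \<in> S} \<subseteq> N"
  shows "S \<in> null_sets (Pi\<^sub>M I M)"
proof -
  interpret product_prob_space M by (rule product_prob_spaceI) (rule M)
  have I_eq: "insert e (I - {e}) = I" using I by auto
  have "emeasure (Pi\<^sub>M I M) S = (\<integral>\<^sup>+ \<omega>. indicator S \<omega> \<partial>Pi\<^sub>M (insert e (I - {e})) M)"
    unfolding I_eq using S by simp
  also have "\<dots> = (\<integral>\<^sup>+ \<omega>. (\<integral>\<^sup>+ y. indicator S (fun_upd \<omega> e y) \<partial>M e) \<partial>Pi\<^sub>M (I - {e}) M)"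
  proof (rule product_nn_integral_insert)
    show "indicator S \<in> borel_measurable (Pi\<^sub>M (insert e (I - {e})) M)"
      unfolding I_eq using S by simp
  qed (use I in auto)
  also have "\<dots> = (\<integral>\<^sup>+ \<omega>. 0 \<partial>Pi\<^sub>M (I - {e}) M)"
  proof (intro nn_integral_cong)
    fix \<omega> assume "\<omega> \<in> space (Pi\<^sub>M (I - {e}) M)"
    then obtain N where N: "N \<in> null_sets (M e)" "{y \<in> space (M e). fun_upd \<omega> e y \<in> S} \<subseteq> N"
      using fib by blast
    have "(\<integral>\<^sup>+ y. indicator S (fun_upd \<omega> e y) \<partial>M e) \<le> (\<integral>\<^sup>+ y. indicator N y \<partial>M e)"
      using N(2) by (intro nn_integral_mono) (auto simp: indicator_def)
    also have "\<dots> = emeasure (M e) N"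
      using N(1) by (intro nn_integral_indicator) auto
    also have "\<dots> = 0" using N(1) by auto
    finally show "(\<integral>\<^sup>+ y. indicator S (fun_upd \<omega> e y) \<partial>M e) = 0" by simp
  qed
  finally show ?thesis using S by auto
qed

definition grid :: "nat \<Rightarrow> (nat \<times> nat) set"
  where "grid n = {..<n} \<times> {..<n}"

definition grid_tuple :: "nat \<Rightarrow> (nat \<times> nat \<Rightarrow> real) \<Rightarrow> nat \<Rightarrow> nat \<Rightarrow> real"
  where "grid_tuple n \<omega> = (\<lambda>i l. if i < n \<and> l < n then \<omega> (i, l) else 0)"

lemma det_dist_mat_measurable:
  assumes p: "1 < p" and \<nu>: "sets \<nu> = sets borel"
  shows "(\<lambda>\<omega>. Determinant.det (dist_mat p (x + grid_tuple n \<omega>) i k)) \<in> borel_measurable (Pi\<^sub>M (grid n) (\<lambda>_. \<nu>))"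
proof -
  have comp: "(\<lambda>\<omega>. \<omega> a) \<in> borel_measurable (Pi\<^sub>M (grid n) (\<lambda>_. \<nu>))" if "a \<in> grid n" for a
    using measurable_component_singleton[OF that, of "\<lambda>_. \<nu>"] measurable_cong_sets[OF refl \<nu>] by blast
  have entry: "(\<lambda>\<omega>. (x + grid_tuple n \<omega>) a b) \<in> borel_measurable (Pi\<^sub>M (grid n) (\<lambda>_. \<nu>))" for a b
    using comp[of "(a, b)"] by (cases "a < n \<and> b < n") (auto simp: grid_tuple_def grid_def)
  have "(\<lambda>\<omega>. dpow p ((x + grid_tuple n \<omega>) a b - (x + grid_tuple n \<omega>) c d))
      \<in> borel_measurable (Pi\<^sub>M (grid n) (\<lambda>_. \<nu>))" for a b c d
    by (rule measurable_compose[OF borel_measurable_diff[OF entry entry] borel_measurable_dpow[OF p]])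
  then show ?thesis
    unfolding det_dist_mat
    by (intro borel_measurable_sum borel_measurable_times borel_measurable_const borel_measurable_prod)
qed

text \<open>Induction on the size of the matrix. Where the smaller determinant is nonzero, the
  larger one vanishes for at most one value of its last entry, and the law \<open>\<nu>\<close> has
  no atoms. The base point \<open>x\<close> is arbitrary because all translates have to be
  treated.\<close>

lemma AE_det_dist_mat:
  assumes p: "1 < p" and \<nu>: "prob_space \<nu>" "sets \<nu> = sets borel" "\<And>y. {y} \<in> null_sets \<nu>"
    and ik: "i + k < n"
  shows "AE \<omega> in Pi\<^sub>M (grid n) (\<lambda>_. \<nu>). Determinant.det (dist_mat p (x + grid_tuple n \<omega>) i k) \<noteq> 0"
  using ik
proof (induction k)
  case 0
  show ?case
    by (simp add: det_dist_mat)
next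
  case (Suc k)
  let ?P = "Pi\<^sub>M (grid n) (\<lambda>_. \<nu>)" and ?A = "\<lambda>k \<omega>. dist_mat p (x + grid_tuple n \<omega>) i k"
  \<comment> \<open>Coordinate \<open>k\<close> of point \<open>Suc (i + k)\<close> occurs only in
    the last entry of the larger matrix: the point determines the column and the coordinate
    determines the row.\<close>
  let ?e = "(Suc (i + k), k)"
  define S where "S = {\<omega> \<in> space ?P. Determinant.det (?A k \<omega>) \<noteq> 0 \<and> Determinant.det (?A (Suc k) \<omega>) = 0}"
  note [measurable] = det_dist_mat_measurable[OF p \<nu>(2)]
  have S: "S \<in> sets ?P" unfolding S_def by measurable
  have e: "?e \<in> grid n" using Suc.prems by (simp add: grid_def)
  have "S \<in> null_sets ?P"
  proof (rule null_set_by_fibers[OF \<nu>(1) _ e S])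
    show "finite (grid n)" by (simp add: grid_def)
    fix \<omega>
    have "y = y'" if y: "fun_upd \<omega> ?e y \<in> S" and y': "fun_upd \<omega> ?e y' \<in> S" for y y'
    proof -
      let ?B = "?A (Suc k) (fun_upd \<omega> ?e y)" and ?B' = "?A (Suc k) (fun_upd \<omega> ?e y')"
      have "mat_delete ?B k k = ?A k (fun_upd \<omega> ?e y)"
        by (rule eq_matI) (auto simp: mat_delete_def dist_mat_def)
      then have minor: "Determinant.det (mat_delete ?B k k) \<noteq> 0"
        using y by (simp add: S_def)
      have "?B $$ (k, k) = ?B' $$ (k, k)"
      proof (rule det_zero_last_entry_unique[OF dist_mat_carrier dist_mat_carrier _ _ _ minor])
        show "Determinant.det ?B = 0" "Determinant.det ?B' = 0"
          using y y' by (simp_all add: S_def)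
        show "?B $$ (l, j) = ?B' $$ (l, j)" if "l \<le> k" "j \<le> k" "l \<noteq> k \<or> j \<noteq> k" for l j
          using that by (auto simp: dist_mat_def grid_tuple_def)
      qed
      then have "(x + grid_tuple n (fun_upd \<omega> ?e y)) (Suc (i + k)) k = (x + grid_tuple n (fun_upd \<omega> ?e y')) (Suc (i + k)) k"
        using Suc.prems by (auto simp: dist_mat_def grid_tuple_def dest!: dpow_inj[OF p])
      then show ?thesis
        using Suc.prems by (simp add: grid_tuple_def)
    qed
    then have "\<exists>c. {y \<in> space \<nu>. fun_upd \<omega> ?e y \<in> S} \<subseteq> {c}"
      by blast
    then show "\<exists>N\<in>null_sets \<nu>. {y \<in> space \<nu>. fun_upd \<omega> ?e y \<in> S} \<subseteq> N"
      using \<nu>(3) by blast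
  qed
  then have "AE \<omega> in ?P. \<omega> \<notin> S" by (rule AE_not_in)
  moreover have "AE \<omega> in ?P. Determinant.det (?A k \<omega>) \<noteq> 0"
    using Suc.prems by (intro Suc.IH) simp
  ultimately show ?case
    using AE_space by eventually_elim (unfold S_def, blast)
qed

lemma AE_regular:
  assumes p: "1 < p" and \<nu>: "prob_space \<nu>" "sets \<nu> = sets borel" "\<And>y. {y} \<in> null_sets \<nu>"
  shows "AE \<omega> in Pi\<^sub>M (grid n) (\<lambda>_. \<nu>). regular p n (x + grid_tuple n \<omega>)"
proof -
  have "AE \<omega> in Pi\<^sub>M (grid n) (\<lambda>_. \<nu>). \<forall>i\<in>{..<n}. Determinant.det (dist_mat p (x + grid_tuple n \<omega>) i (n - Suc i)) \<noteq> 0"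
    using AE_det_dist_mat[OF p \<nu>] by (intro AE_finite_allI) auto
  then show ?thesis by eventually_elim (simp add: regular_def)
qed

subsection \<open>The set of irregular tuples\<close>

lemma sum_powr_le_powr_sum:
  fixes f :: "nat \<Rightarrow> real"
  assumes p: "1 < p" and f: "\<And>l. 0 \<le> f l"
  shows "(\<Sum>l<n. f l powr p) \<le> (\<Sum>l<n. f l) powr p"
proof (induction n)
  case (Suc n)
  then show ?case
    using powr_add_le_add_powr[of p "\<Sum>l<n. f l" "f n"] p f by (simp add: sum_nonneg)
qed simp

lemma lp_norm_finite_support:
  assumes p: "1 < p" and y: "\<And>l. n \<le> l \<Longrightarrow> y l = 0"
  shows "y \<in> lp_space p" "lp_norm p y \<le> (\<Sum>l<n. \<bar>y l\<bar>)"
proof -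
  show "y \<in> lp_space p"
    unfolding lp_space_iff by (rule summable_finite[of "{..<n}"]) (auto simp: y)
  have "suminf (\<lambda>l. \<bar>y l\<bar> powr p) = (\<Sum>l<n. \<bar>y l\<bar> powr p)"
    by (rule suminf_finite) (auto simp: y)
  also have "\<dots> \<le> (\<Sum>l<n. \<bar>y l\<bar>) powr p"
    by (rule sum_powr_le_powr_sum[OF p]) simp
  finally have "lp_norm p y \<le> ((\<Sum>l<n. \<bar>y l\<bar>) powr p) powr (1 / p)"
    unfolding lp_norm_def using p \<open>y \<in> lp_space p\<close>
    by (intro powr_mono2) (auto intro!: suminf_nonneg simp: lp_space_iff)
  also have "\<dots> = (\<Sum>l<n. \<bar>y l\<bar>)"
    using p by (simp add: powr_powr sum_nonneg)
  finally show "lp_norm p y \<le> (\<Sum>l<n. \<bar>y l\<bar>)" .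
qed

lemma abs_coordinate_le_lp_norm:
  assumes p: "1 < p" and y: "y \<in> lp_space p"
  shows "\<bar>y l\<bar> \<le> lp_norm p y"
proof -
  have "(\<Sum>i\<in>{l}. \<bar>y i\<bar> powr p) \<le> suminf (\<lambda>i. \<bar>y i\<bar> powr p)"
    using y by (intro sum_le_suminf) (auto simp: lp_space_iff)
  then have "(\<bar>y l\<bar> powr p) powr (1 / p) \<le> lp_norm p y"
    unfolding lp_norm_def using p by (intro powr_mono2) auto
  then show ?thesis using p by (simp add: powr_powr)
qed

lemma grid_tuple_mem: "1 < p \<Longrightarrow> grid_tuple n \<omega> \<in> tuples n (lp_space p)"
  by (auto simp: tuples_def grid_tuple_def fun_eq_iff intro!: lp_norm_finite_support(1)[of p n])

lemma tuple_norm_grid_tuple_le: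
  assumes p: "1 < p"
  shows "tuple_norm n (lp_norm p) (grid_tuple n \<omega> - grid_tuple n \<omega>') \<le> (\<Sum>i<n. \<Sum>l<n. \<bar>\<omega> (i, l) - \<omega>' (i, l)\<bar>)"
  unfolding tuple_norm_def
proof (rule sum_mono)
  fix i assume i: "i \<in> {..<n}"
  have "lp_norm p ((grid_tuple n \<omega> - grid_tuple n \<omega>') i) \<le> (\<Sum>l<n. \<bar>(grid_tuple n \<omega> - grid_tuple n \<omega>') i l\<bar>)"
    by (rule lp_norm_finite_support(2)[OF p]) (simp add: grid_tuple_def)
  also have "\<dots> = (\<Sum>l<n. \<bar>\<omega> (i, l) - \<omega>' (i, l)\<bar>)"
    using i by (intro sum.cong) (auto simp: grid_tuple_def)
  finally show "lp_norm p ((grid_tuple n \<omega> - grid_tuple n \<omega>') i) \<le> (\<Sum>l<n. \<bar>\<omega> (i, l) - \<omega>' (i, l)\<bar>)" .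
qed

section \<open>Topology and measure of the irregular set\<close>

context
  fixes p :: real and n :: nat
  assumes p: "1 < p"
begin

interpretation Metric_space "tuples n (lp_space p)" "\<lambda>x y. tuple_norm n (lp_norm p) (x - y)"
  using p by (rule Metric_space_lp_tuples)

abbreviation (input) "V \<equiv> tuples n (lp_space p)"
abbreviation (input) "N \<equiv> tuple_norm n (lp_norm p)"

lemma tendsto_coordinate:
  assumes lim: "limitin (norm_topology V N) s u sequentially" and s: "range s \<subseteq> V" and i: "i < n"
  shows "(\<lambda>m. s m i l) \<longlonglongrightarrow> u i l"
proof -
  have u: "u \<in> V" and lim': "\<And>\<epsilon>. 0 < \<epsilon> \<Longrightarrow> eventually (\<lambda>m. s m \<in> V \<and> N (s m - u) < \<epsilon>) sequentially"
    using lim unfolding norm_topology_def limitin_metric by auto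
  have le: "\<bar>s m i l - u i l\<bar> \<le> N (s m - u)" for m
  proof -
    have "s m \<in> V" using s by blast
    then have "s m i - u i \<in> lp_space p"
      using u i by (intro subspace_diff[OF subspace_lp_space[OF p]]) (auto simp: tuples_def)
    then have "\<bar>(s m i - u i) l\<bar> \<le> lp_norm p (s m i - u i)"
      by (rule abs_coordinate_le_lp_norm[OF p])
    also have "\<dots> = lp_norm p ((s m - u) i)" by simp
    also have "\<dots> \<le> N (s m - u)"
      unfolding tuple_norm_def using i by (intro member_le_sum) (auto simp: lp_norm_nonneg)
    finally show ?thesis by simp
  qed
  show ?thesis
  proof (rule tendstoI)
    fix \<epsilon> :: real assume "0 < \<epsilon>"
    from lim'[OF this] show "eventually (\<lambda>m. dist (s m i l) (u i l) < \<epsilon>) sequentially"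
      by eventually_elim (use le in \<open>auto simp: dist_real_def intro: le_less_trans\<close>)
  qed
qed

text \<open>Regularity involves finitely many determinants, each continuous in finitely many
  coordinates. The shift by \<open>y\<close> is built in because Haar nullity needs every translate
  to be measurable.\<close>

lemma closedin_irregular: "closedin (norm_topology V N) {u \<in> V. \<not> regular p n (u - y)}"
  unfolding norm_topology_def metric_closedin_iff_sequentially_closed
proof (intro conjI allI impI)
  fix s u assume *: "range s \<subseteq> {u \<in> V. \<not> regular p n (u - y)} \<and> limitin mtopology s u sequentially"
  then have s: "range s \<subseteq> V" and irr: "\<And>m. \<not> regular p n (s m - y)" and u: "u \<in> V"
    and lim: "limitin (norm_topology V N) s u sequentially"
    by (auto simp: limitin_metric norm_topology_def)
  have "\<not> regular p n (u - y)"
  proof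
    assume reg: "regular p n (u - y)"
    have "eventually (\<lambda>m. Determinant.det (dist_mat p (s m - y) i (n - Suc i)) \<noteq> 0) sequentially" if i: "i < n" for i
    proof (rule tendsto_imp_eventually_ne)
      have entry: "(\<lambda>m. dpow p ((s m - y) i l - (s m - y) (Suc (i + j)) l))
          \<longlonglongrightarrow> dpow p ((u - y) i l - (u - y) (Suc (i + j)) l)" if "Suc (i + j) < n" for j l
        using tendsto_coordinate[OF lim s i] tendsto_coordinate[OF lim s that]
        by (intro isCont_tendsto_compose[OF isCont_dpow[OF p]]) (auto intro!: tendsto_intros)
      show "(\<lambda>m. Determinant.det (dist_mat p (s m - y) i (n - Suc i)))
          \<longlonglongrightarrow> Determinant.det (dist_mat p (u - y) i (n - Suc i))"
        unfolding det_dist_mat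
      proof (intro tendsto_sum tendsto_mult tendsto_const tendsto_prod entry)
        fix q l assume "q \<in> {q. q permutes {0..<n - Suc i}}" "l \<in> {0..<n - Suc i}"
        then have "q l < n - Suc i"
          using permutes_in_image[of q "{0..<n - Suc i}" l] by simp
        then show "Suc (i + q l) < n" by linarith
      qed
      show "Determinant.det (dist_mat p (u - y) i (n - Suc i)) \<noteq> 0"
        using reg i by (simp add: regular_def)
    qed
    then have "eventually (\<lambda>m. \<forall>i\<in>{..<n}. Determinant.det (dist_mat p (s m - y) i (n - Suc i)) \<noteq> 0) sequentially"
      by (intro eventually_ball_finite) auto
    then show False
      using irr by (auto simp: regular_def eventually_sequentially)
  qed
  with u show "u \<in> {u \<in> V. \<not> regular p n (u - y)}" by simp
qed auto

lemma space_norm_borel: "space (norm_borel V N) = V"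
  by (simp add: norm_borel_def space_measure_of_conv)

lemma closedin_imp_norm_borel:
  assumes "closedin (norm_topology V N) A"
  shows "A \<in> sets (norm_borel V N)"
proof -
  have A: "A \<subseteq> V" "openin (norm_topology V N) (V - A)"
    using assms by (auto simp: closedin_def norm_topology_def)
  have "{U. openin (norm_topology V N) U} \<subseteq> Pow V"
    using openin_subset[of mtopology] by (auto simp: norm_topology_def)
  then have "V - A \<in> sets (norm_borel V N)"
    using A(2) unfolding norm_borel_def by (simp add: sigma_sets.Basic)
  then have "space (norm_borel V N) - (V - A) \<in> sets (norm_borel V N)"
    by (rule sets.compl_sets)
  moreover have "V - (V - A) = A" using A(1) by blast
  ultimately show ?thesis by (simp add: space_norm_borel)
qed

lemma open_grid_preimage:
  assumes "openin (norm_topology V N) U"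
  shows "open {w :: nat \<times> nat \<Rightarrow> real. grid_tuple n w \<in> U}"
proof (subst open_subopen, rule ballI)
  fix w assume "w \<in> {w :: nat \<times> nat \<Rightarrow> real. grid_tuple n w \<in> U}"
  then obtain r where r: "0 < r" "mball (grid_tuple n w) r \<subseteq> U"
    using assms unfolding norm_topology_def openin_mtopology by blast
  let ?T = "{w'. (\<Sum>i<n. \<Sum>l<n. \<bar>w (i, l) - w' (i, l)\<bar>) < r}"
  have coord: "continuous_on UNIV (\<lambda>w' :: nat \<times> nat \<Rightarrow> real. w' e)" for e
    by (rule continuous_on_product_coordinates)
  have "open ?T"
    by (intro open_Collect_less continuous_intros coord)
  moreover have "w \<in> ?T" using r(1) by simp
  moreover have "?T \<subseteq> {w. grid_tuple n w \<in> U}"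
  proof
    fix w' assume "w' \<in> ?T"
    then have "N (grid_tuple n w - grid_tuple n w') < r"
      using tuple_norm_grid_tuple_le[OF p, of n w w'] by simp
    then have "grid_tuple n w' \<in> mball (grid_tuple n w) r"
      by (simp add: grid_tuple_mem[OF p])
    then show "w' \<in> {w. grid_tuple n w \<in> U}" using r(2) by blast
  qed
  ultimately show "\<exists>T. open T \<and> w \<in> T \<and> T \<subseteq> {w. grid_tuple n w \<in> U}" by blast
qed

lemma grid_tuple_measurable:
  assumes \<nu>: "sets \<nu> = sets (borel :: real measure)"
  shows "grid_tuple n \<in> measurable (Pi\<^sub>M (grid n) (\<lambda>_. \<nu>)) (norm_borel V N)"
  unfolding norm_borel_def
proof (rule measurable_measure_of)
  let ?P = "Pi\<^sub>M (grid n) (\<lambda>_. \<nu>)"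
  \<comment> \<open>Extending by 0 off the grid leads to functions on all pairs of indices, for
    which the product sigma-algebra is the Borel sigma-algebra of the product topology.\<close>
  let ?ext = "\<lambda>\<omega> e. if e \<in> grid n then \<omega> e else 0 :: real"
  show "{U. openin (norm_topology V N) U} \<subseteq> Pow V"
    using openin_subset[of mtopology] by (auto simp: norm_topology_def)
  show "grid_tuple n \<in> space ?P \<rightarrow> V"
    using grid_tuple_mem[OF p] by blast
  fix U assume "U \<in> {U. openin (norm_topology V N) U}"
  then have "{w :: nat \<times> nat \<Rightarrow> real. grid_tuple n w \<in> U} \<in> sets borel"
    using open_grid_preimage by auto
  then have W: "{w :: nat \<times> nat \<Rightarrow> real. grid_tuple n w \<in> U} \<in> sets (Pi\<^sub>M UNIV (\<lambda>_. borel))"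
    by (simp add: sets_PiM_equal_borel)
  have comp: "(\<lambda>\<omega>. \<omega> e) \<in> borel_measurable ?P" if "e \<in> grid n" for e
    using measurable_component_singleton[OF that, of "\<lambda>_. \<nu>"] measurable_cong_sets[OF refl \<nu>] by blast
  have "?ext \<in> measurable ?P (Pi\<^sub>M UNIV (\<lambda>_. borel))"
  proof (rule measurable_PiM_single')
    show "(\<lambda>\<omega>. if e \<in> grid n then \<omega> e else 0) \<in> borel_measurable ?P" for e
      using comp by (cases "e \<in> grid n") auto
  qed auto
  from measurable_sets[OF this W] show "grid_tuple n -` U \<inter> space ?P \<in> sets ?P"
  proof (rule back_subst[of "\<lambda>A. A \<in> sets ?P"])
    have "grid_tuple n (?ext \<omega>) = grid_tuple n \<omega>" for \<omega>
      by (auto simp: grid_tuple_def grid_def fun_eq_iff)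
    then show "?ext -` {w. grid_tuple n w \<in> U} \<inter> space ?P = grid_tuple n -` U \<inter> space ?P" by auto
  qed
qed

text \<open>The coordinate law of the random perturbation: \<open>d = 1\<close> serves for Haar
  nullity, small \<open>d\<close> for density.\<close>

lemma
  fixes d :: real
  assumes d: "0 < d"
  defines "\<nu> \<equiv> uniform_measure lborel {0..d}"
  shows prob_space_uniform_Icc: "prob_space \<nu>"
    and null_sets_uniform_Icc: "{y} \<in> null_sets \<nu>"
    and AE_uniform_Icc: "AE y in \<nu>. y \<in> {0..d}"
proof -
  have pos: "emeasure lborel {0..d} \<noteq> 0" "emeasure lborel {0..d} \<noteq> \<infinity>"
    using d by auto
  show "prob_space \<nu>"
    unfolding \<nu>_def by (rule prob_space_uniform_measure[OF pos])
  have "emeasure lborel ({0..d} \<inter> {y}) \<le> emeasure lborel {y}"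
    by (rule emeasure_mono) auto
  then have "emeasure lborel ({0..d} \<inter> {y}) = 0" by simp
  then show "{y} \<in> null_sets \<nu>"
    unfolding \<nu>_def by (auto simp: null_sets_def)
  show "AE y in \<nu>. y \<in> {0..d}"
    unfolding \<nu>_def by (rule AE_uniform_measureI) auto
qed

text \<open>The test measure is the law of the random grid tuple. A translate by \<open>y\<close> is
  null because the random tuple shifted by \<open>- y\<close> is almost surely regular.\<close>

lemma borel_haar_null_irregular: "borel_haar_null V N {u \<in> V. \<not> regular p n u}"
  unfolding borel_haar_null_def
proof (intro conjI exI ballI)
  show "{u \<in> V. \<not> regular p n u} \<in> sets (norm_borel V N)"
    using closedin_irregular[of 0] by (intro closedin_imp_norm_borel) simp
  define \<nu> :: "real measure" where "\<nu> = uniform_measure lborel {0..1}"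
  have \<nu>: "prob_space \<nu>" "sets \<nu> = sets borel" "\<And>y. {y} \<in> null_sets \<nu>"
    unfolding \<nu>_def by (auto intro: prob_space_uniform_Icc null_sets_uniform_Icc)
  let ?P = "Pi\<^sub>M (grid n) (\<lambda>_. \<nu>)"
  let ?\<mu> = "distr ?P (norm_borel V N) (grid_tuple n)"
  have meas: "grid_tuple n \<in> measurable ?P (norm_borel V N)"
    by (rule grid_tuple_measurable[OF \<nu>(2)])
  show "prob_space ?\<mu>"
    by (intro prob_space.prob_space_distr prob_space_PiM \<nu>(1) meas)
  show "sets ?\<mu> = sets (norm_borel V N)" by simp
  fix y assume y: "y \<in> V"
  note sub = subspace_tuples[OF subspace_lp_space[OF p]]
  have "(+) y ` {u \<in> V. \<not> regular p n u} = {u \<in> V. \<not> regular p n (u - y)}"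
  proof (intro subset_antisym subsetI)
    fix u assume "u \<in> {u \<in> V. \<not> regular p n (u - y)}"
    then show "u \<in> (+) y ` {u \<in> V. \<not> regular p n u}"
      using subspace_diff[OF sub _ y] by (intro image_eqI[of _ _ "u - y"]) auto
  qed (use subspace_add[OF sub y] in auto)
  moreover have "{u \<in> V. \<not> regular p n (u - y)} \<in> null_sets ?\<mu>"
    unfolding null_sets_distr_iff[OF meas]
  proof
    show mem: "{u \<in> V. \<not> regular p n (u - y)} \<in> sets (norm_borel V N)"
      by (rule closedin_imp_norm_borel[OF closedin_irregular])
    show "grid_tuple n -` {u \<in> V. \<not> regular p n (u - y)} \<inter> space ?P \<in> null_sets ?P"
      unfolding AE_iff_null_sets[OF measurable_sets[OF meas mem]]
      using AE_regular[OF p \<nu>, of n "- y"] by eventually_elim auto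
  qed
  ultimately show "(+) y ` {u \<in> V. \<not> regular p n u} \<in> null_sets ?\<mu>" by simp
qed

text \<open>An event of probability one is nonempty, so random perturbation within a small cube
  yields density of the regular tuples.\<close>

lemma regular_perturbation:
  assumes x: "x \<in> V" and r: "0 < r"
  shows "\<exists>u\<in>V. N (x - u) < r \<and> regular p n u"
proof -
  \<comment> \<open>There are \<open>n * n\<close> perturbed coordinates, each of size at most
    \<open>d\<close>; the summand 1 makes the final inequality strict and covers
    \<open>n = 0\<close>.\<close>
  define d where "d = r / (1 + real n * real n)"
  have pos: "0 < 1 + real n * real n" by (simp add: add_pos_nonneg)
  have d: "0 < d" using r pos by (simp add: d_def)
  define \<nu> :: "real measure" where "\<nu> = uniform_measure lborel {0..d}"
  have \<nu>: "prob_space \<nu>" "sets \<nu> = sets borel" "\<And>y. {y} \<in> null_sets \<nu>"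
    unfolding \<nu>_def using d by (auto intro: prob_space_uniform_Icc null_sets_uniform_Icc)
  let ?P = "Pi\<^sub>M (grid n) (\<lambda>_. \<nu>)"
  have "AE \<omega> in ?P. \<omega> e \<in> {0..d}" if "e \<in> grid n" for e
    using that \<nu>(1) AE_uniform_Icc[OF d] unfolding \<nu>_def by (intro AE_PiM_component) auto
  then have "AE \<omega> in ?P. \<forall>e\<in>grid n. \<omega> e \<in> {0..d}"
    by (intro AE_finite_allI) (auto simp: grid_def)
  then have "AE \<omega> in ?P. (\<forall>e\<in>grid n. \<omega> e \<in> {0..d}) \<and> regular p n (x + grid_tuple n \<omega>)"
    using AE_regular[OF p \<nu>, of n x] by eventually_elim auto
  then obtain \<omega> where \<omega>: "\<forall>e\<in>grid n. \<omega> e \<in> {0..d}" "regular p n (x + grid_tuple n \<omega>)"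
    using eventually_happens'[OF prob_space.ae_filter_bot[OF prob_space_PiM[OF \<nu>(1)]]] by blast
  have "grid_tuple n (\<lambda>_. 0) = 0" by (auto simp: grid_tuple_def fun_eq_iff)
  then have "N (x - (x + grid_tuple n \<omega>)) \<le> (\<Sum>i<n. \<Sum>l<n. \<bar>0 - \<omega> (i, l)\<bar>)"
    using tuple_norm_grid_tuple_le[OF p, of n "\<lambda>_. 0" \<omega>] by simp
  also have "\<dots> \<le> (\<Sum>i<n. \<Sum>l<n. d)"
    using \<omega>(1) by (intro sum_mono) (auto simp: grid_def)
  also have "\<dots> < (1 + real n * real n) * d"
    using d by (simp add: distrib_right)
  also have "\<dots> = r" using pos by (simp add: d_def)
  finally have "N (x - (x + grid_tuple n \<omega>)) < r" .
  moreover have "x + grid_tuple n \<omega> \<in> V"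
    using x grid_tuple_mem[OF p] by (rule subspace_add[OF subspace_tuples[OF subspace_lp_space[OF p]]])
  ultimately show ?thesis using \<omega>(2) by blast
qed

text \<open>The closure of \<open>A\<close> stays in the closed set of irregular tuples, whereas
  every ball contains a regular tuple.\<close>

lemma nowhere_dense_irregular:
  assumes A: "A \<subseteq> {u \<in> V. \<not> regular p n u}"
  shows "nowhere_dense_in (norm_topology V N) A"
  unfolding nowhere_dense_in_def
proof
  show "A \<subseteq> topspace (norm_topology V N)"
    using A by (auto simp: norm_topology_def)
  let ?T = "norm_topology V N"
  have "?T closure_of A \<subseteq> {u \<in> V. \<not> regular p n u}"
    using A closedin_irregular[of 0] by (intro closure_of_minimal) auto
  then have int: "?T interior_of (?T closure_of A) \<subseteq> {u \<in> V. \<not> regular p n u}"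
    by (rule order_trans[OF interior_of_subset])
  have "openin ?T (?T interior_of (?T closure_of A))" by simp
  then have ball: "\<exists>r>0. mball x r \<subseteq> ?T interior_of (?T closure_of A)"
    if "x \<in> ?T interior_of (?T closure_of A)" for x
    using that unfolding norm_topology_def openin_mtopology by blast
  show "?T interior_of (?T closure_of A) = {}"
  proof (rule equals0I)
    fix x assume x: "x \<in> ?T interior_of (?T closure_of A)"
    obtain r where r: "0 < r" "mball x r \<subseteq> ?T interior_of (?T closure_of A)"
      using ball[OF x] by blast
    have xV: "x \<in> V" using int x by blast
    obtain u where "u \<in> V" "N (x - u) < r" "regular p n u"
      using regular_perturbation[OF xV r(1)] by blast
    then have "u \<in> mball x r" using xV by simp
    then show False using r(2) int \<open>regular p n u\<close> by blast
  qed
qed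

end

theorem theorem1p3:
  fixes p :: real and n :: nat
  assumes "1 < p"
    and "uniformly_contains_lp p (UNIV :: 'z::banach set)"
  shows "nowhere_dense_in (norm_topology (tuples n (lp_space p)) (tuple_norm n (lp_norm p)))
      (nonembeddable_tuples p n (UNIV :: 'z set)) \<and>
    haar_null (tuples n (lp_space p)) (tuple_norm n (lp_norm p))
      (nonembeddable_tuples p n (UNIV :: 'z set))"
proof -
  \<comment> \<open>Both notions of smallness pass to subsets, so the contrapositive of
    \<open>regular_tuple_embeds\<close> suffices.\<close>
  have sub: "nonembeddable_tuples p n (UNIV :: 'z set) \<subseteq> {u \<in> tuples n (lp_space p). \<not> regular p n u}"
    using regular_tuple_embeds[OF assms, of _ n] unfolding nonembeddable_tuples_def by blast
  then show ?thesis
    unfolding haar_null_def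
    using nowhere_dense_irregular[OF assms(1)] borel_haar_null_irregular[OF assms(1)] by blast
qed

end
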